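(* Let $q\in\mathbb{C}\setminus\{0\}$ be not a root of $1$. (i) There exist no $U_q(\mathfrak{sl}_2)$-symmetries on $\operatorname{Pol}(\mathbb{D})_q$ with grading jump $\operatorname{GJ}=n>1$. (ii) With $\operatorname{GJ}=1$, there exist two 2-parameter series of $U_q(\mathfrak{sl}_2)$-symmetries on $\operatorname{Pol}(\mathbb{D})_q$ as follows. $(1a)$, for $b_0,b_1\in\mathbb{C}$ with $b_0\ne 0$: $$\pi(\mathsf{k})(z)=q^2z,\qquad \pi(\mathsf{k})(z^* )=q^{-2}z^*,$$ $$\pi(\mathsf{e})(y)=q^{-1}b_0^{-1}zy,\qquad \pi(\mathsf{f})(y)=(b_0y+b_1y^2)z^*,$$ $$\pi(\mathsf{e})(z)=qb_0^{-1}z^2,\qquad \pi(\mathsf{f})(z)=-b_0-b_1y^2,$$ $$\pi(\mathsf{e})(z^* )=-q^{-1}b_0^{-1},\qquad \pi(\mathsf{f})(z^* )=q^2b_0z^{*2}.$$ $(1b)$, for $a_0,a_1\in\mathbb{C}$ with $a_0\ne 0$: $$\pi(\mathsf{k})(z)=q^2z,\qquad \pi(\mathsf{k})(z^* )=q^{-2}z^*,$$ $$\pi(\mathsf{e})(y)=z(a_0y+a_1y^2),\qquad \pi(\mathsf{f})(y)=q^{-1}a_0^{-1}yz^*,$$ $$\pi(\mathsf{e})(z)=q^2a_0z^2,\qquad \pi(\mathsf{f})(z)=-q^{-1}a_0^{-1},$$ $$\pi(\mathsf{e})(z^* )=-a_0-a_1y^2,\qquad \pi(\mathsf{f})(z^*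 )=qa_0^{-1}z^{*2}.$$
   Context: The ground field is $\mathbb{C}$. The quantum disc $\operatorname{Pol}(\mathbb{D})_q$ is the unital $\mathbb{C}$-algebra generated by $z,z^*$ subject to the single relation $zz^*=q^2z^*z+1-q^2$; it is considered as an algebra without involution, so $z^*$ is just a symbol for a second generator, and $z^{*j}=(z^* )^j$. Put $y=1-zz^*$. The algebra is graded, $\operatorname{Pol}(\mathbb{D})_q=\bigoplus_{k\in\mathbb{Z}}\mathcal{A}_k$, where $\mathcal{A}_k$ is the linear span of $\{z^iz^{*j} : i-j=k\}$. $U_q(\mathfrak{sl}_2)$ is the unital associative algebra generated by $\mathsf{k},\mathsf{k}^{-1},\mathsf{e},\mathsf{f}$ subject to $\mathsf{k}^{-1}\mathsf{k}=\mathsf{k}\mathsf{k}^{-1}=\mathbf{1}$, $\mathsf{ke}=q^2\mathsf{ek}$, $\mathsf{kf}=q^{-2}\mathsf{fk}$, $\mathsf{ef}-\mathsf{fe}=\frac{\mathsf{k}-\mathsf{k}^{-1}}{q-q^{-1}}$, with Hopf algebra structure $\Delta(\mathsf{k})=\mathsf{k}\otimes\mathsf{k}$, $\Delta(\mathsf{e})=\mathbf{1}\otimes\mathsf{e}+\mathsf{e}\otimes\mathsf{k}$, $\Delta(\mathsf{f})=\mathsf{f}\otimes\mathbf{1}+\mathsf{k}^{-1}\otimes\mathsf{f}$, $\mathsf{S}(\mathsf{k})=\mathsf{k}^{-1}$, $\mathsf{S}(\mathsf{e})=-\mathsf{ek}^{-1}$, $\mathsf{S}(\mathsf{f})=-\mathsf{kf}$,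 $\varepsilon(\mathsf{k})=1$, $\varepsilon(\mathsf{e})=\varepsilon(\mathsf{f})=0$. For a Hopf algebra $H$ and a unital algebra $A$, an $H$-symmetry on $A$ is a homomorphism of algebras $\pi:H\to\operatorname{End}_{\mathbb{C}}A$ such that $\pi(h)(ab)=\sum_{(h)}\pi(h_{(1)})(a)\,\pi(h_{(2)})(b)$ and $\pi(h)(\mathbf{1})=\varepsilon(h)\mathbf{1}$ for all $h\in H$, $a,b\in A$. A symmetry is described by the action of the generators of $U_q(\mathfrak{sl}_2)$ on the generators $z,z^*$, which extends uniquely to everything. Grading jump: for every $U_q(\mathfrak{sl}_2)$-symmetry $\pi$ on $\operatorname{Pol}(\mathbb{D})_q$, if $\pi(\mathsf{e})$ and $\pi(\mathsf{f})$ are not both identically zero, then there is a unique non-zero integer $n$ such that $\pi(\mathsf{e})\mathcal{A}_k\subset\mathcal{A}_{k+n}$ and $\pi(\mathsf{f})\mathcal{A}_k\subset\mathcal{A}_{k-n}$ for all $k\in\mathbb{Z}$; this $n$ is called the grading jump $\operatorname{GJ}$ of $\pi$. If $\pi(\mathsf{e})=\pi(\mathsf{f})=0$, one sets $\operatorname{GJ}=0$. *)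

theory Defs
  imports Complex_Main "HOL-Library.Poly_Mapping" "HOL-Library.Product_Plus" "HOL-Algebra.Module" "HOL-Algebra.QuotRing"
begin

section \<open>Complex associative algebras\<close>

text \<open>
  A (not necessarily commutative) complex algebra is a record of type \<open>(complex, 'a) module\<close>:
  the ring operations of HOL-Algebra together with the scalar multiplication \<open>\<odot>\<close>.
\<close>

definition linear_maps :: "(complex, 'a) module \<Rightarrow> ('a \<Rightarrow> 'a) set" where
  "linear_maps A = {T \<in> carrier A \<rightarrow>\<^sub>E carrier A.
     (\<forall>a\<in>carrier A. \<forall>b\<in>carrier A. T (a \<oplus>\<^bsub>A\<^esub> b) = T a \<oplus>\<^bsub>A\<^esub> T b) \<and>
     (\<forall>c. \<forall>a\<in>carrier A. T (c \<odot>\<^bsub>A\<^esub> a) = c \<odot>\<^bsub>A\<^esub> T a)}"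

definition End_alg :: "(complex, 'a) module \<Rightarrow> (complex, 'a \<Rightarrow> 'a) module" where
  "End_alg A =
    \<lparr> carrier = linear_maps A,
      mult = (\<lambda>S T. compose (carrier A) S T),
      one = (\<lambda>a\<in>carrier A. a),
      zero = (\<lambda>a\<in>carrier A. \<zero>\<^bsub>A\<^esub>),
      add = (\<lambda>S T. \<lambda>a\<in>carrier A. S a \<oplus>\<^bsub>A\<^esub> T a),
      smult = (\<lambda>c T. \<lambda>a\<in>carrier A. c \<odot>\<^bsub>A\<^esub> T a) \<rparr>"

definition alg_hom :: "(complex, 'a) module \<Rightarrow> (complex, 'b) module \<Rightarrow> ('a \<Rightarrow> 'b) set" where
  "alg_hom A B =
     {\<phi> \<in> ring_hom A B. \<forall>c. \<forall>a\<in>carrier A. \<phi> (c \<odot>\<^bsub>A\<^esub> a) = c \<odot>\<^bsub>B\<^esub> \<phi> a}"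


section \<open>Tensor products and Hopf symmetries\<close>

text \<open>
  \<open>V \<otimes> W\<close> is the free vector space on \<open>V \<times> W\<close> modulo the subspace of bilinear relations. The
  coefficient \<open>d\<close> in the rules makes the additive closure below closed under scalars.
\<close>

inductive_set bilinear_relations ::
    "(complex, 'a) module \<Rightarrow> (complex, 'b) module \<Rightarrow> ('a \<times> 'b \<Rightarrow>\<^sub>0 complex) set"
  for V W where
  zero: "0 \<in> bilinear_relations V W"
| add: "s \<in> bilinear_relations V W \<Longrightarrow> t \<in> bilinear_relations V W
    \<Longrightarrow> s + t \<in> bilinear_relations V W"
| add_left: "\<lbrakk>a \<in> carrier V; a' \<in> carrier V; b \<in> carrier W\<rbrakk> \<Longrightarrow>
    Poly_Mapping.single (a \<oplus>\<^bsub>V\<^esub> a', b) d - Poly_Mapping.single (a, b) d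
      - Poly_Mapping.single (a', b) d \<in> bilinear_relations V W"
| add_right: "\<lbrakk>a \<in> carrier V; b \<in> carrier W; b' \<in> carrier W\<rbrakk> \<Longrightarrow>
    Poly_Mapping.single (a, b \<oplus>\<^bsub>W\<^esub> b') d - Poly_Mapping.single (a, b) d
      - Poly_Mapping.single (a, b') d \<in> bilinear_relations V W"
| smult_left: "\<lbrakk>a \<in> carrier V; b \<in> carrier W\<rbrakk> \<Longrightarrow>
    Poly_Mapping.single (c \<odot>\<^bsub>V\<^esub> a, b) d - Poly_Mapping.single (a, b) (c * d)
      \<in> bilinear_relations V W"
| smult_right: "\<lbrakk>a \<in> carrier V; b \<in> carrier W\<rbrakk> \<Longrightarrow>
    Poly_Mapping.single (a, c \<odot>\<^bsub>W\<^esub> b) d - Poly_Mapping.single (a, b) (c * d)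
      \<in> bilinear_relations V W"

definition tensor_class ::
    "(complex, 'a) module \<Rightarrow> (complex, 'b) module \<Rightarrow> ('a \<times> 'b \<Rightarrow>\<^sub>0 complex)
      \<Rightarrow> ('a \<times> 'b \<Rightarrow>\<^sub>0 complex) set" where
  "tensor_class V W t = {t + n | n. n \<in> bilinear_relations V W}"

record 'h hopf_algebra = "(complex, 'h) module" +
  comult :: "'h \<Rightarrow> ('h \<times> 'h \<Rightarrow>\<^sub>0 complex) set"
  counit :: "'h \<Rightarrow> complex"
  antipode :: "'h \<Rightarrow> 'h"

text \<open>
  \<open>comult H h\<close> is a class in \<open>H \<otimes> H\<close>, that is, the set of all formal sums of pairs
  representing it; Sweedler's notation is read off any of these representatives.
\<close>

definition hopf_symmetry :: "'h hopf_algebra \<Rightarrow> (complex, 'a) module \<Rightarrow> ('h \<Rightarrow> 'a \<Rightarrow> 'a) \<Rightarrow> bool" where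
  "hopf_symmetry H A \<pi> \<longleftrightarrow>
     \<pi> \<in> alg_hom (module.truncate H) (End_alg A) \<and>
     (\<forall>h\<in>carrier H. \<forall>t\<in>comult H h. \<forall>a\<in>carrier A. \<forall>b\<in>carrier A.
        \<pi> h (a \<otimes>\<^bsub>A\<^esub> b) =
          (\<Oplus>\<^bsub>A\<^esub>p\<in>Poly_Mapping.keys t.
             Poly_Mapping.lookup t p \<odot>\<^bsub>A\<^esub> (\<pi> (fst p) a \<otimes>\<^bsub>A\<^esub> \<pi> (snd p) b))) \<and>
     (\<forall>h\<in>carrier H. \<pi> h \<one>\<^bsub>A\<^esub> = counit H h \<odot>\<^bsub>A\<^esub> \<one>\<^bsub>A\<^esub>)"


section \<open>Algebras given by generators and relations\<close>

text \<open>
  Words with concatenation as addition, so that \<open>'g list \<Rightarrow>\<^sub>0 complex\<close>, with the convolution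
  product of \<^theory>\<open>HOL-Library.Poly_Mapping\<close>, is the free algebra on \<open>'g\<close>.
\<close>

instantiation list :: (type) monoid_add
begin
definition zero_list :: "'a list" where "zero_list = []"
definition plus_list :: "'a list \<Rightarrow> 'a list \<Rightarrow> 'a list" where "plus_list u v = u @ v"
instance by standard (simp_all add: zero_list_def plus_list_def)
end

type_synonym 'g free = "'g list \<Rightarrow>\<^sub>0 complex"

definition gen :: "'g \<Rightarrow> 'g free" where
  "gen g = Poly_Mapping.single [g] 1"

definition sc :: "complex \<Rightarrow> ('m::monoid_add \<Rightarrow>\<^sub>0 complex)" where
  "sc c = Poly_Mapping.single 0 c"

definition free_alg :: "(complex, 'g free) module" where
  "free_alg = \<lparr> carrier = UNIV, mult = (*), one = 1, zero = 0, add = (+), smult = (\<lambda>c x. sc c * x) \<rparr>"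

definition rel_class :: "'g free set \<Rightarrow> 'g free \<Rightarrow> 'g free set" where
  "rel_class R x = Idl\<^bsub>free_alg\<^esub> R +>\<^bsub>free_alg\<^esub> x"

text \<open>The ideals of HOL-Algebra are two-sided.\<close>

definition presented_alg :: "'g free set \<Rightarrow> (complex, 'g free set) module" where
  "presented_alg R = ring.extend (free_alg Quot (Idl\<^bsub>free_alg\<^esub> R))
     (module.fields (\<lambda>c X. \<Union>x\<in>X. rel_class R (sc c * x)))"

definition free_extension :: "(complex \<Rightarrow> 'b) \<Rightarrow> ('g \<Rightarrow> 'b) \<Rightarrow> 'g free \<Rightarrow> 'b::ring_1" where
  "free_extension s f x =
     (\<Sum>w\<in>Poly_Mapping.keys x. s (Poly_Mapping.lookup x w) * prod_list (map f w))"

definition free_anti_extension :: "(complex \<Rightarrow> 'b) \<Rightarrow> ('g \<Rightarrow> 'b) \<Rightarrow> 'g free \<Rightarrow> 'b::ring_1" where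
  "free_anti_extension s f x =
     (\<Sum>w\<in>Poly_Mapping.keys x. s (Poly_Mapping.lookup x w) * prod_list (map f (rev w)))"

text \<open>
  The tensor square of the free algebra is here the monoid algebra \<open>'g list \<times> 'g list \<Rightarrow>\<^sub>0 complex\<close>,
  with \<open>word_tensor u v\<close> standing for \<open>u \<otimes> v\<close>; its convolution product is
  \<open>(u \<otimes> v)(u' \<otimes> v') = uu' \<otimes> vv'\<close>. The map \<open>project_tensor\<close> sends it to formal sums of pairs
  of elements of the presented algebra.
\<close>

definition word_tensor :: "'g list \<Rightarrow> 'g list \<Rightarrow> ('g list \<times> 'g list \<Rightarrow>\<^sub>0 complex)" where
  "word_tensor u v = Poly_Mapping.single (u, v) 1"

definition project_tensor ::
    "'g free set \<Rightarrow> ('g list \<times> 'g list \<Rightarrow>\<^sub>0 complex) \<Rightarrow> ('g free set \<times> 'g free set \<Rightarrow>\<^sub>0 complex)" where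
  "project_tensor R t = (\<Sum>(u, v)\<in>Poly_Mapping.keys t.
     Poly_Mapping.single
       (rel_class R (Poly_Mapping.single u 1), rel_class R (Poly_Mapping.single v 1))
       (Poly_Mapping.lookup t (u, v)))"


section \<open>The quantum disc\<close>

datatype disc_gen = Z_gen | Zstar_gen

definition disc_rels :: "complex \<Rightarrow> disc_gen free set" where
  "disc_rels q =
    {gen Z_gen * gen Zstar_gen - (sc (q\<^sup>2) * gen Zstar_gen * gen Z_gen + sc (1 - q\<^sup>2))}"

definition disc :: "complex \<Rightarrow> (complex, disc_gen free set) module" where
  "disc q = presented_alg (disc_rels q)"

abbreviation disc_class :: "complex \<Rightarrow> disc_gen free \<Rightarrow> disc_gen free set" where
  "disc_class q \<equiv> rel_class (disc_rels q)"

definition disc_component :: "complex \<Rightarrow> int \<Rightarrow> disc_gen free set set" where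
  "disc_component q k = {disc_class q (\<Sum>(i, j)\<in>S. sc (c i j) * gen Z_gen ^ i * gen Zstar_gen ^ j) | S c.
     finite S \<and> (\<forall>(i, j)\<in>S. int i - int j = k)}"


section \<open>The quantum universal enveloping algebra of \<open>sl\<^sub>2\<close>\<close>

datatype uq_gen = K_gen | Kinv_gen | E_gen | F_gen

definition uq_rels :: "complex \<Rightarrow> uq_gen free set" where
  "uq_rels q =
    {gen Kinv_gen * gen K_gen - 1,
     gen K_gen * gen Kinv_gen - 1,
     gen K_gen * gen E_gen - sc (q\<^sup>2) * gen E_gen * gen K_gen,
     gen K_gen * gen F_gen - sc (inverse (q\<^sup>2)) * gen F_gen * gen K_gen,
     gen E_gen * gen F_gen - gen F_gen * gen E_gen - sc (1 / (q - inverse q)) * (gen K_gen - gen Kinv_gen)}"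

abbreviation uq_class :: "complex \<Rightarrow> uq_gen free \<Rightarrow> uq_gen free set" where
  "uq_class q \<equiv> rel_class (uq_rels q)"

text \<open>The values on \<open>Kinv_gen\<close> are forced by those on \<open>K_gen\<close>.\<close>

fun uq_comult_gen :: "uq_gen \<Rightarrow> (uq_gen list \<times> uq_gen list \<Rightarrow>\<^sub>0 complex)" where
  "uq_comult_gen K_gen = word_tensor [K_gen] [K_gen]"
| "uq_comult_gen Kinv_gen = word_tensor [Kinv_gen] [Kinv_gen]"
| "uq_comult_gen E_gen = word_tensor [] [E_gen] + word_tensor [E_gen] [K_gen]"
| "uq_comult_gen F_gen = word_tensor [F_gen] [] + word_tensor [Kinv_gen] [F_gen]"

fun uq_counit_gen :: "uq_gen \<Rightarrow> complex" where
  "uq_counit_gen K_gen = 1"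
| "uq_counit_gen Kinv_gen = 1"
| "uq_counit_gen E_gen = 0"
| "uq_counit_gen F_gen = 0"

fun uq_antipode_gen :: "uq_gen \<Rightarrow> uq_gen free" where
  "uq_antipode_gen K_gen = gen Kinv_gen"
| "uq_antipode_gen Kinv_gen = gen K_gen"
| "uq_antipode_gen E_gen = - (gen E_gen * gen Kinv_gen)"
| "uq_antipode_gen F_gen = - (gen K_gen * gen F_gen)"

definition uq :: "complex \<Rightarrow> uq_gen free set hopf_algebra" where
  "uq q = (let U = presented_alg (uq_rels q) in module.extend U (hopf_algebra.fields
     (\<lambda>X. \<Union>x\<in>X. tensor_class U U
        (project_tensor (uq_rels q) (free_extension sc uq_comult_gen x)))
     (\<lambda>X. the_elem (free_extension id uq_counit_gen ` X))
     (\<lambda>X. \<Union>x\<in>X. uq_class q (free_anti_extension sc uq_antipode_gen x))))"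


section \<open>Symmetries of the quantum disc and their grading jump\<close>

definition disc_symmetry ::
    "complex \<Rightarrow> (uq_gen free set \<Rightarrow> disc_gen free set \<Rightarrow> disc_gen free set) \<Rightarrow> bool" where
  "disc_symmetry q \<pi> \<longleftrightarrow> hopf_symmetry (uq q) (disc q) \<pi>"

definition grading_jump ::
    "complex \<Rightarrow> (uq_gen free set \<Rightarrow> disc_gen free set \<Rightarrow> disc_gen free set) \<Rightarrow> int \<Rightarrow> bool" where
  "grading_jump q \<pi> n \<longleftrightarrow>
    (let e = \<pi> (uq_class q (gen E_gen)); f = \<pi> (uq_class q (gen F_gen)) in
     if \<forall>a\<in>carrier (disc q). e a = \<zero>\<^bsub>disc q\<^esub> \<and> f a = \<zero>\<^bsub>disc q\<^esub>
     then n = 0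
     else n \<noteq> 0 \<and>
       (\<forall>k. e ` disc_component q k \<subseteq> disc_component q (k + n) \<and>
            f ` disc_component q k \<subseteq> disc_component q (k - n)))"

end

theory Submission
  imports Defs "HOL-Computational_Algebra.Polynomial"
begin

text \<open>
  Write \<open>\<theta> k = q\<^sup>-\<^sup>2\<^sup>k\<close>. The quantum disc embeds into the skew Laurent ring over
  \<open>\<complex>[y]\<close> in which \<open>y z = \<theta> 1 z y\<close> and \<open>z\<^sup>* = z\<inverse> (1 - y)\<close>; the coefficients \<open>a\<^sub>k(y)\<close> of
  \<open>a = \<Sum>\<^sub>k z\<^sup>k a\<^sub>k(y)\<close> form the symbol of \<open>a\<close>, so identities in the disc become identities between
  polynomials in one variable.

  Let \<open>\<pi>\<close> be a symmetry with grading jump \<open>n > 1\<close>. The Leibniz rules show that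
  \<open>\<pi>(k)\<close> preserves the grading, hence \<open>\<pi>(k) z = \<alpha> z\<close>, \<open>\<pi>(k) z\<^sup>* = \<alpha>\<inverse> z\<^sup>*\<close>, and \<open>\<alpha>\<^sup>n = q\<^sup>2\<close>.
  The relations between \<open>y\<close> and \<open>z\<close>, \<open>z\<^sup>*\<close> then force \<open>\<pi>(e) a = x \<pi>(k)(a) - a x\<close> and
  \<open>\<pi>(f) a = v a - \<pi>(k\<inverse>)(a) v\<close> with \<open>x = z\<^sup>n X(y)\<close> and \<open>v\<close> of degree \<open>-n\<close>, and the commutator of
  \<open>\<pi>(e)\<close> and \<open>\<pi>(f)\<close> is governed by \<open>w = q\<^sup>-\<^sup>2 x v - v x\<close>. Comparing coefficients, \<open>v x\<close> is a
  polynomial in \<open>y\<close> of degree at most 1. But \<open>\<pi>(f) y\<close>, a multiple of \<open>y v\<close>, lies in the disc and so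
  annihilates the first \<open>n\<close> vectors of the Fock representation, which makes \<open>v x\<close> vanish at
  \<open>n \<ge> 2\<close> distinct points. So \<open>v x = 0\<close> and \<open>\<pi>(k) = \<pi>(k\<inverse>)\<close>, which is absurd.

  For \<open>n = 1\<close> the same formulas, with \<open>x = z X(y)\<close>, \<open>v = V(y) z\<^sup>*\<close> and \<open>X V\<close> of degree at most 1,
  define the two series, and all axioms of a symmetry follow from the shape of the formulas.
\<close>

section \<open>Free algebras\<close>

text \<open>The coefficient is an argument of \<open>\<psi>\<close> and not a scalar factor, so that
  the same lemmas cover targets as different as complex numbers, free algebras and formal sums of
  tensors.\<close>

definition linear_extension :: "('m \<Rightarrow> complex \<Rightarrow> 'v) \<Rightarrow> ('m \<Rightarrow>\<^sub>0 complex) \<Rightarrow> 'v::ab_group_add" where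
  "linear_extension \<psi> x = (\<Sum>w\<in>Poly_Mapping.keys x. \<psi> w (Poly_Mapping.lookup x w))"

locale termwise_additive =
  fixes \<psi> :: "'m \<Rightarrow> complex \<Rightarrow> 'v::ab_group_add"
  assumes add: "\<psi> w (c + d) = \<psi> w c + \<psi> w d"
begin

lemma zero [simp]: "\<psi> w 0 = 0"
  using add[of w 0 0] by simp

lemma extension_superset:
  assumes "finite S" "Poly_Mapping.keys x \<subseteq> S"
  shows "linear_extension \<psi> x = (\<Sum>w\<in>S. \<psi> w (Poly_Mapping.lookup x w))"
  unfolding linear_extension_def using assms
  by (intro sum.mono_neutral_left) (auto simp: in_keys_iff)

lemma extension_add:
  "linear_extension \<psi> (x + y) = linear_extension \<psi> x + linear_extension \<psi> y"
proof -
  define S where "S = Poly_Mapping.keys x \<union> Poly_Mapping.keys y"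
  have S: "finite S" "Poly_Mapping.keys x \<subseteq> S" "Poly_Mapping.keys y \<subseteq> S"
      "Poly_Mapping.keys (x + y) \<subseteq> S"
    using Poly_Mapping.keys_add[of x y] by (auto simp: S_def)
  show ?thesis
    by (simp add: extension_superset[OF S(1)] S lookup_add add sum.distrib)
qed

lemma extension_single [simp]: "linear_extension \<psi> (Poly_Mapping.single w c) = \<psi> w c"
  by (subst extension_superset[of "{w}"]) auto

lemma extension_zero [simp]: "linear_extension \<psi> 0 = 0"
  by (simp add: linear_extension_def)

lemma extension_uminus: "linear_extension \<psi> (- x) = - linear_extension \<psi> x"
  using extension_add[of x "- x"] by (simp add: eq_neg_iff_add_eq_0 add.commute)

lemma extension_diff:
  "linear_extension \<psi> (x - y) = linear_extension \<psi> x - linear_extension \<psi> y"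
  using extension_add[of x "- y"] by (simp add: extension_uminus)

lemma extension_sum: "linear_extension \<psi> (\<Sum>i\<in>S. x i) = (\<Sum>i\<in>S. linear_extension \<psi> (x i))"
  by (induction S rule: infinite_finite_induct) (auto simp: extension_add)

end

lemma poly_mapping_add_induct [case_names zero add single]:
  fixes x :: "'m \<Rightarrow>\<^sub>0 complex"
  assumes "P 0" "\<And>x y. P x \<Longrightarrow> P y \<Longrightarrow> P (x + y)" "\<And>w c. P (Poly_Mapping.single w c)"
  shows "P x"
proof -
  have "P (\<Sum>w\<in>S. Poly_Mapping.single w (Poly_Mapping.lookup x w))" if "finite S" for S
    using that by induction (auto intro: assms)
  moreover have "(\<Sum>w\<in>Poly_Mapping.keys x. Poly_Mapping.single w (Poly_Mapping.lookup x w)) = x"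
    by (intro poly_mapping_eqI)
      (auto simp: lookup_sum lookup_single when_def in_keys_iff sum.delta)
  ultimately show ?thesis
    by (metis finite_keys)
qed

lemma sc_add: "sc (c + d) = sc c + sc d"
  and sc_mult: "sc (c * d) = sc c * sc d"
  and sc_diff: "sc (c - d) = sc c - sc d"
  and sc_uminus: "sc (- c) = - sc c"
  and sc_0 [simp]: "sc 0 = 0"
  and sc_1 [simp]: "sc 1 = 1"
  by (simp_all add: sc_def single_add mult_single single_diff single_uminus)

lemma sc_commute: "x * sc c = sc c * x"
  by (induction x rule: poly_mapping_add_induct)
    (simp_all add: sc_def mult_single algebra_simps)

lemma sc_left_commute: "x * (sc c * y) = sc c * (x * y)"
  by (metis mult.assoc sc_commute)

lemma single_eq_sc: "Poly_Mapping.single w c = sc c * Poly_Mapping.single w 1"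
  by (simp add: sc_def mult_single)

lemma single_Nil: "Poly_Mapping.single [] (1 :: complex) = 1"
  unfolding zero_list_def[symmetric] by (rule single_one)

lemma single_Cons: "Poly_Mapping.single (g # w) 1 = gen g * Poly_Mapping.single w 1"
  by (simp add: gen_def mult_single plus_list_def)

text \<open>Words arise by prefixing generators, so only left multiplication by one generator has to
  be treated; symbols and Leibniz rules are given in exactly this form.\<close>

lemma free_induct [case_names add scale one gen]:
  fixes x :: "'g free"
  assumes "\<And>x y. P x \<Longrightarrow> P y \<Longrightarrow> P (x + y)" "\<And>c x. P x \<Longrightarrow> P (sc c * x)"
    and "P 1" "\<And>g x. P x \<Longrightarrow> P (gen g * x)"
  shows "P x"
proof (induction x rule: poly_mapping_add_induct)
  case zero
  show ?case using assms(2)[of 1 0] assms(3) by simp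
next
  case (single w c)
  have "P (Poly_Mapping.single w 1)"
    by (induction w) (auto simp: single_Nil single_Cons assms)
  then show ?case by (subst single_eq_sc) (rule assms)
qed (rule assms)


section \<open>Algebras given by generators and relations\<close>

lemma free_alg_simps [simp]:
  "carrier free_alg = UNIV" "x \<otimes>\<^bsub>free_alg\<^esub> y = x * y" "\<one>\<^bsub>free_alg\<^esub> = 1"
  "\<zero>\<^bsub>free_alg\<^esub> = 0" "x \<oplus>\<^bsub>free_alg\<^esub> y = x + y"
  by (simp_all add: free_alg_def)

lemma ring_free_alg: "ring (free_alg :: (complex, 'g free) module)"
proof (rule ringI)
  show "abelian_group (free_alg :: (complex, 'g free) module)"
    by (rule abelian_groupI) (auto simp: algebra_simps intro: exI[of _ "- x" for x])
  show "Group.monoid (free_alg :: (complex, 'g free) module)"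
    by (rule monoidI) (auto simp: algebra_simps)
qed (auto simp: algebra_simps)

interpretation free_alg: ring "free_alg :: (complex, 'g free) module"
  by (rule ring_free_alg)

lemma free_alg_minus [simp]: "\<ominus>\<^bsub>free_alg\<^esub> x = - x"
  by (rule free_alg.minus_equality) simp_all

abbreviation rel_ideal :: "'g free set \<Rightarrow> 'g free set" where
  "rel_ideal R \<equiv> Idl\<^bsub>free_alg\<^esub> R"

lemma ideal_rel_ideal: "ideal (rel_ideal R) free_alg"
  by (rule free_alg.genideal_ideal) simp

lemma rel_ideal_memI: "x \<in> R \<Longrightarrow> x \<in> rel_ideal R"
  using free_alg.genideal_self[of R] by auto

lemma rel_ideal_zero: "0 \<in> rel_ideal R"
  using additive_subgroup.zero_closed[OF ideal.axioms(1)[OF ideal_rel_ideal]] by simp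

lemma rel_ideal_add: "x \<in> rel_ideal R \<Longrightarrow> y \<in> rel_ideal R \<Longrightarrow> x + y \<in> rel_ideal R"
  using additive_subgroup.a_closed[OF ideal.axioms(1)[OF ideal_rel_ideal]] by force

lemma rel_ideal_mult_left: "x \<in> rel_ideal R \<Longrightarrow> a * x \<in> rel_ideal R"
  using ideal.I_l_closed[OF ideal_rel_ideal] by force

lemma rel_ideal_mult_right: "x \<in> rel_ideal R \<Longrightarrow> x * a \<in> rel_ideal R"
  using ideal.I_r_closed[OF ideal_rel_ideal] by force

lemma rel_ideal_uminus: "x \<in> rel_ideal R \<Longrightarrow> - x \<in> rel_ideal R"
  using rel_ideal_mult_left[of x R "- 1"] by simp

lemma rel_ideal_diff: "x \<in> rel_ideal R \<Longrightarrow> y \<in> rel_ideal R \<Longrightarrow> x - y \<in> rel_ideal R"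
  using rel_ideal_add[of x R "- y"] rel_ideal_uminus by auto

text \<open>The elements satisfying \<open>P\<close> form a two-sided ideal containing
  \<open>R\<close>; closure under negation comes from left multiplication by
  \<open>- 1\<close>.\<close>

lemma rel_ideal_induct [consumes 1, case_names rel zero add mult_left mult_right]:
  assumes "x \<in> rel_ideal R" "\<And>x. x \<in> R \<Longrightarrow> P x" "P 0"
    and "\<And>x y. P x \<Longrightarrow> P y \<Longrightarrow> P (x + y)"
    and "\<And>a x. P x \<Longrightarrow> P (a * x)" "\<And>a x. P x \<Longrightarrow> P (x * a)"
  shows "P x"
proof -
  have "P (- x)" if "P x" for x
    using assms(5)[OF that, of "- 1"] by simp
  then have "subgroup {x. P x} (add_monoid free_alg)"
    using assms
    by unfold_locales (auto simp: free_alg_minus[unfolded a_inv_def, simplified])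
  then have "ideal {x. P x} free_alg"
    using assms by (intro idealI ring_free_alg) auto
  from free_alg.genideal_minimal[OF this, of R] show ?thesis
    using assms by auto
qed

lemma rel_class_eq_iff: "rel_class R x = rel_class R y \<longleftrightarrow> x - y \<in> rel_ideal R"
proof -
  interpret I: ideal "rel_ideal R" free_alg by (rule ideal_rel_ideal)
  have mem: "z \<in> rel_class R x \<longleftrightarrow> z - x \<in> rel_ideal R" for z x
    by (auto simp: rel_class_def a_r_coset_def' intro!: bexI[of _ "z - x"])
  have "z - y \<in> rel_ideal R" if "x - y \<in> rel_ideal R" "z - x \<in> rel_ideal R" for x y z
    using rel_ideal_add[OF that] by simp
  moreover have "y - x \<in> rel_ideal R" if "x - y \<in> rel_ideal R" for x y
    using rel_ideal_uminus[OF that] by simp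
  ultimately show ?thesis
    unfolding set_eq_iff mem using rel_ideal_zero by (metis diff_self)
qed

lemma mem_rel_class_iff: "x \<in> rel_class R y \<longleftrightarrow> rel_class R x = rel_class R y"
  unfolding rel_class_eq_iff
  by (auto simp: rel_class_def a_r_coset_def' intro!: bexI[of _ "x - y"])

lemma carrier_presented: "carrier (presented_alg R) = range (rel_class R)"
  by (auto simp: presented_alg_def ring.extend_def FactRing_def A_RCOSETS_def RCOSETS_def
      rel_class_def a_r_coset_def)

lemma rel_class_carrier [simp]: "rel_class R x \<in> carrier (presented_alg R)"
  by (simp add: carrier_presented)

lemma presented_simps [simp]:
  "rel_class R x \<otimes>\<^bsub>presented_alg R\<^esub> rel_class R y = rel_class R (x * y)"
  "rel_class R x \<oplus>\<^bsub>presented_alg R\<^esub> rel_class R y = rel_class R (x + y)"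
proof -
  interpret I: ideal "rel_ideal R" free_alg by (rule ideal_rel_ideal)
  show "rel_class R x \<otimes>\<^bsub>presented_alg R\<^esub> rel_class R y = rel_class R (x * y)"
    using I.rcoset_mult_add[of x y]
    by (simp add: presented_alg_def ring.extend_def FactRing_def rel_class_def)
  show "rel_class R x \<oplus>\<^bsub>presented_alg R\<^esub> rel_class R y = rel_class R (x + y)"
    using I.a_rcos_sum[of x y]
    by (simp add: presented_alg_def ring.extend_def FactRing_def rel_class_def)
qed

lemma presented_one: "\<one>\<^bsub>presented_alg R\<^esub> = rel_class R 1"
  by (simp add: presented_alg_def ring.extend_def FactRing_def rel_class_def)

lemma presented_zero: "\<zero>\<^bsub>presented_alg R\<^esub> = rel_class R 0"
proof -
  have "\<zero>\<^bsub>presented_alg R\<^esub> = rel_ideal R"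
    by (simp add: presented_alg_def ring.extend_def FactRing_def)
  also have "\<dots> = rel_class R 0"
    by (auto simp: rel_class_def a_r_coset_def')
  finally show ?thesis .
qed

text \<open>Scalar multiplication is defined as a union over all representatives; each of them
  yields the same class, so the union collapses to it.\<close>

lemma presented_smult [simp]:
  "c \<odot>\<^bsub>presented_alg R\<^esub> rel_class R x = rel_class R (sc c * x)"
proof -
  have "rel_class R (sc c * y) = rel_class R (sc c * x)" if "y \<in> rel_class R x" for y
    using that rel_ideal_mult_left[of "y - x" R "sc c"]
    by (simp add: mem_rel_class_iff rel_class_eq_iff algebra_simps)
  then have "(\<Union>y\<in>rel_class R x. rel_class R (sc c * y)) = rel_class R (sc c * x)"
    using mem_rel_class_iff by fastforce
  then show ?thesis
    by (simp add: presented_alg_def ring.extend_def module.fields_def)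
qed

lemma ring_presented: "ring (presented_alg R)"
proof -
  interpret I: ideal "rel_ideal R" free_alg by (rule ideal_rel_ideal)
  show ?thesis
  proof (rule ringI)
    show "abelian_group (presented_alg R)"
    proof (rule abelian_groupI)
      fix X assume "X \<in> carrier (presented_alg R)"
      then obtain x where "X = rel_class R x"
        by (auto simp: carrier_presented)
      then show "\<exists>Y\<in>carrier (presented_alg R). Y \<oplus>\<^bsub>presented_alg R\<^esub> X = \<zero>\<^bsub>presented_alg R\<^esub>"
        by (intro bexI[of _ "rel_class R (- x)"]) (simp_all add: presented_zero)
    qed (auto simp: carrier_presented presented_zero algebra_simps)
    show "Group.monoid (presented_alg R)"
      by (rule monoidI) (auto simp: carrier_presented presented_one algebra_simps)
  qed (auto simp: carrier_presented algebra_simps)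
qed

lemma finsum_presented:
  "(\<Oplus>\<^bsub>presented_alg R\<^esub>i\<in>S. rel_class R (x i)) = rel_class R (\<Sum>i\<in>S. x i)"
proof -
  interpret A: ring "presented_alg R" by (rule ring_presented)
  show ?thesis
    by (induction S rule: infinite_finite_induct) (auto simp: presented_zero)
qed


section \<open>Symbols of elements of the quantum disc\<close>

text \<open>Left multiplication in the skew Laurent ring, with coefficients to the right of z^k: z
  shifts the degree, and z^(-1) (1 - y), moved past z^(k+1), contributes the factor 1 - q^(-2(k+1))
  t.\<close>

fun word_symbol :: "complex \<Rightarrow> disc_gen list \<Rightarrow> int \<Rightarrow> complex \<Rightarrow> complex" where
  "word_symbol q [] k t = (if k = 0 then 1 else 0)"
| "word_symbol q (Z_gen # w) k t = word_symbol q w (k - 1) t"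
| "word_symbol q (Zstar_gen # w) k t = (1 - q powi (- 2 * (k + 1)) * t) * word_symbol q w (k + 1) t"

fun weight :: "disc_gen list \<Rightarrow> int" where
  "weight [] = 0"
| "weight (Z_gen # w) = weight w + 1"
| "weight (Zstar_gen # w) = weight w - 1"

locale quantum_disc =
  fixes q :: complex
  assumes q_nonzero [simp]: "q \<noteq> 0" and not_root: "\<And>m::nat. m > 0 \<Longrightarrow> q ^ m \<noteq> 1"
begin

lemma powi_eq_1_iff: "q powi k = 1 \<longleftrightarrow> k = 0"
proof
  assume *: "q powi k = 1"
  then have "q powi (- k) = 1" by (simp add: power_int_minus)
  then have "q ^ nat \<bar>k\<bar> = 1"
    using * by (cases "k \<ge> 0") (simp_all add: power_int_def split: if_splits)
  then show "k = 0" using not_root[of "nat \<bar>k\<bar>"] by auto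
qed simp

definition \<theta> :: "int \<Rightarrow> complex" where "\<theta> k = q powi (- 2 * k)"

lemma \<theta>_0 [simp]: "\<theta> 0 = 1"
  and \<theta>_nonzero [simp]: "\<theta> k \<noteq> 0"
  and \<theta>_add: "\<theta> (k + l) = \<theta> k * \<theta> l"
  and \<theta>_eq_1_iff: "\<theta> k = 1 \<longleftrightarrow> k = 0"
  by (simp_all add: \<theta>_def powi_eq_1_iff algebra_simps flip: power_int_add)

lemma \<theta>_minus: "\<theta> (- k) = inverse (\<theta> k)"
  using \<theta>_add[of k "- k"] by (simp add: inverse_unique)

lemma \<theta>_diff: "\<theta> (k - l) = \<theta> k / \<theta> l"
  using \<theta>_add[of k "- l"] by (simp add: \<theta>_minus divide_inverse)

lemma \<theta>_1: "\<theta> 1 = inverse (q\<^sup>2)" and \<theta>_minus_1: "\<theta> (- 1) = q\<^sup>2"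
  by (simp_all add: \<theta>_def power_int_minus)

definition symbol :: "disc_gen free \<Rightarrow> int \<Rightarrow> complex \<Rightarrow> complex" where
  "symbol a k t = linear_extension (\<lambda>w c. c * word_symbol q w k t) a"

sublocale word_sum: termwise_additive "\<lambda>w c. c * word_symbol q w k t" for k t
  by unfold_locales (simp add: algebra_simps)

abbreviation "z \<equiv> gen Z_gen"
abbreviation "zs \<equiv> gen Zstar_gen"
abbreviation "y \<equiv> 1 - z * zs"

lemma symbol_add [simp]: "symbol (a + b) k t = symbol a k t + symbol b k t"
  and symbol_diff [simp]: "symbol (a - b) k t = symbol a k t - symbol b k t"
  and symbol_uminus [simp]: "symbol (- a) k t = - symbol a k t"
  and symbol_0 [simp]: "symbol 0 k t = 0"
  by (simp_all add: symbol_def word_sum.extension_add word_sum.extension_diff word_sum.extension_uminus)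

lemma symbol_sum: "symbol (\<Sum>i\<in>S. a i) k t = (\<Sum>i\<in>S. symbol (a i) k t)"
  by (simp add: symbol_def word_sum.extension_sum)

lemma symbol_single: "symbol (Poly_Mapping.single w c) k t = c * word_symbol q w k t"
  by (simp add: symbol_def)

lemma symbol_sc_mult [simp]: "symbol (sc c * a) k t = c * symbol a k t"
  by (induction a rule: poly_mapping_add_induct)
    (simp_all add: ring_distribs symbol_single sc_def mult_single)

lemma symbol_1 [simp]: "symbol 1 k t = (if k = 0 then 1 else 0)"
  by (simp add: symbol_single flip: single_Nil)

lemma symbol_z_mult [simp]: "symbol (z * a) k t = symbol a (k - 1) t"
  by (induction a rule: poly_mapping_add_induct)
    (simp_all add: ring_distribs symbol_single gen_def mult_single plus_list_def)

lemma symbol_zs_mult [simp]: "symbol (zs * a) k t = (1 - \<theta> (k + 1) * t) * symbol a (k + 1) t"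
  by (induction a rule: poly_mapping_add_induct)
    (simp_all add: ring_distribs symbol_single gen_def mult_single plus_list_def \<theta>_def)

lemma symbol_sc [simp]: "symbol (sc c) k t = (if k = 0 then c else 0)"
  using symbol_sc_mult[of c 1] by simp

lemma symbol_z [simp]: "symbol z k t = (if k = 1 then 1 else 0)"
  using symbol_z_mult[of 1] by simp

lemma symbol_zs [simp]: "symbol zs k t = (if k = - 1 then 1 - t else 0)"
  using symbol_zs_mult[of 1 k t] by (auto simp: eq_neg_iff_add_eq_0)

lemma symbol_y_mult [simp]: "symbol (y * a) k t = \<theta> k * t * symbol a k t"
  by (simp add: left_diff_distrib mult.assoc)

lemma symbol_z_power_mult: "symbol (z ^ i * a) k t = symbol a (k - int i) t"
  by (induction i arbitrary: k) (simp_all add: mult.assoc algebra_simps)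

lemma symbol_word:
  "k \<noteq> weight w \<Longrightarrow> word_symbol q w k t = 0"
  by (induction w arbitrary: k rule: weight.induct) auto

section \<open>Homogeneous elements and products of symbols\<close>

definition homog :: "int \<Rightarrow> disc_gen free \<Rightarrow> bool" where
  "homog j a \<longleftrightarrow> (\<forall>k t. k \<noteq> j \<longrightarrow> symbol a k t = 0)"

lemma homog_symbol: "homog j a \<Longrightarrow> k \<noteq> j \<Longrightarrow> symbol a k t = 0"
  by (simp add: homog_def)

text \<open>Moving a coefficient past z^j rescales its variable by \<open>\<theta> j\<close>, and
  since \<open>b\<close> has a single degree, only one term of the product has degree
  \<open>l\<close>.\<close>

lemma symbol_mult_homog_right:
  assumes "homog j b"
  shows "symbol (a * b) l t = symbol a (l - j) (\<theta> j * t) * symbol b j t"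
proof (induction a arbitrary: l rule: free_induct)
  case (gen g x)
  then show ?case
    by (cases g) (simp_all add: mult.assoc \<theta>_add \<theta>_diff algebra_simps)
qed (use homog_symbol[OF assms] in \<open>auto simp: ring_distribs mult.assoc\<close>)

text \<open>By linearity \<open>b\<close> may be taken to be a multiple of a word, which is
  homogeneous, so the previous formula applies.\<close>

lemma symbol_mult_homog_left:
  assumes "homog i a"
  shows "symbol (a * b) l t = symbol a i (\<theta> (l - i) * t) * symbol b (l - i) t"
proof (induction b rule: poly_mapping_add_induct)
  case (single w c)
  have "homog (weight w) (Poly_Mapping.single w c)"
    by (simp add: homog_def symbol_single symbol_word)
  from symbol_mult_homog_right[OF this, of a l t] show ?case
    using homog_symbol[OF assms] by (cases "weight w = l - i") (auto simp: symbol_single symbol_word)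
qed (auto simp: ring_distribs)

lemma homog_mult: "homog i a \<Longrightarrow> homog j b \<Longrightarrow> homog (i + j) (a * b)"
  by (auto simp: homog_def[of "i + j"] symbol_mult_homog_left intro!: homog_symbol[of j])

lemma homog_diff: "homog i a \<Longrightarrow> homog i b \<Longrightarrow> homog i (a - b)"
  and homog_1: "homog 0 1"
  and homog_z: "homog 1 z"
  and homog_zs: "homog (- 1) zs"
  by (simp_all add: homog_def)

lemma homog_y: "homog 0 y"
  by (simp add: homog_def)

lemma homog_scale: "homog i a \<Longrightarrow> homog i (sc c * a)"
  by (simp add: homog_def)

lemma homog_sum: "(\<And>i. i \<in> S \<Longrightarrow> homog k (x i)) \<Longrightarrow> homog k (\<Sum>i\<in>S. x i)"
  by (simp add: homog_def symbol_sum)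

lemma homog_power: "homog i a \<Longrightarrow> homog (int n * i) (a ^ n)"
  by (induction n) (auto simp: homog_1 ring_distribs intro: homog_mult)

text \<open>Each \<open>zs\<close> brings in one linear factor. Polynomiality turns identities valid
  for all \<open>t\<close> into identities of polynomials, where nonzero factors can be
  cancelled.\<close>

lemma symbol_poly: "\<exists>p. \<forall>t. symbol a k t = poly p t"
proof (induction a arbitrary: k rule: free_induct)
  case (add x y)
  then show ?case by (metis poly_add symbol_add)
next
  case (scale c x)
  then show ?case by (metis poly_smult symbol_sc_mult)
next
  case one
  show ?case by (intro exI[of _ "[:if k = 0 then 1 else 0:]"]) simp
next
  case (gen g x)
  show ?case
  proof (cases g)
    case Z_gen
    then show ?thesis using gen[of "k - 1"] by simp
  next
    case Zstar_gen
    obtain p where "\<forall>t. symbol x (k + 1) t = poly p t" using gen by blast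
    then show ?thesis
      by (intro exI[of _ "[:1, - \<theta> (k + 1):] * p"]) (simp add: Zstar_gen algebra_simps)
  qed
qed

text \<open>In the Fock representation an element of degree \<open>k\<close> kills the vectors \<open>v\<^sub>m\<close> with \<open>m + k < 0\<close>.\<close>

lemma symbol_vanishes: "m \<ge> 0 \<Longrightarrow> m + k < 0 \<Longrightarrow> symbol a k (\<theta> m) = 0"
proof (induction a arbitrary: k rule: free_induct)
  case (gen g x)
  show ?case
  proof (cases g)
    case Z_gen
    then show ?thesis using gen.IH[of "k - 1"] gen.prems by simp
  next
    case Zstar_gen
    show ?thesis
    proof (cases "m + k + 1 = 0")
      \<comment> \<open>Boundary case: the induction hypothesis for \<open>k + 1\<close> does not
        apply, but the factor coming from \<open>zs\<close> vanishes at
        \<open>\<theta> m\<close>.\<close>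
      case True
      then have "\<theta> (k + 1) * \<theta> m = 1"
        by (metis \<theta>_0 \<theta>_add add.assoc add.commute)
      then show ?thesis by (simp add: Zstar_gen algebra_simps)
    next
      case False
      then show ?thesis using gen.IH[of "k + 1"] gen.prems Zstar_gen by simp
    qed
  qed
qed auto

lemma symbol_rel_ideal:
  assumes "x \<in> rel_ideal (disc_rels q)"
  shows "symbol x k t = 0"
  using assms
proof (induction x arbitrary: k t rule: rel_ideal_induct)
  case (rel x)
  then have x: "x = z * zs - (sc (q\<^sup>2) * (zs * z) + sc (1 - q\<^sup>2))"
    by (simp add: disc_rels_def mult.assoc)
  show ?case
    by (cases "k = 0") (auto simp: x symbol_z symbol_zs \<theta>_1 field_simps)
next
  case (mult_left a x)
  \<comment> \<open>An element with zero symbol is homogeneous of any degree, so the product formula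
    is available.\<close>
  then have "homog 0 x" by (simp add: homog_def)
  from symbol_mult_homog_right[OF this] mult_left show ?case by simp
next
  case (mult_right a x)
  then have "homog 0 x" by (simp add: homog_def)
  from symbol_mult_homog_left[OF this] mult_right show ?case by simp
qed auto

lemma symbol_cong: "disc_class q a = disc_class q b \<Longrightarrow> symbol a = symbol b"
  using symbol_rel_ideal[of "a - b"] by (simp add: rel_class_eq_iff fun_eq_iff)

end


section \<open>Normal forms and graded components\<close>

context quantum_disc
begin

text \<open>Computations in the disc are made with representatives in the free algebra; maps of the
  disc become maps of the free algebra respecting this congruence.\<close>

definition equiv_mod :: "disc_gen free \<Rightarrow> disc_gen free \<Rightarrow> bool" (infix "\<approx>" 50) where
  "a \<approx> b \<longleftrightarrow> a - b \<in> rel_ideal (disc_rels q)"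

lemma equiv_mod_iff_class: "a \<approx> b \<longleftrightarrow> disc_class q a = disc_class q b"
  by (simp add: equiv_mod_def rel_class_eq_iff)

lemma equiv_mod_refl [simp]: "a \<approx> a"
  by (simp add: equiv_mod_iff_class)

lemma equiv_mod_sym: "a \<approx> b \<Longrightarrow> b \<approx> a"
  by (simp add: equiv_mod_iff_class)

lemma equiv_mod_trans [trans]: "a \<approx> b \<Longrightarrow> b \<approx> c \<Longrightarrow> a \<approx> c"
  by (simp add: equiv_mod_iff_class)

lemma equiv_mod_add: "a \<approx> b \<Longrightarrow> c \<approx> d \<Longrightarrow> a + c \<approx> b + d"
  using rel_ideal_add[of "a - b" _ "c - d"] by (simp add: equiv_mod_def algebra_simps)

lemma equiv_mod_diff: "a \<approx> b \<Longrightarrow> c \<approx> d \<Longrightarrow> a - c \<approx> b - d"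
  using rel_ideal_diff[of "a - b" _ "c - d"] by (simp add: equiv_mod_def algebra_simps)

lemma equiv_mod_left: "a \<approx> b \<Longrightarrow> c * a \<approx> c * b"
  using rel_ideal_mult_left[of "a - b" _ c] by (simp add: equiv_mod_def algebra_simps)

lemma equiv_mod_right: "a \<approx> b \<Longrightarrow> a * c \<approx> b * c"
  using rel_ideal_mult_right[of "a - b" _ c] by (simp add: equiv_mod_def algebra_simps)

lemma equiv_mod_symbol: "a \<approx> b \<Longrightarrow> symbol a = symbol b"
  unfolding equiv_mod_iff_class by (rule symbol_cong)

text \<open>The defining relation, solved for \<open>zs * z\<close> after multiplication by
  \<open>- \<theta> 1\<close>, where \<open>\<theta> 1\<close> is the inverse of
  \<open>q\<^sup>2\<close>.\<close>

lemma zs_z: "zs * z \<approx> 1 - sc (\<theta> 1) * y"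
proof -
  have "sc (- \<theta> 1) * (z * zs - (sc (q\<^sup>2) * (zs * z) + sc (1 - q\<^sup>2))) \<in> rel_ideal (disc_rels q)"
    by (intro rel_ideal_mult_left rel_ideal_memI) (simp add: disc_rels_def mult.assoc)
  also have "sc (- \<theta> 1) * (z * zs - (sc (q\<^sup>2) * (zs * z) + sc (1 - q\<^sup>2))) =
      sc (\<theta> 1 * q\<^sup>2) * (zs * z) - sc (\<theta> 1) * (z * zs) + sc (\<theta> 1 * (1 - q\<^sup>2))"
    by (simp add: sc_mult sc_uminus sc_diff algebra_simps)
  also have "\<dots> = zs * z - (1 - sc (\<theta> 1) * y)"
    by (simp add: \<theta>_1 sc_diff algebra_simps)
  finally show ?thesis by (simp add: equiv_mod_def)
qed

text \<open>Since \<open>y * z = z - z * (zs * z)\<close>, substituting the previous rule for the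
  inner product moves \<open>y\<close> to the right.\<close>

lemma y_z: "y * z \<approx> sc (\<theta> 1) * (z * y)"
proof -
  have "z - z * (zs * z) \<approx> z - z * (1 - sc (\<theta> 1) * y)"
    by (intro equiv_mod_diff equiv_mod_left zs_z equiv_mod_refl)
  then show ?thesis
    by (simp add: algebra_simps sc_left_commute[of z] sc_commute[of z])
qed

text \<open>The same substitution in \<open>zs * y = zs - (zs * z) * zs\<close>, after which the
  scalar is inverted.\<close>

lemma y_zs: "y * zs \<approx> sc (\<theta> (- 1)) * (zs * y)"
proof -
  have "sc (\<theta> (- 1)) * (zs - (zs * z) * zs) \<approx> sc (\<theta> (- 1)) * (zs - (1 - sc (\<theta> 1) * y) * zs)"
    by (intro equiv_mod_diff equiv_mod_left equiv_mod_right zs_z equiv_mod_refl)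
  also have "\<dots> = sc (\<theta> (- 1) * \<theta> 1) * (y * zs)"
    by (simp add: sc_mult ring_distribs mult.assoc)
  also have "\<theta> (- 1) * \<theta> 1 = 1"
    by (simp flip: \<theta>_add)
  finally show ?thesis
    by (simp add: algebra_simps equiv_mod_sym)
qed

lemma y_power:
  assumes "y * a \<approx> sc c * (a * y)"
  shows "y * a ^ n \<approx> sc (c ^ n) * (a ^ n * y)"
proof (induction n)
  case (Suc n)
  have "y * a ^ Suc n = (y * a) * a ^ n"
    by (simp add: mult.assoc)
  also have "\<dots> \<approx> (sc c * (a * y)) * a ^ n"
    by (rule equiv_mod_right[OF assms])
  also have "\<dots> = sc c * a * (y * a ^ n)"
    by (simp add: mult.assoc)
  also have "\<dots> \<approx> sc c * a * (sc (c ^ n) * (a ^ n * y))"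
    by (rule equiv_mod_left[OF Suc])
  also have "\<dots> = sc (c ^ Suc n) * (a ^ Suc n * y)"
    by (simp add: sc_mult mult.assoc sc_left_commute[of a])
  finally show ?case .
qed simp

section \<open>Normal forms: signed powers of the generators times polynomials in y\<close>

definition Mon :: "int \<Rightarrow> disc_gen free" where
  "Mon k = (if k \<ge> 0 then z ^ nat k else zs ^ nat (- k))"

lemma \<theta>_power: "\<theta> k ^ n = \<theta> (int n * k)"
  by (induction n) (simp_all add: \<theta>_add ring_distribs)

lemma y_Mon: "y * Mon k \<approx> sc (\<theta> k) * (Mon k * y)"
  using y_power[OF y_z, of "nat k"] y_power[OF y_zs, of "nat (- k)"]
  by (cases "k \<ge> 0") (simp_all add: Mon_def \<theta>_power)

lemma homog_Mon: "homog k (Mon k)"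
  using homog_power[OF homog_z, of "nat k"] homog_power[OF homog_zs, of "nat (- k)"]
  by (simp add: Mon_def split: if_splits)

text \<open>All factors coming from \<open>zs\<close> have the form 1 - c t. The value shows that
  the symbol is a nonzero polynomial, which may be cancelled.\<close>

lemma symbol_Mon_0: "symbol (Mon k) k 0 = 1"
proof -
  have "symbol (z ^ n) (int n) 0 = 1" for n
    using symbol_z_power_mult[of n 1] by simp
  moreover have "symbol (zs ^ n) (- int n) 0 = 1" for n
    by (induction n) simp_all
  ultimately show ?thesis
    by (metis Mon_def int_nat_eq minus_minus nle_le neg_0_le_iff_le)
qed

text \<open>Horner evaluation of \<open>p\<close> at \<open>y\<close>.\<close>

definition y_poly :: "complex poly \<Rightarrow> disc_gen free" where
  "y_poly p = fold_coeffs (\<lambda>c f. sc c + y * f) p 0"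

lemma y_poly_0 [simp]: "y_poly 0 = 0"
  by (simp add: y_poly_def)

lemma y_poly_pCons [simp]: "y_poly (pCons c p) = sc c + y * y_poly p"
  by (cases "p = 0 \<and> c = 0") (auto simp: y_poly_def)

lemma y_poly_add: "y_poly (p + r) = y_poly p + y_poly r"
  by (induction p r rule: poly_induct2) (simp_all add: sc_add algebra_simps)

lemma y_poly_smult: "y_poly (smult c p) = sc c * y_poly p"
  by (induction p) (simp_all add: sc_mult distrib_left sc_left_commute[of y])

lemma y_poly_uminus: "y_poly (- p) = - y_poly p"
  using y_poly_smult[of "- 1" p] by (simp add: sc_uminus)

lemma symbol_y_poly: "symbol (y_poly p) k t = (if k = 0 then poly p t else 0)"
  by (induction p) simp_all

lemma symbol_mult_y_poly: "symbol (a * y_poly p) k t = symbol a k t * poly p t"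
proof -
  have "homog 0 (y_poly p)" by (simp add: homog_def symbol_y_poly)
  from symbol_mult_homog_right[OF this] show ?thesis by (simp add: symbol_y_poly)
qed

text \<open>Both \<open>z * zs\<close> and \<open>zs * z\<close> are congruent to some 1 - c y.
  Moving this factor past \<open>Mon k\<close> into the polynomial restores the normal form when a
  generator moves the degree towards zero.\<close>

lemma Mon_y_poly_linear:
  "(1 - sc c * y) * (Mon k * y_poly p) \<approx> Mon k * y_poly ([:1, - c * \<theta> k:] * p)"
proof -
  have "Mon k * y_poly p - sc c * (y * Mon k) * y_poly p
      \<approx> Mon k * y_poly p - sc c * (sc (\<theta> k) * (Mon k * y)) * y_poly p"
    by (intro equiv_mod_diff equiv_mod_right equiv_mod_left y_Mon equiv_mod_refl)
  also have "\<dots> = Mon k * (y_poly p + y * (sc (- c * \<theta> k) * y_poly p))"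
    by (simp add: sc_mult sc_uminus sc_left_commute[of "Mon k"] sc_left_commute[of y]
        mult.assoc distrib_left right_diff_distrib[of "Mon k" "y_poly p"])
  also have "\<dots> = Mon k * y_poly ([:1, - c * \<theta> k:] * p)"
    by (simp add: y_poly_add y_poly_smult y_poly_uminus sc_uminus)
  finally show ?thesis
    by (simp add: left_diff_distrib mult.assoc)
qed

lemma z_Mon: "\<exists>r. z * (Mon k * y_poly p) \<approx> Mon (k + 1) * y_poly r"
proof (cases "k \<ge> 0")
  case True
  then show ?thesis
    by (intro exI[of _ p]) (simp add: Mon_def nat_add_distrib mult.assoc)
next
  case False
  then have "nat (- k) = Suc (nat (- k - 1))" by simp
  \<comment> \<open>In negative degree a factor \<open>zs\<close> is split off and absorbed by
    \<open>z * zs = 1 - y\<close>.\<close>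
  then have "Mon k = zs * Mon (k + 1)"
    using False by (auto simp: Mon_def) 
  then have "z * (Mon k * y_poly p) = (1 - sc 1 * y) * (Mon (k + 1) * y_poly p)"
    by (simp add: mult.assoc)
  then show ?thesis using Mon_y_poly_linear[of 1 "k + 1" p] by auto
qed

lemma zs_Mon: "\<exists>r. zs * (Mon k * y_poly p) \<approx> Mon (k - 1) * y_poly r"
proof (cases "k \<le> 0")
  case True
  then have "nat (1 - k) = Suc (nat (- k))" by simp
  then show ?thesis using True
    by (intro exI[of _ p]) (auto simp: Mon_def mult.assoc)
next
  case False
  then have "nat k = Suc (nat (k - 1))" by simp
  then have "Mon k = z * Mon (k - 1)"
    using False by (auto simp: Mon_def)
  then have "zs * (Mon k * y_poly p) = (zs * z) * (Mon (k - 1) * y_poly p)"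
    by (simp add: mult.assoc)
  also have "\<dots> \<approx> (1 - sc (\<theta> 1) * y) * (Mon (k - 1) * y_poly p)"
    by (rule equiv_mod_right[OF zs_z])
  also note Mon_y_poly_linear
  finally show ?thesis by blast
qed

lemma word_normal_form: "\<exists>p. Poly_Mapping.single w 1 \<approx> Mon (weight w) * y_poly p"
proof (induction w rule: weight.induct)
  case 1
  show ?case by (intro exI[of _ 1]) (simp add: Mon_def single_Nil one_pCons)
next
  case (2 w)
  then obtain p where "Poly_Mapping.single w 1 \<approx> Mon (weight w) * y_poly p" ..
  from equiv_mod_left[OF this, of z] z_Mon[of "weight w" p] show ?case
    by (auto simp: single_Cons intro: equiv_mod_trans)
next
  case (3 w)
  then obtain p where "Poly_Mapping.single w 1 \<approx> Mon (weight w) * y_poly p" ..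
  from equiv_mod_left[OF this, of zs] zs_Mon[of "weight w" p] show ?case
    by (auto simp: single_Cons intro: equiv_mod_trans)
qed

lemma normal_form:
  "\<exists>S p. finite S \<and> a \<approx> (\<Sum>k\<in>S. Mon k * y_poly (p k))"
proof (induction a rule: poly_mapping_add_induct)
  case zero
  show ?case by (intro exI[of _ "{}"]) simp
next
  case (add a b)
  then obtain S p S' p' where S: "finite S" "finite S'"
    and a: "a \<approx> (\<Sum>k\<in>S. Mon k * y_poly (p k))" and b: "b \<approx> (\<Sum>k\<in>S'. Mon k * y_poly (p' k))"
    by blast
  define r where "r k = (if k \<in> S then p k else 0) + (if k \<in> S' then p' k else 0)" for k
  have "(\<Sum>k\<in>S. Mon k * y_poly (p k)) = (\<Sum>k\<in>S \<union> S'. Mon k * y_poly (if k \<in> S then p k else 0))"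
    "(\<Sum>k\<in>S'. Mon k * y_poly (p' k)) = (\<Sum>k\<in>S \<union> S'. Mon k * y_poly (if k \<in> S' then p' k else 0))"
    using S by (auto intro!: sum.mono_neutral_cong_left)
  then have "(\<Sum>k\<in>S \<union> S'. Mon k * y_poly (r k)) =
      (\<Sum>k\<in>S. Mon k * y_poly (p k)) + (\<Sum>k\<in>S'. Mon k * y_poly (p' k))"
    by (simp add: r_def y_poly_add distrib_left sum.distrib)
  with equiv_mod_add[OF a b] S show ?case
    by (intro exI[of _ "S \<union> S'"] exI[of _ r]) simp
next
  case (single w c)
  obtain p where "Poly_Mapping.single w 1 \<approx> Mon (weight w) * y_poly p"
    using word_normal_form by blast
  from equiv_mod_left[OF this, of "sc c"] show ?case
    by (subst single_eq_sc, intro exI[of _ "{weight w}"] exI[of _ "\<lambda>_. smult c p"])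
      (simp add: y_poly_smult sc_left_commute[of "Mon (weight w)"])
qed

text \<open>The symbol of a normal form in degree \<open>j\<close> is that of \<open>Mon j\<close>
  times \<open>p j\<close>. It vanishes for \<open>j \<noteq> k\<close>, and since complex
  polynomials have no zero divisors, so does \<open>p j\<close>.\<close>

lemma homog_normal_form:
  assumes "homog k a"
  obtains p where "a \<approx> Mon k * y_poly p"
proof -
  obtain S p where S: "finite S" and a: "a \<approx> (\<Sum>k\<in>S. Mon k * y_poly (p k))"
    using normal_form by blast
  have "p j = 0" if j: "j \<in> S - {k}" for j
  proof -
    have Mon: "symbol (Mon i) j t = 0" if "i \<noteq> j" for i t
      using homog_Mon[of i] that by (auto simp: homog_def)
    obtain r where r: "\<And>t. symbol (Mon j) j t = poly r t"
      using symbol_poly by blast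
    have "poly (r * p j) t = 0" for t
    proof -
      have "0 = symbol a j t"
        using assms j by (simp add: homog_def)
      also have "\<dots> = (\<Sum>i\<in>S. symbol (Mon i) j t * poly (p i) t)"
        by (simp add: equiv_mod_symbol[OF a] symbol_sum symbol_mult_y_poly)
      also have "\<dots> = (\<Sum>i\<in>S. if i = j then poly r t * poly (p j) t else 0)"
        by (intro sum.cong) (auto simp: Mon r)
      finally show ?thesis using S j by simp
    qed
    then have "r * p j = 0"
      using poly_all_0_iff_0 by blast
    moreover have "r \<noteq> 0"
      using symbol_Mon_0[of j] r[of 0] by auto
    ultimately show "p j = 0" by simp
  qed
  then have "(\<Sum>j\<in>S. Mon j * y_poly (p j)) = (\<Sum>j\<in>S \<inter> {k}. Mon j * y_poly (p j))"
    using S by (intro sum.mono_neutral_right) auto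
  with a have "a \<approx> Mon k * y_poly (if k \<in> S then p k else 0)"
    by (auto split: if_splits)
  then show ?thesis by (rule that)
qed

text \<open>The difference is homogeneous of degree 0 with zero symbol, and the symbol of its normal
  form \<open>Mon 0 * y_poly p\<close> is \<open>p\<close> itself.\<close>

lemma symbol_injective:
  assumes "symbol a = symbol b"
  shows "a \<approx> b"
proof -
  have "homog k (a - b)" for k
    using assms by (simp add: homog_def)
  then obtain p where p: "a - b \<approx> Mon 0 * y_poly p"
    using homog_normal_form by blast
  have "poly p t = 0" for t
    using fun_cong[OF fun_cong[OF equiv_mod_symbol[OF p], of 0], of t] assms
    by (simp add: symbol_y_poly Mon_def)
  then have "p = 0"
    using poly_all_0_iff_0 by blast
  with p show ?thesis by (simp add: equiv_mod_def Mon_def)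
qed

lemma disc_class_eq_iff: "disc_class q a = disc_class q b \<longleftrightarrow> symbol a = symbol b"
  using symbol_injective symbol_cong equiv_mod_iff_class by blast

section \<open>Graded components as spans of ordered monomials\<close>

definition span_rep :: "int \<Rightarrow> disc_gen free \<Rightarrow> bool" where
  "span_rep k a \<longleftrightarrow> disc_class q a \<in> disc_component q k"

lemma span_rep_iff: "span_rep k a \<longleftrightarrow> (\<exists>S c. finite S \<and> (\<forall>(i, j)\<in>S. int i - int j = k) \<and>
    symbol a = symbol (\<Sum>(i, j)\<in>S. sc (c i j) * z ^ i * zs ^ j))"
  unfolding span_rep_def disc_component_def by (auto simp: disc_class_eq_iff)

lemma span_rep_cong: "symbol a = symbol b \<Longrightarrow> span_rep k a \<Longrightarrow> span_rep k b"
  by (simp add: span_rep_iff)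

lemma span_rep_monomial: "int i - int j = k \<Longrightarrow> span_rep k (sc c * z ^ i * zs ^ j)"
  unfolding span_rep_iff by (intro exI[of _ "{(i, j)}"] exI[of _ "\<lambda>_ _. c"]) simp

lemma span_rep_0: "span_rep k 0"
  unfolding span_rep_iff by (intro exI[of _ "{}"]) auto

lemma span_rep_add:
  assumes "span_rep k a" "span_rep k b"
  shows "span_rep k (a + b)"
proof -
  obtain S c S' c' where S: "finite S" "finite S'"
    "\<forall>(i, j)\<in>S. int i - int j = k" "\<forall>(i, j)\<in>S'. int i - int j = k"
    and a: "symbol a = symbol (\<Sum>(i, j)\<in>S. sc (c i j) * z ^ i * zs ^ j)"
    and b: "symbol b = symbol (\<Sum>(i, j)\<in>S'. sc (c' i j) * z ^ i * zs ^ j)"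
    using assms unfolding span_rep_iff by blast
  define d where "d i j = (if (i, j) \<in> S then c i j else 0) + (if (i, j) \<in> S' then c' i j else 0)" for i j
  have "(\<Sum>(i, j)\<in>S. sc (c i j) * z ^ i * zs ^ j) =
      (\<Sum>(i, j)\<in>S \<union> S'. sc (if (i, j) \<in> S then c i j else 0) * z ^ i * zs ^ j)"
    "(\<Sum>(i, j)\<in>S'. sc (c' i j) * z ^ i * zs ^ j) =
      (\<Sum>(i, j)\<in>S \<union> S'. sc (if (i, j) \<in> S' then c' i j else 0) * z ^ i * zs ^ j)"
    using S by (auto intro!: sum.mono_neutral_cong_left)
  then have "(\<Sum>(i, j)\<in>S \<union> S'. sc (d i j) * z ^ i * zs ^ j) =
      (\<Sum>(i, j)\<in>S. sc (c i j) * z ^ i * zs ^ j) + (\<Sum>(i, j)\<in>S'. sc (c' i j) * z ^ i * zs ^ j)"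
    by (simp add: d_def sc_add distrib_right sum.distrib case_prod_unfold)
  with a b S show ?thesis unfolding span_rep_iff
    by (intro exI[of _ "S \<union> S'"] exI[of _ d]) (auto simp: fun_eq_iff)
qed

lemma span_rep_sum: "(\<And>i. i \<in> S \<Longrightarrow> span_rep k (x i)) \<Longrightarrow> span_rep k (\<Sum>i\<in>S. x i)"
  by (induction S rule: infinite_finite_induct) (auto simp: span_rep_0 span_rep_add)

text \<open>By linearity, left multiplication by \<open>f\<close> has to be examined only on the
  ordered monomials that span the component.\<close>

lemma span_rep_map:
  assumes "span_rep k a"
    and f: "\<And>i j c. int i - int j = k \<Longrightarrow> span_rep l (f * (sc c * z ^ i * zs ^ j))"
  shows "span_rep l (f * a)"
proof -
  obtain S c where S: "\<forall>(i, j)\<in>S. int i - int j = k"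
    and a: "symbol a = symbol (\<Sum>(i, j)\<in>S. sc (c i j) * z ^ i * zs ^ j)"
    using assms unfolding span_rep_iff by blast
  have "span_rep l (\<Sum>p\<in>S. f * (sc (c (fst p) (snd p)) * z ^ fst p * zs ^ snd p))"
    using S by (intro span_rep_sum f) auto
  then have "span_rep l (f * (\<Sum>(i, j)\<in>S. sc (c i j) * z ^ i * zs ^ j))"
    by (simp add: sum_distrib_left case_prod_unfold)
  moreover have "symbol (f * (\<Sum>(i, j)\<in>S. sc (c i j) * z ^ i * zs ^ j)) = symbol (f * a)"
    by (rule equiv_mod_symbol[OF equiv_mod_left[OF equiv_mod_sym[OF symbol_injective[OF a]]]])
  ultimately show ?thesis by (rule span_rep_cong[rotated])
qed

lemma span_rep_scale: "span_rep k a \<Longrightarrow> span_rep k (sc c * a)"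
proof (erule span_rep_map)
  fix i j :: nat and d assume "int i - int j = k"
  then show "span_rep k (sc c * (sc d * z ^ i * zs ^ j))"
    using span_rep_monomial[of i j k "c * d"] by (simp add: mult.assoc sc_mult)
qed

lemma span_rep_z: "span_rep k a \<Longrightarrow> span_rep (k + 1) (z * a)"
proof (erule span_rep_map)
  fix i j :: nat and c assume "int i - int j = k"
  then show "span_rep (k + 1) (z * (sc c * z ^ i * zs ^ j))"
    using span_rep_monomial[of "Suc i" j "k + 1" c] by (simp add: mult.assoc sc_left_commute[of z])
qed

lemma span_rep_zs: "span_rep k a \<Longrightarrow> span_rep (k - 1) (zs * a)"
proof (erule span_rep_map)
  fix i j :: nat and c assume k: "int i - int j = k"
  show "span_rep (k - 1) (zs * (sc c * z ^ i * zs ^ j))"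
  proof (cases i)
    case 0
    then show ?thesis
      using span_rep_monomial[of 0 "Suc j" "k - 1" c] k by (simp add: sc_left_commute[of zs] 0)
  next
    case (Suc n)
    \<comment> \<open>The coefficients are those of zs z^i = \<open>\<theta> i\<close> z^i zs + (1 -
      \<open>\<theta> i\<close>) z^(i-1), which restores the order of the generators.\<close>
    define b where "b = sc (c * \<theta> i) * z ^ i * zs ^ Suc j + sc (c * (1 - \<theta> i)) * z ^ n * zs ^ j"
    have "span_rep (k - 1) b"
      unfolding b_def using k Suc by (intro span_rep_add span_rep_monomial) auto
    moreover have "symbol b = symbol (zs * (sc c * z ^ i * zs ^ j))"
    proof (intro ext)
      fix l t
      have "\<theta> (int i) * \<theta> (l + 1 - int i) = \<theta> (l + 1)"
        by (simp flip: \<theta>_add)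
      then show "symbol b l t = symbol (zs * (sc c * z ^ i * zs ^ j)) l t"
        unfolding b_def
        by (simp add: mult.assoc symbol_z_power_mult Suc algebra_simps del: power_Suc)
          (simp add: Suc algebra_simps)
    qed
    ultimately show ?thesis by (rule span_rep_cong[rotated])
  qed
qed

lemma span_rep_y: "span_rep k a \<Longrightarrow> span_rep k (y * a)"
  using span_rep_add[OF _ span_rep_scale[OF span_rep_z[OF span_rep_zs]], of k a a "- 1"]
  by (simp add: sc_uminus algebra_simps)

text \<open>Ordered monomials are homogeneous. Conversely, the normal form of a homogeneous element
  is built from \<open>Mon k\<close> by left multiplications by \<open>y\<close>, under which the
  span is closed.\<close>

lemma disc_component_iff: "disc_class q a \<in> disc_component q k \<longleftrightarrow> homog k a"
proof
  assume "disc_class q a \<in> disc_component q k"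
  then obtain S c where S: "\<forall>(i, j)\<in>S. int i - int j = k"
    and a: "symbol a = symbol (\<Sum>(i, j)\<in>S. sc (c i j) * z ^ i * zs ^ j)"
    unfolding span_rep_def[symmetric] span_rep_iff by blast
  have "homog k (sc c * z ^ i * zs ^ j)" if "int i - int j = k" for i j c
    using homog_mult[OF homog_scale[OF homog_power[OF homog_z]] homog_power[OF homog_zs], of i j c]
      that by simp
  then have "homog k (\<Sum>(i, j)\<in>S. sc (c i j) * z ^ i * zs ^ j)"
    using S by (intro homog_sum) auto
  then show "homog k a" by (simp add: homog_def a)
next
  assume "homog k a"
  then obtain p where a: "a \<approx> Mon k * y_poly p"
    by (rule homog_normal_form)
  have Mon: "span_rep k (Mon k)"
    using span_rep_monomial[of "nat k" "nat (- k)" k 1] by (auto simp: Mon_def)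
  have "span_rep k (Mon k * y_poly p)"
  proof (induction p)
    case 0
    show ?case by (simp add: span_rep_0)
  next
    case (pCons c p)
    have Mon_0: "symbol (Mon k) l t = 0" if "l \<noteq> k" for l t
      using homog_symbol[OF homog_Mon that] .
    \<comment> \<open>\<open>y\<close> multiplies from the left, so the scalar undoes the factor
      \<open>\<theta> k\<close> from passing \<open>Mon k\<close>.\<close>
    have "span_rep k (sc c * Mon k + sc (inverse (\<theta> k)) * (y * (Mon k * y_poly p)))"
      by (intro span_rep_add span_rep_scale span_rep_y Mon pCons)
    moreover have "symbol (sc c * Mon k + sc (inverse (\<theta> k)) * (y * (Mon k * y_poly p))) =
        symbol (Mon k * y_poly (pCons c p))"
    proof (intro ext)
      fix l t
      show "symbol (sc c * Mon k + sc (inverse (\<theta> k)) * (y * (Mon k * y_poly p))) l t =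
          symbol (Mon k * y_poly (pCons c p)) l t"
        unfolding symbol_mult_y_poly symbol_y_mult symbol_add symbol_sc_mult
        by (cases "l = k") (simp_all add: Mon_0 algebra_simps)
    qed
    ultimately show ?case by (rule span_rep_cong[rotated])
  qed
  then have "span_rep k a"
    by (rule span_rep_cong[OF equiv_mod_symbol[OF equiv_mod_sym[OF a]]])
  then show "disc_class q a \<in> disc_component q k"
    unfolding span_rep_def .
qed

end


section \<open>Endomorphisms satisfying the relations of the quantum group\<close>

context quantum_disc
begin

lemma equiv_mod_symbol_iff: "a \<approx> b \<longleftrightarrow> symbol a = symbol b"
  using symbol_injective equiv_mod_symbol by blast

text \<open>Linearity is asked modulo the relations, since operators obtained from a symmetry by
  choosing representatives need not be linear on the free algebra.\<close>

definition linear_mod :: "(disc_gen free \<Rightarrow> disc_gen free) \<Rightarrow> bool" where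
  "linear_mod g \<longleftrightarrow> (\<forall>a b. a \<approx> b \<longrightarrow> g a \<approx> g b) \<and> (\<forall>a b. g (a + b) \<approx> g a + g b) \<and>
     (\<forall>c a. g (sc c * a) \<approx> sc c * g a)"

lemma linear_mod_cong: "linear_mod g \<Longrightarrow> a \<approx> b \<Longrightarrow> g a \<approx> g b"
  by (simp add: linear_mod_def)

lemma symbol_linear_add: "linear_mod g \<Longrightarrow> symbol (g (a + b)) k t = symbol (g a) k t + symbol (g b) k t"
  using equiv_mod_symbol[of "g (a + b)" "g a + g b"] by (simp add: linear_mod_def)

lemma symbol_linear_scale: "linear_mod g \<Longrightarrow> symbol (g (sc c * a)) k t = c * symbol (g a) k t"
  using equiv_mod_symbol[of "g (sc c * a)" "sc c * g a"] by (simp add: linear_mod_def)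

lemma linear_mod_0: "linear_mod g \<Longrightarrow> g 0 \<approx> 0"
  using symbol_linear_scale[of g 0 0] by (simp add: equiv_mod_symbol_iff fun_eq_iff)

text \<open>Rescaling the variable by a nonzero constant keeps a polynomial nonzero, and complex
  polynomials have no zero divisors. This is how homogeneous factors are cancelled in the
  disc.\<close>

lemma symbol_cancel:
  assumes "\<And>t. symbol a i (c * t) * symbol b j t = 0" "c \<noteq> 0"
  shows "(\<forall>t. symbol a i t = 0) \<or> (\<forall>t. symbol b j t = 0)"
proof -
  obtain p r where p: "\<And>t. symbol a i t = poly p t" and r: "\<And>t. symbol b j t = poly r t"
    using symbol_poly by metis
  have "poly (pcompose p [:0, c:] * r) t = 0" for t
    using assms(1)[of t] by (simp add: p r poly_pcompose mult.commute)
  then have "pcompose p [:0, c:] * r = 0"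
    using poly_all_0_iff_0 by blast
  then show ?thesis
    using assms(2) by (auto simp: p r pcompose_eq_0_iff)
qed

end

text \<open>The relations of the quantum group together with the Leibniz rules read off the
  coproduct. The values at 1 and the multiplicativity of \<open>\<kappa>'\<close> are
  derived.\<close>

locale uq_action = quantum_disc +
  fixes \<kappa> \<kappa>' e f :: "disc_gen free \<Rightarrow> disc_gen free"
  assumes linear: "linear_mod \<kappa>" "linear_mod \<kappa>'" "linear_mod e" "linear_mod f"
    and \<kappa>_\<kappa>': "\<And>a. \<kappa> (\<kappa>' a) \<approx> a" and \<kappa>'_\<kappa>: "\<And>a. \<kappa>' (\<kappa> a) \<approx> a"
    and \<kappa>_mult: "\<And>a b. \<kappa> (a * b) \<approx> \<kappa> a * \<kappa> b"
    and \<kappa>_e: "\<And>a. \<kappa> (e a) \<approx> sc (q\<^sup>2) * e (\<kappa> a)"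
    and \<kappa>_f: "\<And>a. \<kappa> (f a) \<approx> sc (inverse (q\<^sup>2)) * f (\<kappa> a)"
    and e_f: "\<And>a. e (f a) - f (e a) \<approx> sc (1 / (q - inverse q)) * (\<kappa> a - \<kappa>' a)"
    and e_mult: "\<And>a b. e (a * b) \<approx> a * e b + e a * \<kappa> b"
    and f_mult: "\<And>a b. f (a * b) \<approx> f a * b + \<kappa>' a * f b"
begin

lemmas symbol_linear =
  linear[THEN symbol_linear_add] linear[THEN symbol_linear_scale]

lemma q4: "q ^ 4 \<noteq> 1" "q\<^sup>2 \<noteq> 1"
  using not_root[of 4] not_root[of 2] by auto

lemma q_diff_inverse: "q - inverse q \<noteq> 0"
  using q4(2) by (auto simp: field_simps power2_eq_square)

text \<open>Multiplicativity is used for the product of 1 and \<open>\<kappa>' 1\<close>, an element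
  that \<open>\<kappa>\<close> maps to 1.\<close>

lemma \<kappa>_1: "\<kappa> 1 \<approx> 1"
proof -
  have "\<kappa> (1 * \<kappa>' 1) \<approx> \<kappa> 1 * \<kappa> (\<kappa>' 1)" by (rule \<kappa>_mult)
  also have "\<dots> \<approx> \<kappa> 1 * 1" by (rule equiv_mod_left[OF \<kappa>_\<kappa>'])
  finally have "\<kappa> 1 \<approx> \<kappa> (\<kappa>' 1)" by (simp add: equiv_mod_sym)
  then show ?thesis by (rule equiv_mod_trans[OF _ \<kappa>_\<kappa>'])
qed

lemma \<kappa>'_1: "\<kappa>' 1 \<approx> 1"
  by (rule equiv_mod_trans[OF equiv_mod_sym[OF linear_mod_cong[OF linear(2) \<kappa>_1]] \<kappa>'_\<kappa>])

text \<open>The Leibniz rule for the product of 1 with itself gives \<open>e 1\<close>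
  twice.\<close>

lemma e_1: "e 1 \<approx> 0"
proof -
  have "e (1 * 1) \<approx> 1 * e 1 + e 1 * \<kappa> 1" by (rule e_mult)
  also have "\<dots> \<approx> 1 * e 1 + e 1 * 1" by (intro equiv_mod_add equiv_mod_left \<kappa>_1 equiv_mod_refl)
  finally show ?thesis by (simp add: equiv_mod_symbol_iff fun_eq_iff)
qed

lemma f_1: "f 1 \<approx> 0"
proof -
  have "f (1 * 1) \<approx> f 1 * 1 + \<kappa>' 1 * f 1" by (rule f_mult)
  also have "\<dots> \<approx> f 1 * 1 + 1 * f 1" by (intro equiv_mod_add equiv_mod_right \<kappa>'_1 equiv_mod_refl)
  finally show ?thesis by (simp add: equiv_mod_symbol_iff fun_eq_iff)
qed

text \<open>The commutator of \<open>e\<close> and \<open>f\<close> vanishes, while the scalar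
  \<open>1 / (q - inverse q)\<close> in its relation does not.\<close>

lemma \<kappa>_eq_\<kappa>':
  assumes "(\<forall>a. e a \<approx> 0) \<or> (\<forall>a. f a \<approx> 0)"
  shows "\<kappa> a \<approx> \<kappa>' a"
proof -
  have "symbol (e (f a)) k t = 0 \<and> symbol (f (e a)) k t = 0" for k t
  proof -
    have "e (f a) \<approx> 0 \<and> f (e a) \<approx> 0"
      using assms linear(3,4)[THEN linear_mod_cong] linear(3,4)[THEN linear_mod_0] equiv_mod_trans
      by blast
    then show ?thesis by (simp add: equiv_mod_symbol_iff)
  qed
  then show ?thesis
    using e_f[of a] q_diff_inverse by (auto simp: equiv_mod_symbol_iff fun_eq_iff)
qed

end

section \<open>Symmetries of jump greater than 1: nonvanishing and the grading\<close>

locale jump_symmetry = uq_action +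
  fixes n :: int
  assumes homog_e: "\<And>k a. homog k a \<Longrightarrow> homog (k + n) (e a)"
    and homog_f: "\<And>k a. homog k a \<Longrightarrow> homog (k - n) (f a)"
    and nontrivial: "\<not> (\<forall>a. e a \<approx> 0 \<and> f a \<approx> 0)"
    and jump: "n > 1"
begin

text \<open>With \<open>\<kappa> = \<kappa>'\<close> the square of \<open>\<kappa>\<close> is the
  identity, while moving it across \<open>g\<close> multiplies by \<open>c\<^sup>2\<close>; hence
  \<open>g\<close> equals \<open>c\<^sup>2\<close> times itself.\<close>

lemma scaled_zero:
  assumes "linear_mod g" "\<And>a. \<kappa> (g a) \<approx> sc c * g (\<kappa> a)" "\<And>a. \<kappa> a \<approx> \<kappa>' a" "c\<^sup>2 \<noteq> 1"
  shows "g a \<approx> 0"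
proof -
  have \<kappa>\<kappa>: "\<kappa> (\<kappa> a) \<approx> a" for a
    using linear_mod_cong[OF linear(1) assms(3), of a] \<kappa>_\<kappa>' equiv_mod_trans by blast
  have "symbol (g a) k t = c\<^sup>2 * symbol (g a) k t" for k t
  proof -
    have "symbol (g a) k t = symbol (\<kappa> (\<kappa> (g a))) k t"
      using \<kappa>\<kappa> by (simp add: equiv_mod_symbol_iff)
    also have "\<dots> = symbol (\<kappa> (sc c * g (\<kappa> a))) k t"
      using linear_mod_cong[OF linear(1) assms(2)] by (simp add: equiv_mod_symbol_iff)
    also have "\<dots> = c * symbol (\<kappa> (g (\<kappa> a))) k t"
      by (simp add: symbol_linear)
    also have "\<dots> = c * (c * symbol (g (\<kappa> (\<kappa> a))) k t)"
      using assms(2) by (simp add: equiv_mod_symbol_iff)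
    also have "symbol (g (\<kappa> (\<kappa> a))) k t = symbol (g a) k t"
      using linear_mod_cong[OF assms(1) \<kappa>\<kappa>] by (simp add: equiv_mod_symbol_iff)
    finally show ?thesis by (simp add: power2_eq_square)
  qed
  then show ?thesis using assms(4) by (auto simp: equiv_mod_symbol_iff fun_eq_iff)
qed

text \<open>If one operator vanished, \<open>\<kappa>\<close> and \<open>\<kappa>'\<close> would
  agree and the other operator would vanish as well, because q^4 is not 1.\<close>

lemma e_nonzero: "\<not> (\<forall>a. e a \<approx> 0)" and f_nonzero: "\<not> (\<forall>a. f a \<approx> 0)"
proof -
  have c: "(inverse (q\<^sup>2))\<^sup>2 \<noteq> 1" "(q\<^sup>2)\<^sup>2 \<noteq> 1"
    using q4 by (simp_all add: power_inverse flip: power_mult)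
  show "\<not> (\<forall>a. e a \<approx> 0)"
    using scaled_zero[OF linear(4) \<kappa>_f \<kappa>_eq_\<kappa>' c(1)] nontrivial by blast
  show "\<not> (\<forall>a. f a \<approx> 0)"
    using scaled_zero[OF linear(3) \<kappa>_e \<kappa>_eq_\<kappa>' c(2)] nontrivial by blast
qed

lemma symbol_mult_equiv_0: "a \<approx> 0 \<Longrightarrow> symbol (a * b) = symbol 0" "a \<approx> 0 \<Longrightarrow> symbol (b * a) = symbol 0"
  using equiv_mod_symbol[OF equiv_mod_right[of a 0 b]] equiv_mod_symbol[OF equiv_mod_left[of a 0 b]]
  by simp_all

definition deg_gen :: "disc_gen \<Rightarrow> int" where
  "deg_gen g = (case g of Z_gen \<Rightarrow> 1 | Zstar_gen \<Rightarrow> - 1)"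

lemma homog_gen: "homog (deg_gen g) (gen g)"
  by (cases g) (auto simp: deg_gen_def homog_z homog_zs)

text \<open>By the Leibniz rule \<open>e\<close> would vanish everywhere if it vanished on both
  generators. The witness serves as a homogeneous factor that can be cancelled.\<close>

lemma e_gen_nonzero: obtains g s where "symbol (e (gen g)) (deg_gen g + n) s \<noteq> 0"
proof -
  have "\<exists>g. \<not> e (gen g) \<approx> 0"
  proof (rule ccontr)
    assume "\<nexists>g. \<not> e (gen g) \<approx> 0"
    then have g: "e (gen g) \<approx> 0" for g by blast
    have "e a \<approx> 0" for a
    proof (induction a rule: free_induct)
      case (gen h x)
      then show ?case
        using e_mult[of "gen h" x] symbol_mult_equiv_0(1)[OF g] symbol_mult_equiv_0(2)[OF gen]
        by (simp add: equiv_mod_symbol_iff fun_eq_iff)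
    qed (use e_1 in \<open>auto simp: equiv_mod_symbol_iff fun_eq_iff symbol_linear\<close>)
    then show False using e_nonzero by blast
  qed
  then obtain g k t where "symbol (e (gen g)) k t \<noteq> 0"
    by (auto simp: equiv_mod_symbol_iff fun_eq_iff)
  moreover have "k = deg_gen g + n"
    using calculation homog_symbol[OF homog_e[OF homog_gen]] by metis
  ultimately show ?thesis using that by blast
qed

lemma f_gen_nonzero: obtains g s where "symbol (f (gen g)) (deg_gen g - n) s \<noteq> 0"
proof -
  have "\<exists>g. \<not> f (gen g) \<approx> 0"
  proof (rule ccontr)
    assume "\<nexists>g. \<not> f (gen g) \<approx> 0"
    then have g: "f (gen g) \<approx> 0" for g by blast
    have "f a \<approx> 0" for a
    proof (induction a rule: free_induct)
      case (gen h x)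
      then show ?case
        using f_mult[of "gen h" x] symbol_mult_equiv_0(1)[OF g] symbol_mult_equiv_0(2)[OF gen]
        by (simp add: equiv_mod_symbol_iff fun_eq_iff)
    qed (use f_1 in \<open>auto simp: equiv_mod_symbol_iff fun_eq_iff symbol_linear\<close>)
    then show False using f_nonzero by blast
  qed
  then obtain g k t where "symbol (f (gen g)) k t \<noteq> 0"
    by (auto simp: equiv_mod_symbol_iff fun_eq_iff)
  moreover have "k = deg_gen g - n"
    using calculation homog_symbol[OF homog_f[OF homog_gen]] by metis
  ultimately show ?thesis using that by blast
qed

text \<open>The Leibniz rule writes \<open>e (gen g) * \<kappa> b\<close> as a difference of
  homogeneous elements; the left factor is homogeneous and nonzero, so it can be cancelled.\<close>

lemma homog_\<kappa>:
  assumes b: "homog m b"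
  shows "homog m (\<kappa> b)"
proof -
  obtain g s where s: "symbol (e (gen g)) (deg_gen g + n) s \<noteq> 0" by (rule e_gen_nonzero)
  let ?d = "deg_gen g"
  have "homog (?d + m + n) (e (gen g * b) - gen g * e b)"
    using homog_e[OF homog_mult[OF homog_gen b]] homog_mult[OF homog_gen homog_e[OF b]]
    by (intro homog_diff) (auto simp: algebra_simps)
  then have *: "homog (?d + m + n) (e (gen g) * \<kappa> b)"
    using e_mult[of "gen g" b] by (simp add: homog_def equiv_mod_symbol_iff)
  have "symbol (\<kappa> b) j t = 0" if "j \<noteq> m" for j t
  proof -
    have "symbol (e (gen g)) (?d + n) (\<theta> j * t) * symbol (\<kappa> b) j t = 0" for t
      using homog_symbol[OF *, of "?d + n + j" t] that
        symbol_mult_homog_left[OF homog_e[OF homog_gen], of g "\<kappa> b" "?d + n + j" t]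
      by simp
    from symbol_cancel[OF this] s show ?thesis by auto
  qed
  then show ?thesis by (simp add: homog_def)
qed

text \<open>The mirror argument: \<open>\<kappa>' a * f (gen g)\<close> is homogeneous and its right
  factor can be cancelled.\<close>

lemma homog_\<kappa>':
  assumes a: "homog m a"
  shows "homog m (\<kappa>' a)"
proof -
  obtain g s where s: "symbol (f (gen g)) (deg_gen g - n) s \<noteq> 0" by (rule f_gen_nonzero)
  let ?d = "deg_gen g"
  have "homog (m + ?d - n) (f (a * gen g) - f a * gen g)"
    using homog_f[OF homog_mult[OF a homog_gen]] homog_mult[OF homog_f[OF a] homog_gen]
    by (intro homog_diff) (auto simp: algebra_simps)
  then have *: "homog (m + ?d - n) (\<kappa>' a * f (gen g))"
    using f_mult[of a "gen g"] by (simp add: homog_def equiv_mod_symbol_iff)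
  have "symbol (\<kappa>' a) j t = 0" if "j \<noteq> m" for j t
  proof -
    have "symbol (\<kappa>' a) j (\<theta> (?d - n) * t) * symbol (f (gen g)) (?d - n) t = 0" for t
      using homog_symbol[OF *, of "j + ?d - n" t] that
        symbol_mult_homog_right[OF homog_f[OF homog_gen], of "\<kappa>' a" g "j + ?d - n" t]
      by (simp add: algebra_simps)
    from symbol_cancel[OF this] s show ?thesis by auto
  qed
  then show ?thesis by (simp add: homog_def)
qed

text \<open>Preserving degrees, \<open>\<kappa>\<close> multiplies a generator by a polynomial in
  \<open>y\<close>, and so does its inverse \<open>\<kappa>'\<close>. Composing them shows that the
  polynomial divides 1, so it is constant.\<close>

lemma \<kappa>_gen: "\<exists>c. \<kappa> (gen g) \<approx> sc c * gen g"
proof -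
  let ?d = "deg_gen g"
  have Mon: "Mon ?d = gen g"
    by (cases g) (auto simp: deg_gen_def Mon_def)
  obtain p where p: "\<kappa> (gen g) \<approx> gen g * y_poly p"
    using homog_normal_form[OF homog_\<kappa>[OF homog_gen, of g]] Mon by metis
  obtain p' where p': "\<kappa>' (gen g) \<approx> gen g * y_poly p'"
    using homog_normal_form[OF homog_\<kappa>'[OF homog_gen, of g]] Mon by metis
  obtain r where r: "\<And>t. symbol (\<kappa> (y_poly p')) 0 t = poly r t"
    using symbol_poly by metis
  obtain s where s: "\<And>t. symbol (gen g) ?d t = poly s t"
    using symbol_poly by metis
  have hom: "homog 0 (\<kappa> (y_poly p'))"
    by (rule homog_\<kappa>) (simp add: homog_def symbol_y_poly)
  have "gen g \<approx> \<kappa> (\<kappa>' (gen g))"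
    by (rule equiv_mod_sym[OF \<kappa>_\<kappa>'])
  also have "\<dots> \<approx> \<kappa> (gen g * y_poly p')"
    by (rule linear_mod_cong[OF linear(1) p'])
  also have "\<dots> \<approx> \<kappa> (gen g) * \<kappa> (y_poly p')" by (rule \<kappa>_mult)
  also have "\<dots> \<approx> gen g * y_poly p * \<kappa> (y_poly p')" by (rule equiv_mod_right[OF p])
  finally have "symbol (gen g) ?d t = symbol (gen g * y_poly p * \<kappa> (y_poly p')) ?d t" for t
    by (simp add: equiv_mod_symbol_iff)
  then have "poly s t = poly s t * poly p t * poly r t" for t
    unfolding symbol_mult_homog_right[OF hom] symbol_mult_y_poly r s by (simp add: s)
  then have "poly (s * (1 - p * r)) t = 0" for t
    by (simp add: right_diff_distrib mult.assoc)
  then have "s * (1 - p * r) = 0"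
    using poly_all_0_iff_0 by blast
  moreover have "poly s 0 = 1"
    using symbol_Mon_0[of ?d] by (simp add: Mon flip: s)
  then have "s \<noteq> 0" by auto
  ultimately have "p * r = 1" by simp
  then have "p dvd 1" by (metis dvdI)
  then obtain c where "p = [:c:]"
    by (auto simp: is_unit_poly_iff)
  then show ?thesis using p by (auto simp: sc_commute)
qed

section \<open>The weight of k\<close>

definition \<alpha> :: complex where "\<alpha> = (SOME c. \<kappa> z \<approx> sc c * z)"

lemma \<kappa>_z: "\<kappa> z \<approx> sc \<alpha> * z"
  unfolding \<alpha>_def using \<kappa>_gen by (rule someI_ex)

text \<open>Apply \<open>\<kappa>\<close> to the relation between the generators and take the degree
  0 symbol at t = 1, where that of \<open>z * zs\<close> vanishes. What remains is
  \<open>(1 - q\<^sup>2) * (1 - \<alpha> * \<beta>) = 0\<close>.\<close>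

lemma \<alpha>_zs: "\<alpha> \<noteq> 0" "\<kappa> zs \<approx> sc (inverse \<alpha>) * zs"
proof -
  obtain \<beta> where \<beta>: "\<kappa> zs \<approx> sc \<beta> * zs" using \<kappa>_gen by blast
  have z: "symbol (\<kappa> (a * b)) 0 1 = symbol (a' * b') 0 1"
    if "\<kappa> a \<approx> a'" "\<kappa> b \<approx> b'" for a b a' b'
  proof -
    have "\<kappa> (a * b) \<approx> a' * b'"
      using \<kappa>_mult equiv_mod_left[OF that(2), of "\<kappa> a"] equiv_mod_right[OF that(1), of b']
        equiv_mod_trans by blast
    then show ?thesis by (simp add: equiv_mod_symbol_iff)
  qed
  have "symbol (z * zs) = symbol (sc (q\<^sup>2) * (zs * z) + sc (1 - q\<^sup>2) * 1)"
    by (intro ext) (auto simp: \<theta>_1 field_simps)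
  then have "symbol (\<kappa> (z * zs)) 0 1 = symbol (\<kappa> (sc (q\<^sup>2) * (zs * z) + sc (1 - q\<^sup>2) * 1)) 0 1"
    using linear_mod_cong[OF linear(1)] unfolding equiv_mod_symbol_iff by metis
  also have "\<dots> = q\<^sup>2 * symbol (\<kappa> (zs * z)) 0 1 + (1 - q\<^sup>2) * symbol (\<kappa> 1) 0 1"
    by (simp only: symbol_linear)
  finally have "0 = q\<^sup>2 * (\<alpha> * \<beta> * (1 - \<theta> 1)) + (1 - q\<^sup>2)"
    using \<kappa>_1 by (simp add: z[OF \<kappa>_z \<beta>] z[OF \<beta> \<kappa>_z] equiv_mod_symbol_iff mult.assoc
        sc_left_commute[of z] sc_left_commute[of zs] algebra_simps)
  also have "q\<^sup>2 * (\<alpha> * \<beta> * (1 - \<theta> 1)) + (1 - q\<^sup>2) = (1 - q\<^sup>2) * (1 - \<alpha> * \<beta>)"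
    by (simp add: \<theta>_1 field_simps)
  finally have "\<alpha> * \<beta> = 1" using q4(2) by simp
  then show "\<alpha> \<noteq> 0" "\<kappa> zs \<approx> sc (inverse \<alpha>) * zs"
    using \<beta> by (auto simp: inverse_unique)
qed

lemma symbol_\<kappa>: "symbol (\<kappa> a) k t = \<alpha> powi k * symbol a k t"
proof (induction a arbitrary: k rule: free_induct)
  case (gen g x)
  have "\<kappa> (gen g * x) \<approx> sc (\<alpha> powi deg_gen g) * gen g * \<kappa> x"
  proof -
    have "\<kappa> (gen g) \<approx> sc (\<alpha> powi deg_gen g) * gen g"
      using \<kappa>_z \<alpha>_zs by (cases g) (simp_all add: deg_gen_def power_int_minus)
    then show ?thesis using \<kappa>_mult equiv_mod_right equiv_mod_trans by blast
  qed
  then have "symbol (\<kappa> (gen g * x)) k t = \<alpha> powi deg_gen g * symbol (gen g * \<kappa> x) k t"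
    by (simp add: equiv_mod_symbol_iff mult.assoc)
  also have "\<dots> = \<alpha> powi k * symbol (gen g * x) k t"
    by (cases g) (simp_all add: deg_gen_def gen \<alpha>_zs(1) power_int_diff power_int_add power_int_minus)
  finally show ?case .
qed (use \<kappa>_1 in \<open>auto simp: symbol_linear equiv_mod_symbol_iff algebra_simps\<close>)

lemma symbol_\<kappa>': "symbol (\<kappa>' a) k t = \<alpha> powi (- k) * symbol a k t"
  using symbol_\<kappa>[of "\<kappa>' a" k t] \<kappa>_\<kappa>'[of a] \<alpha>_zs(1)
  by (simp add: equiv_mod_symbol_iff power_int_minus field_simps)

text \<open>On a generator and on its image under \<open>e\<close>, whose degrees differ by
  \<open>n\<close>, \<open>\<kappa>\<close> acts by powers of \<open>\<alpha>\<close>; their ratio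
  is the scalar in the relation between k and e.\<close>

lemma \<alpha>_powi_n: "\<alpha> powi n = q\<^sup>2"
proof -
  obtain g s where s: "symbol (e (gen g)) (deg_gen g + n) s \<noteq> 0" by (rule e_gen_nonzero)
  let ?d = "deg_gen g"
  have "\<kappa> (gen g) \<approx> sc (\<alpha> powi ?d) * gen g"
    using homog_gen[of g] unfolding equiv_mod_symbol_iff
    by (intro ext) (metis homog_symbol mult_zero_right symbol_\<kappa> symbol_sc_mult)
  from linear_mod_cong[OF linear(3) this]
  have "symbol (e (\<kappa> (gen g))) (?d + n) s = \<alpha> powi ?d * symbol (e (gen g)) (?d + n) s"
    by (simp add: equiv_mod_symbol_iff symbol_linear)
  moreover have "symbol (\<kappa> (e (gen g))) (?d + n) s = q\<^sup>2 * symbol (e (\<kappa> (gen g))) (?d + n) s"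
    using \<kappa>_e by (simp add: equiv_mod_symbol_iff)
  ultimately show ?thesis
    using s \<alpha>_zs(1) by (simp add: symbol_\<kappa> power_int_add)
qed

text \<open>Otherwise q^(-2n) = q^2, so n = -1. The inequality is what makes \<open>e y\<close> and
  \<open>f y\<close> divisible by \<open>y\<close>.\<close>

lemma \<alpha>_neq: "\<alpha> \<noteq> \<theta> 1"
proof
  assume "\<alpha> = \<theta> 1"
  then have "\<theta> n = \<theta> (- 1)"
    using \<alpha>_powi_n by (simp add: \<theta>_minus_1) (simp add: \<theta>_def flip: power_int_mult)
  then have "\<theta> (n + 1) = 1" by (simp add: \<theta>_add \<theta>_minus)
  then show False using jump by (simp add: \<theta>_eq_1_iff)
qed

lemma \<theta>_n: "1 - \<theta> n \<noteq> 0" "1 - \<theta> (- n) \<noteq> 0"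
  using jump by (simp_all add: \<theta>_eq_1_iff)

section \<open>The twisted derivations on the commutation rules of y\<close>

lemma e_cong: "symbol a = symbol b \<Longrightarrow> symbol (e a) = symbol (e b)"
  and f_cong: "symbol a = symbol b \<Longrightarrow> symbol (f a) = symbol (f b)"
  by (simp_all only: linear_mod_cong[OF linear(3)] linear_mod_cong[OF linear(4)]
      flip: equiv_mod_symbol_iff)

lemma symbol_e_mult: "symbol (e (a * b)) k t = symbol (a * e b) k t + symbol (e a * \<kappa> b) k t"
  and symbol_f_mult: "symbol (f (a * b)) k t = symbol (f a * b) k t + symbol (\<kappa>' a * f b) k t"
  using e_mult f_mult by (simp_all add: equiv_mod_symbol_iff)

lemma symbol_y_z: "symbol (y * z) = symbol (sc (\<theta> 1) * (z * y))"
  and symbol_y_zs: "symbol (y * zs) = symbol (sc (\<theta> (- 1)) * (zs * y))"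
  using y_z y_zs by (simp_all add: equiv_mod_symbol_iff)

lemma e_y_z: "symbol (e (y * z)) k t = \<theta> 1 * symbol (e (z * y)) k t"
  and e_y_zs: "symbol (e (y * zs)) k t = \<theta> (- 1) * symbol (e (zs * y)) k t"
  and f_y_z: "symbol (f (y * z)) k t = \<theta> 1 * symbol (f (z * y)) k t"
  and f_y_zs: "symbol (f (y * zs)) k t = \<theta> (- 1) * symbol (f (zs * y)) k t"
  unfolding e_cong[OF symbol_y_z] e_cong[OF symbol_y_zs] f_cong[OF symbol_y_z] f_cong[OF symbol_y_zs]
  by (simp_all only: symbol_linear)

lemma symbol_y: "symbol y k t = (if k = 0 then t else 0)"
  by simp

lemma homog_\<kappa>_gens: "homog 1 (\<kappa> z)" "homog (- 1) (\<kappa> zs)" "homog 0 (\<kappa> y)"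
  "homog 1 (\<kappa>' z)" "homog (- 1) (\<kappa>' zs)" "homog 0 (\<kappa>' y)"
  by (intro homog_\<kappa> homog_\<kappa>' homog_z homog_zs homog_y)+

text \<open>Both commutation rules of \<open>y\<close> are sent through \<open>e\<close> and
  expanded by the Leibniz rule in degrees n + 1 and n - 1. Away from t = 0 the equations determine
  \<open>e z\<close> and \<open>e zs\<close> from \<open>e y\<close>.\<close>

lemma e_relations:
  "\<theta> (n + 1) * t * symbol (e z) (n + 1) t + symbol (e y) n (\<theta> 1 * t) * \<alpha> =
    \<theta> 1 * (symbol (e y) n t + symbol (e z) (n + 1) t * t)"
  "\<theta> (n - 1) * t * symbol (e zs) (n - 1) t + symbol (e y) n (\<theta> (- 1) * t) * (inverse \<alpha> * (1 - t)) =
    \<theta> (- 1) * ((1 - \<theta> n * t) * symbol (e y) n t + symbol (e zs) (n - 1) t * t)"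
proof -
  show "\<theta> (n + 1) * t * symbol (e z) (n + 1) t + symbol (e y) n (\<theta> 1 * t) * \<alpha> =
      \<theta> 1 * (symbol (e y) n t + symbol (e z) (n + 1) t * t)"
    using e_y_z[of "n + 1" t]
    unfolding symbol_e_mult symbol_y_mult symbol_z_mult
      symbol_mult_homog_right[OF homog_\<kappa>_gens(1)] symbol_mult_homog_right[OF homog_\<kappa>_gens(3)]
      symbol_\<kappa> symbol_y by simp
  show "\<theta> (n - 1) * t * symbol (e zs) (n - 1) t + symbol (e y) n (\<theta> (- 1) * t) * (inverse \<alpha> * (1 - t)) =
      \<theta> (- 1) * ((1 - \<theta> n * t) * symbol (e y) n t + symbol (e zs) (n - 1) t * t)"
    using e_y_zs[of "n - 1" t]
    unfolding symbol_e_mult symbol_y_mult symbol_zs_mult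
      symbol_mult_homog_right[OF homog_\<kappa>_gens(2)] symbol_mult_homog_right[OF homog_\<kappa>_gens(3)]
      symbol_\<kappa> symbol_y by (simp add: power_int_minus)
qed

text \<open>The same for \<open>f\<close> in degrees 1 - n and - 1 - n, with the twist
  \<open>\<kappa>'\<close> now on the left factor.\<close>

lemma f_relations:
  "symbol (f y) (- n) (\<theta> 1 * t) + \<theta> (1 - n) * t * symbol (f z) (1 - n) t =
    \<theta> 1 * (symbol (f z) (1 - n) t * t + inverse \<alpha> * symbol (f y) (- n) t)"
  "symbol (f y) (- n) (\<theta> (- 1) * t) * (1 - t) + \<theta> (- 1 - n) * t * symbol (f zs) (- 1 - n) t =
    \<theta> (- 1) * (symbol (f zs) (- 1 - n) t * t + \<alpha> * (1 - \<theta> (- n) * t) * symbol (f y) (- n) t)"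
proof -
  show "symbol (f y) (- n) (\<theta> 1 * t) + \<theta> (1 - n) * t * symbol (f z) (1 - n) t =
      \<theta> 1 * (symbol (f z) (1 - n) t * t + inverse \<alpha> * symbol (f y) (- n) t)"
    using f_y_z[of "1 - n" t]
    unfolding symbol_f_mult symbol_mult_homog_right[OF homog_y]
      symbol_mult_homog_right[OF homog_z]
      symbol_mult_homog_left[OF homog_\<kappa>_gens(4)] symbol_mult_homog_left[OF homog_\<kappa>_gens(6)]
      symbol_\<kappa>' symbol_y by (simp add: power_int_minus)
  show "symbol (f y) (- n) (\<theta> (- 1) * t) * (1 - t) + \<theta> (- 1 - n) * t * symbol (f zs) (- 1 - n) t =
      \<theta> (- 1) * (symbol (f zs) (- 1 - n) t * t + \<alpha> * (1 - \<theta> (- n) * t) * symbol (f y) (- n) t)"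
    using f_y_zs[of "- 1 - n" t]
    unfolding symbol_f_mult symbol_mult_homog_right[OF homog_y]
      symbol_mult_homog_right[OF homog_zs]
      symbol_mult_homog_left[OF homog_\<kappa>_gens(5)] symbol_mult_homog_left[OF homog_\<kappa>_gens(6)]
      symbol_\<kappa>' symbol_y by simp
qed


lemma symbol_y_quotient:
  assumes "symbol a k 0 = 0" "c \<noteq> 0"
  obtains p where "\<And>t. symbol a k t = c * t * poly p t"
proof -
  obtain r where r: "\<And>t. symbol a k t = poly r t"
    using symbol_poly by metis
  have "poly r 0 = 0" using assms r by metis
  then obtain p where "r = [:0, 1:] * p"
    using poly_eq_0_iff_dvd[of r 0] by (auto elim: dvdE)
  then show ?thesis
    using assms(2) by (intro that[of "smult (inverse c) p"]) (simp add: r field_simps)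
qed

text \<open>After localisation at \<open>y\<close> the skew derivation \<open>e\<close> is inner, \<open>e a = x \<kappa>(a) - a x\<close> with
  \<open>x = z\<^sup>n X(y)\<close>; similarly \<open>f a = v a - \<kappa>\<inverse>(a) v\<close> with \<open>v\<close> of degree \<open>-n\<close> and symbol \<open>Y\<close>.\<close>

definition X :: "complex poly" where
  "X = (SOME p. \<forall>t. symbol (e y) n t = (1 - \<theta> n) * t * poly p t)"

definition Y :: "complex poly" where
  "Y = (SOME p. \<forall>t. symbol (f y) (- n) t = (1 - \<theta> (- n)) * t * poly p t)"

text \<open>At t = 0 the first relation forces the symbol to vanish, as \<open>\<alpha>\<close>
  differs from \<open>\<theta> 1\<close>, so it is divisible by t. The factor
  \<open>1 - \<theta> n\<close> is that of the commutator of z^n X(y) with y.\<close>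

lemma symbol_e_y: "symbol (e y) n t = (1 - \<theta> n) * t * poly X t"
proof -
  have "\<alpha> * symbol (e y) n 0 = \<theta> 1 * symbol (e y) n 0"
    using e_relations(1)[of 0] by (simp add: mult.commute)
  then have "symbol (e y) n 0 = 0"
    using \<alpha>_neq by (metis mult_right_cancel)
  then have "\<exists>p. \<forall>t. symbol (e y) n t = (1 - \<theta> n) * t * poly p t"
    using symbol_y_quotient[OF _ \<theta>_n(1)] by metis
  then have "\<forall>t. symbol (e y) n t = (1 - \<theta> n) * t * poly X t"
    unfolding X_def by (rule someI_ex)
  then show ?thesis ..
qed

lemma symbol_f_y: "symbol (f y) (- n) t = (1 - \<theta> (- n)) * t * poly Y t"
proof -
  have "symbol (f y) (- n) 0 = \<theta> 1 * inverse \<alpha> * symbol (f y) (- n) 0"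
    using f_relations(1)[of 0] by (simp add: mult.assoc)
  moreover have "\<theta> 1 * inverse \<alpha> \<noteq> 1"
    using \<alpha>_neq \<alpha>_zs(1) by (simp add: field_simps)
  ultimately have "symbol (f y) (- n) 0 = 0"
    by (metis mult_cancel_right1)
  then have "\<exists>p. \<forall>t. symbol (f y) (- n) t = (1 - \<theta> (- n)) * t * poly p t"
    using symbol_y_quotient[OF _ \<theta>_n(2)] by metis
  then have "\<forall>t. symbol (f y) (- n) t = (1 - \<theta> (- n)) * t * poly Y t"
    unfolding Y_def by (rule someI_ex)
  then show ?thesis ..
qed

lemma \<theta>_mult: "\<theta> k * (\<theta> l * t) = \<theta> (k + l) * t"
  by (simp add: \<theta>_add)

text \<open>The relation is divided by t, whence \<open>t \<noteq> 0\<close>; the result is the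
  symbol of x \<open>\<kappa> z\<close> - z x.\<close>

lemma symbol_e_z: "t \<noteq> 0 \<Longrightarrow> symbol (e z) (n + 1) t = \<alpha> * poly X (\<theta> 1 * t) - poly X t"
proof -
  assume t: "t \<noteq> 0"
  have "(\<theta> 1 * (\<theta> n - 1) * t) *
      (symbol (e z) (n + 1) t - (\<alpha> * poly X (\<theta> 1 * t) - poly X t)) = 0"
    using e_relations(1)[of t] by (simp add: symbol_e_y \<theta>_add algebra_simps)
  then show ?thesis using t \<theta>_n(1) by auto
qed

lemma symbol_e_zs:
  "t \<noteq> 0 \<Longrightarrow> symbol (e zs) (n - 1) t =
    inverse \<alpha> * poly X (\<theta> (- 1) * t) * (1 - t) - (1 - \<theta> n * t) * poly X t"
proof -
  assume t: "t \<noteq> 0"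
  have "\<theta> (n - 1) = \<theta> n * \<theta> (- 1)" by (simp flip: \<theta>_add)
  then have "(\<theta> (- 1) * (\<theta> n - 1) * t) * (symbol (e zs) (n - 1) t -
      (inverse \<alpha> * poly X (\<theta> (- 1) * t) * (1 - t) - (1 - \<theta> n * t) * poly X t)) = 0"
    using e_relations(2)[of t] by (simp add: symbol_e_y algebra_simps)
  then show ?thesis using t \<theta>_n(1) by auto
qed

lemma symbol_f_z: "t \<noteq> 0 \<Longrightarrow> symbol (f z) (1 - n) t = poly Y (\<theta> 1 * t) - inverse \<alpha> * poly Y t"
proof -
  assume t: "t \<noteq> 0"
  have "\<theta> (1 - n) = \<theta> 1 * \<theta> (- n)" by (simp flip: \<theta>_add)
  then have "(\<theta> 1 * (\<theta> (- n) - 1) * t) *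
      (symbol (f z) (1 - n) t - (poly Y (\<theta> 1 * t) - inverse \<alpha> * poly Y t)) = 0"
    using f_relations(1)[of t] by (simp add: symbol_f_y algebra_simps)
  then show ?thesis using t \<theta>_n(2) by auto
qed

lemma symbol_f_zs:
  "t \<noteq> 0 \<Longrightarrow> symbol (f zs) (- 1 - n) t =
    poly Y (\<theta> (- 1) * t) * (1 - t) - \<alpha> * (1 - \<theta> (- n) * t) * poly Y t"
proof -
  assume t: "t \<noteq> 0"
  have "\<theta> (- 1 - n) = \<theta> (- 1) * \<theta> (- n)" by (simp flip: \<theta>_add)
  then have "(\<theta> (- 1) * (\<theta> (- n) - 1) * t) * (symbol (f zs) (- 1 - n) t -
      (poly Y (\<theta> (- 1) * t) * (1 - t) - \<alpha> * (1 - \<theta> (- n) * t) * poly Y t)) = 0"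
    using f_relations(2)[of t] by (simp add: symbol_f_y algebra_simps)
  then show ?thesis using t \<theta>_n(2) by auto
qed

text \<open>Both sides obey the same twisted Leibniz rule, so agreement on the generators
  suffices.\<close>

lemma symbol_e:
  assumes "t \<noteq> 0"
  shows "symbol (e a) (k + n) t =
    \<alpha> powi k * poly X (\<theta> k * t) * symbol a k t - symbol a k (\<theta> n * t) * poly X t"
proof (induction a arbitrary: k rule: free_induct)
  case (gen g a)
  show ?case
  proof (cases g)
    case Z_gen
    have *: "symbol (e (z * a)) (k + n) t = symbol (e a) (k - 1 + n) t +
        symbol (e z) (n + 1) (\<theta> (k - 1) * t) * (\<alpha> powi (k - 1) * symbol a (k - 1) t)"
      using homog_e[OF homog_z]
      by (simp add: symbol_e_mult symbol_mult_homog_left[of "n + 1"] symbol_\<kappa> algebra_simps)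
    have 2: "symbol (e z) (n + 1) (\<theta> (k - 1) * t) =
        \<alpha> * poly X (\<theta> k * t) - poly X (\<theta> (k - 1) * t)"
      using assms by (simp add: symbol_e_z \<theta>_mult)
    have 3: "\<alpha> powi k = \<alpha> * \<alpha> powi (k - 1)"
      using \<alpha>_zs(1) by (simp add: power_int_diff)
    show ?thesis
      unfolding Z_gen * gen 2 3 by (simp add: algebra_simps)
  next
    case Zstar_gen
    have *: "symbol (e (zs * a)) (k + n) t = (1 - \<theta> (k + n + 1) * t) * symbol (e a) (k + 1 + n) t +
        symbol (e zs) (n - 1) (\<theta> (k + 1) * t) * (\<alpha> powi (k + 1) * symbol a (k + 1) t)"
      using homog_e[OF homog_zs]
      by (simp add: symbol_e_mult symbol_mult_homog_left[of "n - 1"] symbol_\<kappa> algebra_simps)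
    have 1: "\<theta> (- 1) * (\<theta> (k + 1) * t) = \<theta> k * t" "\<theta> (k + n + 1) = \<theta> (k + 1) * \<theta> n"
      by (simp_all add: \<theta>_mult algebra_simps flip: \<theta>_add)
    have nz: "\<theta> (k + 1) * t \<noteq> 0" using assms by simp
    have 2: "symbol (e zs) (n - 1) (\<theta> (k + 1) * t) =
        inverse \<alpha> * poly X (\<theta> k * t) * (1 - \<theta> (k + 1) * t) -
        (1 - \<theta> (k + 1) * \<theta> n * t) * poly X (\<theta> (k + 1) * t)"
      unfolding symbol_e_zs[OF nz] 1 by (simp add: mult_ac)
    have 3: "\<alpha> powi (k + 1) = \<alpha> * \<alpha> powi k"
      using \<alpha>_zs(1) by (simp add: power_int_add)
    have 4: "\<alpha> * (inverse \<alpha> * c) = c" for c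
      using \<alpha>_zs(1) by simp
    show ?thesis
      unfolding Zstar_gen * gen 1 2 3 by (simp add: algebra_simps 4)
  qed
next
  case one
  show ?case using e_1 by (simp add: equiv_mod_symbol_iff)
next
  case (add a b)
  show ?case unfolding symbol_linear add symbol_add by (simp add: algebra_simps)
next
  case (scale c a)
  show ?case unfolding symbol_linear scale symbol_sc_mult by (simp add: algebra_simps)
qed

text \<open>As for \<open>e\<close>: v a - \<open>\<kappa>' a\<close> v satisfies the Leibniz rule
  of \<open>f\<close> and has the right values on the generators.\<close>

lemma symbol_f:
  assumes "t \<noteq> 0"
  shows "symbol (f a) (k - n) t =
    poly Y (\<theta> k * t) * symbol a k t - \<alpha> powi (- k) * symbol a k (\<theta> (- n) * t) * poly Y t"
proof (induction a arbitrary: k rule: free_induct)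
  case (gen g a)
  show ?case
  proof (cases g)
    case Z_gen
    have *: "symbol (f (z * a)) (k - n) t =
        symbol (f z) (1 - n) (\<theta> (k - 1) * t) * symbol a (k - 1) t +
        inverse \<alpha> * symbol (f a) (k - 1 - n) t"
      using homog_f[OF homog_z]
      by (simp add: symbol_f_mult symbol_mult_homog_left[of "1 - n"]
          symbol_mult_homog_left[OF homog_\<kappa>_gens(4)] symbol_\<kappa>' power_int_minus algebra_simps)
    have 2: "symbol (f z) (1 - n) (\<theta> (k - 1) * t) =
        poly Y (\<theta> k * t) - inverse \<alpha> * poly Y (\<theta> (k - 1) * t)"
      using assms by (simp add: symbol_f_z \<theta>_mult)
    have 3: "\<alpha> powi (- k) = inverse \<alpha> * \<alpha> powi (- (k - 1))"
      using \<alpha>_zs(1) by (simp add: power_int_diff power_int_minus field_simps)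
    show ?thesis
      unfolding Z_gen * gen 2 3 by (simp add: algebra_simps)
  next
    case Zstar_gen
    have *: "symbol (f (zs * a)) (k - n) t =
        symbol (f zs) (- 1 - n) (\<theta> (k + 1) * t) * symbol a (k + 1) t +
        \<alpha> * (1 - \<theta> (k - n + 1) * t) * symbol (f a) (k + 1 - n) t"
      using homog_f[OF homog_zs]
      by (simp add: symbol_f_mult symbol_mult_homog_left[of "- 1 - n"]
          symbol_mult_homog_left[OF homog_\<kappa>_gens(5)] symbol_\<kappa>' algebra_simps)
    have 1: "\<theta> (- 1) * (\<theta> (k + 1) * t) = \<theta> k * t"
        "\<theta> (k - n + 1) = \<theta> (k + 1) * \<theta> (- n)"
      by (simp_all add: \<theta>_mult algebra_simps flip: \<theta>_add)
    have nz: "\<theta> (k + 1) * t \<noteq> 0" using assms by simp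
    have 2: "symbol (f zs) (- 1 - n) (\<theta> (k + 1) * t) =
        poly Y (\<theta> k * t) * (1 - \<theta> (k + 1) * t) -
        \<alpha> * (1 - \<theta> (k + 1) * \<theta> (- n) * t) * poly Y (\<theta> (k + 1) * t)"
      unfolding symbol_f_zs[OF nz] 1 by (simp add: mult_ac)
    have 3: "\<alpha> powi (- k) = \<alpha> * \<alpha> powi (- (k + 1))"
      using \<alpha>_zs(1) by (simp add: power_int_diff power_int_add power_int_minus field_simps)
    show ?thesis
      unfolding Zstar_gen * gen 1 2 3 by (simp add: algebra_simps)
  qed
next
  case one
  show ?case using f_1 by (simp add: equiv_mod_symbol_iff)
next
  case (add a b)
  show ?case unfolding symbol_linear add symbol_add by (simp add: algebra_simps)
next
  case (scale c a)
  show ?case unfolding symbol_linear scale symbol_sc_mult by (simp add: algebra_simps)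
qed

text \<open>In the notation above, \<open>G\<close> and \<open>W\<close> are the symbols of \<open>v x\<close> and \<open>q\<^sup>-\<^sup>2 x v - v x\<close>.\<close>

definition G :: "complex poly" where "G = X * pcompose Y [:0, \<theta> n:]"

definition W :: "complex poly" where "W = smult (\<theta> 1) (pcompose G [:0, \<theta> (- n):]) - G"

lemma poly_W: "poly W t = \<theta> 1 * (poly X (\<theta> (- n) * t) * poly Y t) - poly X t * poly Y (\<theta> n * t)"
proof -
  have 1: "poly (pcompose p [:0, c:]) s = poly p (c * s)" for p :: "complex poly" and c s
    by (simp add: poly_pcompose mult.commute)
  have 2: "\<theta> n * (\<theta> (- n) * t) = t"
    using \<theta>_mult[of n "- n" t] by simp
  show ?thesis by (simp only: W_def G_def poly_diff poly_smult poly_mult 1 2)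
qed

text \<open>For inner operators the commutator of \<open>e\<close> and \<open>f\<close> at a is w
  \<open>\<kappa> a\<close> - \<open>\<kappa>' a\<close> w, where w has symbol \<open>W\<close>. The
  commutator relation is compared at a = z in degree 1.\<close>

lemma W_equation_nonzero:
  assumes "t \<noteq> 0"
  shows "\<alpha> * poly W (\<theta> 1 * t) - inverse \<alpha> * poly W t = (\<alpha> - inverse \<alpha>) / (q - inverse q)"
proof -
  \<comment> \<open>Both follow from \<open>\<alpha> powi n = q\<^sup>2\<close>, the inverse of
    \<open>\<theta> 1\<close>.\<close>
  have \<alpha>n: "\<alpha> powi (- n - 1) = inverse \<alpha> * \<theta> 1" "\<alpha> powi (1 - n) = \<alpha> * \<theta> 1"
    using \<alpha>_zs(1) by (simp_all add: power_int_diff power_int_minus \<alpha>_powi_n \<theta>_1 field_simps)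
  have ef: "symbol (e (f z)) 1 t = \<alpha> * \<theta> 1 * poly X (\<theta> (1 - n) * t) *
      (poly Y (\<theta> 1 * t) - inverse \<alpha> * poly Y t) -
      (poly Y (\<theta> (n + 1) * t) - inverse \<alpha> * poly Y (\<theta> n * t)) * poly X t"
    using symbol_e[OF assms, of "f z" "1 - n"] assms
    by (simp add: \<alpha>n symbol_f_z \<theta>_mult add.commute)
  have fe: "symbol (f (e z)) 1 t = poly Y (\<theta> (n + 1) * t) * (\<alpha> * poly X (\<theta> 1 * t) - poly X t) -
      inverse \<alpha> * \<theta> 1 * (\<alpha> * poly X (\<theta> (1 - n) * t) - poly X (\<theta> (- n) * t)) * poly Y t"
    using symbol_f[OF assms, of "e z" "n + 1"] assms
    by (simp add: \<alpha>n symbol_e_z \<theta>_mult)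
  have "symbol (e (f z) - f (e z)) 1 t =
      symbol (sc (1 / (q - inverse q)) * (\<kappa> z - \<kappa>' z)) 1 t"
    using e_f by (simp add: equiv_mod_symbol_iff)
  then have comm: "symbol (e (f z)) 1 t - symbol (f (e z)) 1 t = (\<alpha> - inverse \<alpha>) / (q - inverse q)"
    by (simp add: symbol_\<kappa> symbol_\<kappa>' power_int_minus)
  have \<theta>s: "\<theta> (1 - n) = \<theta> 1 * \<theta> (- n)" "\<theta> (n + 1) = \<theta> 1 * \<theta> n"
    by (simp_all add: add.commute flip: \<theta>_add)
  have "\<alpha> * poly W (\<theta> 1 * t) - inverse \<alpha> * poly W t =
      symbol (e (f z)) 1 t - symbol (f (e z)) 1 t"
    unfolding ef fe poly_W \<theta>s using \<alpha>_zs(1) by (simp add: algebra_simps)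
  with comm show ?thesis by simp
qed

section \<open>The polynomial equation and the contradiction\<close>

lemma poly_eqI_nonzero:
  fixes p r :: "complex poly"
  assumes "\<And>t. t \<noteq> 0 \<Longrightarrow> poly p t = poly r t"
  shows "p = r"
proof -
  have "poly ([:0, 1:] * (p - r)) t = 0" for t
    using assms[of t] by (cases "t = 0") simp_all
  then have "[:0, 1:] * (p - r) = 0"
    using poly_all_0_iff_0 by blast
  then show ?thesis by simp
qed

lemma W_equation:
  "smult \<alpha> (pcompose W [:0, \<theta> 1:]) - smult (inverse \<alpha>) W = [:(\<alpha> - inverse \<alpha>) / (q - inverse q):]"
  by (rule poly_eqI_nonzero) (use W_equation_nonzero in \<open>simp add: poly_pcompose mult.commute\<close>)

text \<open>The n-th power of the assumption, compared with
  \<open>\<alpha> powi n = q\<^sup>2\<close>, equates two powers of q, whose exponents agree because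
  q is not a root of 1.\<close>

lemma \<alpha>_square: assumes "\<alpha>\<^sup>2 = \<theta> (- int j)" shows "int j * n = 2"
proof -
  have "\<theta> (- 2) = (\<alpha> powi n)\<^sup>2"
    by (simp add: \<alpha>_powi_n \<theta>_def flip: power_mult)
  also have "\<dots> = (\<alpha>\<^sup>2) powi n"
    by (simp add: power2_eq_square power_int_mult_distrib)
  also have "\<dots> = \<theta> (- int j * n)"
    unfolding assms by (simp add: \<theta>_def mult.assoc flip: power_int_mult)
  finally have "\<theta> (int j * n - 2) = 1"
    by (simp add: \<theta>_diff \<theta>_minus)
  then show ?thesis by (simp add: \<theta>_eq_1_iff)
qed

text \<open>The right-hand side of the equation for \<open>W\<close> is constant, so the coefficient
  of \<open>W\<close> vanishes, and then that of \<open>G\<close>; both scalars are nonzero because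
  \<open>int j * n > 2\<close>. For n = 2 the argument leaves j = 1 open.\<close>

lemma coeff_G:
  assumes "j \<ge> 2"
  shows "coeff G j = 0"
proof -
  have jn: "int j * n > 2"
    using mult_mono[of 2 "int j" 2 n] assms jump by simp
  have "coeff (smult \<alpha> (pcompose W [:0, \<theta> 1:]) - smult (inverse \<alpha>) W) j = 0"
    unfolding W_equation using assms by (simp add: coeff_pCons split: nat.split)
  then have "(\<alpha> * \<theta> (int j) - inverse \<alpha>) * coeff W j = 0"
    by (simp add: coeff_pcompose_linear \<theta>_power algebra_simps)
  moreover have "\<alpha> * \<theta> (int j) - inverse \<alpha> \<noteq> 0"
    using \<alpha>_square[of j] jn \<alpha>_zs(1)
    by (auto simp: \<theta>_minus field_simps power2_eq_square)
  ultimately have "coeff W j = 0" by simp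
  moreover have "coeff W j = (\<theta> (1 - int j * n) - 1) * coeff G j"
    by (simp add: W_def coeff_pcompose_linear \<theta>_power \<theta>_diff \<theta>_minus power_inverse
        algebra_simps divide_inverse)
  ultimately show ?thesis
    using jn by (auto simp: \<theta>_eq_1_iff)
qed

text \<open>\<open>f y\<close> has degree \<open>- n\<close>, so its symbol vanishes at these
  points, while its factors other than \<open>Y\<close> do not.\<close>

lemma Y_roots: "m < n \<Longrightarrow> m \<ge> 0 \<Longrightarrow> poly Y (\<theta> m) = 0"
  using symbol_f_y[of "\<theta> m"] symbol_vanishes[of m "- n" "f y"] \<theta>_n(2) by simp

lemma contradiction: False
proof -
  define a b where "a = coeff G 0" and "b = coeff G 1"
  have "G = [:a, b:]"
  proof (rule poly_eqI)
    fix i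
    show "coeff G i = coeff [:a, b:] i"
      using coeff_G[of i] by (cases i; cases "i - 1") (auto simp: a_def b_def)
  qed
  then have G: "poly G t = a + b * t" for t by (simp add: mult.commute)
  \<comment> \<open>\<open>G\<close> has the factor Y(\<open>\<theta> n\<close> t), so a root
    \<open>\<theta> m\<close> of \<open>Y\<close> becomes a root \<open>\<theta> (m - n)\<close> of
    \<open>G\<close>.\<close>
  have root: "a + b * \<theta> (m - n) = 0" if "m \<ge> 0" "m < n" for m
    using Y_roots[OF that(2,1)] unfolding G[symmetric]
    by (simp add: G_def poly_pcompose flip: \<theta>_add)
  \<comment> \<open>Two distinct roots of a polynomial of degree at most 1; the second is available
    because \<open>n > 1\<close>.\<close>
  have ab: "a + b * \<theta> (- n) = 0" "a + b * \<theta> (1 - n) = 0"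
    using root[of 0] root[of 1] jump by simp_all
  have "b * (\<theta> (1 - n) - \<theta> (- n)) = (a + b * \<theta> (1 - n)) - (a + b * \<theta> (- n))"
    by (simp add: algebra_simps)
  then have "b * (\<theta> (1 - n) - \<theta> (- n)) = 0" by (simp only: ab diff_self)
  moreover have "\<theta> (1 - n) = \<theta> 1 * \<theta> (- n)" by (simp flip: \<theta>_add)
  then have "\<theta> (1 - n) - \<theta> (- n) \<noteq> 0" by (simp add: \<theta>_eq_1_iff)
  ultimately have "b = 0" by simp
  with ab have "a = 0" by simp
  with \<open>b = 0\<close> have "G = 0" using \<open>G = [:a, b:]\<close> by simp
  then have "W = 0" by (simp add: W_def)
  then have "\<alpha> = inverse \<alpha>" using W_equation q_diff_inverse by simp
  \<comment> \<open>The case j = 0 of \<open>\<alpha>_square\<close>, whose conclusion is 0 =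
    2.\<close>
  then have "\<alpha>\<^sup>2 = \<theta> (- int 0)" using \<alpha>_zs(1) by (simp add: field_simps power2_eq_square)
  from \<alpha>_square[OF this] show False by simp
qed

end


section \<open>From endomorphisms of the free algebra to Hopf symmetries\<close>

lemma uq_truncate: "module.truncate (uq q) = presented_alg (uq_rels q)"
  by (simp add: uq_def Let_def module.truncate_def module.extend_def)

lemma uq_simps:
  "carrier (uq q) = carrier (presented_alg (uq_rels q))"
  "comult (uq q) X = (\<Union>x\<in>X. tensor_class (presented_alg (uq_rels q)) (presented_alg (uq_rels q))
     (project_tensor (uq_rels q) (free_extension sc uq_comult_gen x)))"
  "counit (uq q) X = the_elem (free_extension id uq_counit_gen ` X)"
  by (simp_all add: uq_def Let_def module.extend_def hopf_algebra.fields_def)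

lemma free_extension_eq:
  "free_extension s g x = linear_extension (\<lambda>w c. s c * prod_list (map g w)) x"
  by (simp add: free_extension_def linear_extension_def)

interpretation sc_extension: termwise_additive
  "\<lambda>w c. sc c * g w" for g :: "'m \<Rightarrow> ('n::monoid_add \<Rightarrow>\<^sub>0 complex)"
  by unfold_locales (simp add: sc_add distrib_right)

interpretation counit_extension: termwise_additive "\<lambda>w c. id c * prod_list (map uq_counit_gen w)"
  by unfold_locales (simp add: algebra_simps)

interpretation project_extension: termwise_additive
  "\<lambda>p c. Poly_Mapping.single (g p) c" for g :: "'m \<Rightarrow> 'n"
  by unfold_locales (simp add: single_add)

lemma project_tensor_eq: "project_tensor R t = linear_extension
    (\<lambda>p c. Poly_Mapping.single (rel_class R (Poly_Mapping.single (fst p) 1),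
      rel_class R (Poly_Mapping.single (snd p) 1)) c) t"
  by (simp add: project_tensor_def linear_extension_def case_prod_unfold)

lemma sc_mult_single: "sc d * Poly_Mapping.single w c = Poly_Mapping.single w (d * c)"
  by (simp add: sc_def mult_single)

lemma linear_extension_sc:
  "linear_extension (\<lambda>w c. sc c * g w) (sc d * x) = sc d * linear_extension (\<lambda>w c. sc c * g w) x"
proof (induction x rule: poly_mapping_add_induct)
  case (single w c)
  show ?case by (simp add: sc_mult_single sc_mult mult.assoc)
qed (simp_all add: distrib_left sc_extension.extension_add)

text \<open>The first argument of \<open>P\<close> is a class, because coproducts are formal sums
  over pairs of classes; on the side of the disc \<open>P\<close> works with
  representatives.\<close>

definition (in quantum_disc) acts_through ::
    "(uq_gen free set \<Rightarrow> disc_gen free set \<Rightarrow> disc_gen free set) \<Rightarrow>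
     (uq_gen free set \<Rightarrow> disc_gen free \<Rightarrow> disc_gen free) \<Rightarrow> bool" where
  "acts_through \<pi> P \<longleftrightarrow> (\<forall>x a. \<pi> (uq_class q x) (disc_class q a) = disc_class q (P (uq_class q x) a))"

text \<open>The Sweedler sum over the support of \<open>t\<close> becomes a linear extension, hence
  additive in \<open>t\<close>.\<close>

lemma (in quantum_disc) comult_sum:
  assumes P: "acts_through \<pi> P"
    and t: "Poly_Mapping.keys t \<subseteq> range (uq_class q) \<times> range (uq_class q)"
  shows "(\<Oplus>\<^bsub>disc q\<^esub>p\<in>Poly_Mapping.keys t. Poly_Mapping.lookup t p \<odot>\<^bsub>disc q\<^esub>
      (\<pi> (fst p) (disc_class q a) \<otimes>\<^bsub>disc q\<^esub> \<pi> (snd p) (disc_class q b))) =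
    disc_class q (linear_extension (\<lambda>p c. sc c * (P (fst p) a * P (snd p) b)) t)"
proof -
  interpret A: ring "disc q" unfolding disc_def by (rule ring_presented)
  have "Poly_Mapping.lookup t p \<odot>\<^bsub>disc q\<^esub>
      (\<pi> (fst p) (disc_class q a) \<otimes>\<^bsub>disc q\<^esub> \<pi> (snd p) (disc_class q b)) =
      disc_class q (sc (Poly_Mapping.lookup t p) * (P (fst p) a * P (snd p) b))"
    if "p \<in> Poly_Mapping.keys t" for p
    using P t that by (auto simp: acts_through_def disc_def)
  then show ?thesis
    unfolding linear_extension_def
    by (subst A.finsum_cong'[OF refl]) (auto simp: disc_def finsum_presented)
qed

section \<open>The action of the free algebra on k, its inverse, e and f\<close>

context uq_action
begin

fun gen_action :: "uq_gen \<Rightarrow> disc_gen free \<Rightarrow> disc_gen free" where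
  "gen_action K_gen = \<kappa>"
| "gen_action Kinv_gen = \<kappa>'"
| "gen_action E_gen = e"
| "gen_action F_gen = f"

definition act :: "uq_gen free \<Rightarrow> disc_gen free \<Rightarrow> disc_gen free" where
  "act x a = linear_extension (\<lambda>w c. sc c * foldr gen_action w a) x"

lemma linear_mod_gen_action: "linear_mod (gen_action g)"
  by (cases g) (simp_all add: linear)

lemma linear_mod_add: "linear_mod g \<Longrightarrow> g (a + b) \<approx> g a + g b"
  and linear_mod_scale: "linear_mod g \<Longrightarrow> g (sc c * a) \<approx> sc c * g a"
  by (simp_all add: linear_mod_def)

lemma act_add: "act (x + x') a = act x a + act x' a"
  and act_diff: "act (x - x') a = act x a - act x' a"
  and act_0 [simp]: "act 0 a = 0"
  and act_scale: "act (sc c * x) a = sc c * act x a"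
  and act_single: "act (Poly_Mapping.single w c) a = sc c * foldr gen_action w a"
  by (simp_all add: act_def sc_extension.extension_add sc_extension.extension_diff
      linear_extension_sc)

lemma act_1 [simp]: "act 1 a = a"
  using act_single[of "[]" 1 a] by (simp add: single_Nil)

text \<open>This is only a congruence, since the operators of the generators are linear modulo the
  relations.\<close>

lemma act_gen_mult: "act (gen g * x) a \<approx> gen_action g (act x a)"
proof (induction x rule: poly_mapping_add_induct)
  case zero
  show ?case
    using linear_mod_0[OF linear_mod_gen_action] by (simp add: equiv_mod_sym)
next
  case (add x y)
  show ?case
    using equiv_mod_trans[OF equiv_mod_add[OF add]
        equiv_mod_sym[OF linear_mod_add[OF linear_mod_gen_action]]]
    by (simp add: distrib_left act_add)
next
  case (single w c)
  show ?case
    using equiv_mod_sym[OF linear_mod_scale[OF linear_mod_gen_action]]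
    by (simp add: gen_def mult_single plus_list_def act_single)
qed

lemma act_gen: "act (gen g) a \<approx> gen_action g a"
  using act_gen_mult[of g 1 a] by simp

lemma linear_mod_compose:
  assumes "linear_mod g" "linear_mod h" "\<And>a. k a \<approx> g (h a)"
  shows "linear_mod k"
  unfolding linear_mod_def
proof (intro conjI allI impI)
  fix a b assume "a \<approx> b"
  then show "k a \<approx> k b"
    using assms linear_mod_cong equiv_mod_trans equiv_mod_sym by metis
next
  fix a b
  have "g (h (a + b)) \<approx> g (h a) + g (h b)"
    using equiv_mod_trans[OF linear_mod_cong[OF assms(1) linear_mod_add[OF assms(2)]]
        linear_mod_add[OF assms(1)]] .
  then show "k (a + b) \<approx> k a + k b"
    using assms(3) equiv_mod_add equiv_mod_trans equiv_mod_sym by metis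
next
  fix c a
  have "g (h (sc c * a)) \<approx> sc c * g (h a)"
    using equiv_mod_trans[OF linear_mod_cong[OF assms(1) linear_mod_scale[OF assms(2)]]
        linear_mod_scale[OF assms(1)]] .
  then show "k (sc c * a) \<approx> sc c * k a"
    using assms(3) equiv_mod_left equiv_mod_trans equiv_mod_sym by metis
qed

lemma linear_mod_act: "linear_mod (act x)"
proof (induction x rule: free_induct)
  case (add x y)
  show ?case
    unfolding linear_mod_def act_add
  proof (intro conjI allI impI)
    fix a b assume "a \<approx> b"
    then show "act x a + act y a \<approx> act x b + act y b"
      by (intro equiv_mod_add linear_mod_cong[OF add(1)] linear_mod_cong[OF add(2)])
  next
    fix a b
    show "act x (a + b) + act y (a + b) \<approx> act x a + act y a + (act x b + act y b)"
      using equiv_mod_add[OF linear_mod_add[OF add(1)] linear_mod_add[OF add(2)], of a b a b]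
      by (simp add: algebra_simps)
  next
    fix c a
    show "act x (sc c * a) + act y (sc c * a) \<approx> sc c * (act x a + act y a)"
      using equiv_mod_add[OF linear_mod_scale[OF add(1)] linear_mod_scale[OF add(2)], of c a c a]
      by (simp add: distrib_left)
  qed
next
  case (scale d x)
  show ?case
    unfolding linear_mod_def act_scale
  proof (intro conjI allI impI)
    fix a b assume "a \<approx> b"
    then show "sc d * act x a \<approx> sc d * act x b"
      by (intro equiv_mod_left linear_mod_cong[OF scale])
  next
    fix a b
    show "sc d * act x (a + b) \<approx> sc d * act x a + sc d * act x b"
      using equiv_mod_left[OF linear_mod_add[OF scale]] by (simp add: distrib_left)
  next
    fix c a
    show "sc d * act x (sc c * a) \<approx> sc c * (sc d * act x a)"
      using equiv_mod_left[OF linear_mod_scale[OF scale], of "sc d" c a]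
        sc_left_commute[of "sc d" c "act x a"] by simp
  qed
next
  case one
  show ?case by (simp add: linear_mod_def)
next
  case (gen g x)
  show ?case
    by (rule linear_mod_compose[OF linear_mod_gen_action gen act_gen_mult])
qed

lemma act_mult: "act (x * x') a \<approx> act x (act x' a)"
proof (induction x rule: free_induct)
  case (add x1 x2)
  then show ?case by (simp add: distrib_right act_add equiv_mod_add)
next
  case (scale c x)
  then show ?case by (simp add: mult.assoc act_scale equiv_mod_left)
next
  case (gen g x)
  have "act (gen g * x * x') a \<approx> gen_action g (act (x * x') a)"
    using act_gen_mult[of g "x * x'" a] by (simp add: mult.assoc)
  also have "\<dots> \<approx> gen_action g (act x (act x' a))"
    by (rule linear_mod_cong[OF linear_mod_gen_action gen])
  also have "\<dots> \<approx> act (gen g * x) (act x' a)"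
    by (rule equiv_mod_sym[OF act_gen_mult])
  finally show ?case .
qed simp

lemma equiv_mod_0_iff: "a \<approx> b \<longleftrightarrow> a - b \<approx> 0"
  by (simp add: equiv_mod_def)

lemma act_gen_gen: "act (gen g * gen h) a \<approx> gen_action g (gen_action h a)"
  using equiv_mod_trans[OF act_gen_mult linear_mod_cong[OF linear_mod_gen_action act_gen]] .

lemma act_uq_rels:
  assumes "x \<in> uq_rels q"
  shows "act x a \<approx> 0"
proof -
  have s: "symbol (act (gen g * gen h) a) = symbol (gen_action g (gen_action h a))"
    "symbol (act (gen g) a) = symbol (gen_action g a)" for g h
    using act_gen_gen act_gen by (simp_all add: equiv_mod_symbol_iff)
  have "symbol (act x a) k t = 0" for k t
    using assms \<kappa>_\<kappa>'[of a] \<kappa>'_\<kappa>[of a] \<kappa>_e[of a] \<kappa>_f[of a] e_f[of a]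
    by (auto simp: uq_rels_def act_add act_diff act_scale mult.assoc s equiv_mod_symbol_iff
        fun_eq_iff)
  then show ?thesis by (simp add: equiv_mod_symbol_iff fun_eq_iff)
qed

text \<open>The elements acting as zero form a two-sided ideal: on the left because operators
  preserve zero, on the right because \<open>a\<close> is arbitrary.\<close>

lemma act_rel_ideal: "x \<in> rel_ideal (uq_rels q) \<Longrightarrow> act x a \<approx> 0"
proof (induction x arbitrary: a rule: rel_ideal_induct)
  case (add x y)
  then show ?case using equiv_mod_add[of "act x a" 0 "act y a" 0] by (simp add: act_add)
next
  case (mult_left c x)
  show ?case
    by (rule equiv_mod_trans[OF act_mult equiv_mod_trans[OF
          linear_mod_cong[OF linear_mod_act mult_left] linear_mod_0[OF linear_mod_act]]])
next
  case (mult_right c x)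
  show ?case by (rule equiv_mod_trans[OF act_mult mult_right])
qed (simp_all add: act_uq_rels)

lemma act_cong: "uq_class q x = uq_class q x' \<Longrightarrow> act x a \<approx> act x' a"
  using act_rel_ideal[of "x - x'" a] unfolding rel_class_eq_iff equiv_mod_0_iff[of "act x a"]
  by (simp add: act_diff)

text \<open>Each generator multiplies 1 by its counit, so a word multiplies 1 by the product of the
  counits of its letters.\<close>

lemma act_unit: "act x 1 \<approx> sc (free_extension id uq_counit_gen x)"
proof -
  have word: "foldr gen_action w 1 \<approx> sc (prod_list (map uq_counit_gen w))" for w
  proof (induction w)
    case (Cons g w)
    let ?c = "prod_list (map uq_counit_gen w)"
    have "gen_action g 1 \<approx> sc (uq_counit_gen g) * 1"
      by (cases g) (simp_all add: \<kappa>_1 \<kappa>'_1 e_1 f_1)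
    from equiv_mod_left[OF this, of "sc ?c"]
    have "sc ?c * gen_action g 1 \<approx> sc (uq_counit_gen g * ?c)"
      by (simp add: mult.commute flip: sc_mult)
    with linear_mod_scale[OF linear_mod_gen_action, of g ?c 1]
    have "gen_action g (sc ?c * 1) \<approx> sc (uq_counit_gen g * ?c)"
      by (rule equiv_mod_trans)
    then have "gen_action g (foldr gen_action w 1) \<approx> sc (uq_counit_gen g * ?c)"
      unfolding mult_1_right
      by (rule equiv_mod_trans[OF linear_mod_cong[OF linear_mod_gen_action Cons]])
    then show ?case by simp
  qed simp
  show ?thesis
  proof (induction x rule: poly_mapping_add_induct)
    case (add x y)
    then show ?case
      by (simp add: act_add free_extension_eq counit_extension.extension_add sc_add equiv_mod_add
          del: id_apply)
  next
    case (single w c)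
    show ?case
      using equiv_mod_left[OF word, of "sc c" w]
        counit_extension.extension_single[of w c]
      by (simp add: act_single free_extension_eq sc_mult)
  qed (simp add: free_extension_eq linear_extension_def)
qed

text \<open>The action of the tensor square on the pair \<open>a\<close>, \<open>b\<close>, followed
  by multiplication; the coproduct axiom says that \<open>act x (a * b)\<close> is its value at the
  coproduct of \<open>x\<close>.\<close>

definition tensor_action :: "disc_gen free \<Rightarrow> disc_gen free \<Rightarrow>
    (uq_gen list \<times> uq_gen list \<Rightarrow>\<^sub>0 complex) \<Rightarrow> disc_gen free" where
  "tensor_action a b s = linear_extension
    (\<lambda>p c. sc c * (act (Poly_Mapping.single (fst p) 1) a * act (Poly_Mapping.single (snd p) 1) b)) s"

lemma tensor_action_add: "tensor_action a b (s + s') = tensor_action a b s + tensor_action a b s'"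
  and tensor_action_0 [simp]: "tensor_action a b 0 = 0"
  and tensor_action_scale: "tensor_action a b (sc c * s) = sc c * tensor_action a b s"
  and tensor_action_single: "tensor_action a b (Poly_Mapping.single (u, v) c) =
    sc c * (act (Poly_Mapping.single u 1) a * act (Poly_Mapping.single v 1) b)"
  by (simp_all add: tensor_action_def sc_extension.extension_add linear_extension_sc)

text \<open>\<open>\<kappa>'\<close> is inverse to a multiplicative map.\<close>

lemma \<kappa>'_mult: "\<kappa>' (a * b) \<approx> \<kappa>' a * \<kappa>' b"
proof -
  have "a * b \<approx> \<kappa> (\<kappa>' a) * \<kappa> (\<kappa>' b)"
    by (rule equiv_mod_trans[OF equiv_mod_left equiv_mod_right]) (rule equiv_mod_sym[OF \<kappa>_\<kappa>'])+
  also have "\<dots> \<approx> \<kappa> (\<kappa>' a * \<kappa>' b)"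
    by (rule equiv_mod_sym[OF \<kappa>_mult])
  finally show ?thesis
    by (rule equiv_mod_trans[OF linear_mod_cong[OF linear(2)] \<kappa>'_\<kappa>])
qed

lemma equiv_mod_mult: "a \<approx> a' \<Longrightarrow> b \<approx> b' \<Longrightarrow> a * b \<approx> a' * b'"
  using equiv_mod_trans[OF equiv_mod_left equiv_mod_right] .

text \<open>On a pair of words the coproduct of a generator unfolds to its Leibniz rule at the
  images of \<open>a\<close> and \<open>b\<close>.\<close>

lemma tensor_action_gen: "tensor_action a b (uq_comult_gen g * s) \<approx> gen_action g (tensor_action a b s)"
proof (induction s rule: poly_mapping_add_induct)
  case zero
  show ?case
    using linear_mod_0[OF linear_mod_gen_action] by (simp add: equiv_mod_sym)
next
  case (add x y)
  show ?case
    using equiv_mod_trans[OF equiv_mod_add[OF add]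
        equiv_mod_sym[OF linear_mod_add[OF linear_mod_gen_action]]]
    by (simp add: distrib_left tensor_action_add)
next
  case (single p c)
  obtain u v where p: "p = (u, v)" by (cases p)
  define A B where "A = act (Poly_Mapping.single u 1) a" and "B = act (Poly_Mapping.single v 1) b"
  have single: "act (Poly_Mapping.single (h # w) 1) x \<approx> gen_action h (act (Poly_Mapping.single w 1) x)"
    for h w x
    unfolding single_Cons by (rule act_gen_mult)
  note sK = single[of K_gen, unfolded gen_action.simps]
    and sK_inv = single[of Kinv_gen, unfolded gen_action.simps]
    and sE = single[of E_gen, unfolded gen_action.simps]
    and sF = single[of F_gen, unfolded gen_action.simps]
  have "tensor_action a b (uq_comult_gen g * Poly_Mapping.single (u, v) 1) \<approx> gen_action g (A * B)"
  proof (cases g)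
    case K_gen
    show ?thesis
      using equiv_mod_trans[OF equiv_mod_mult[OF sK[of u a] sK[of v b]]
          equiv_mod_sym[OF \<kappa>_mult]]
      by (simp add: K_gen word_tensor_def mult_single plus_list_def tensor_action_single A_def B_def)
  next
    case Kinv_gen
    show ?thesis
      using equiv_mod_trans[OF equiv_mod_mult[OF sK_inv[of u a] sK_inv[of v b]]
          equiv_mod_sym[OF \<kappa>'_mult]]
      by (simp add: Kinv_gen word_tensor_def mult_single plus_list_def tensor_action_single A_def B_def)
  next
    case E_gen
    show ?thesis
      using equiv_mod_trans[OF equiv_mod_add[OF equiv_mod_left[OF sE[of v b]]
            equiv_mod_mult[OF sE[of u a] sK[of v b]]] equiv_mod_sym[OF e_mult]]
      by (simp add: E_gen word_tensor_def mult_single plus_list_def tensor_action_single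
          tensor_action_add distrib_right A_def B_def)
  next
    case F_gen
    show ?thesis
      using equiv_mod_trans[OF equiv_mod_add[OF equiv_mod_right[OF sF[of u a]]
            equiv_mod_mult[OF sK_inv[of u a] sF[of v b]]] equiv_mod_sym[OF f_mult]]
      by (simp add: F_gen word_tensor_def mult_single plus_list_def tensor_action_single
          tensor_action_add distrib_right A_def B_def)
  qed
  from equiv_mod_trans[OF equiv_mod_left[OF this, of "sc c"]
      equiv_mod_sym[OF linear_mod_scale[OF linear_mod_gen_action]]]
  have "tensor_action a b (sc c * (uq_comult_gen g * Poly_Mapping.single (u, v) 1)) \<approx>
      gen_action g (tensor_action a b (sc c * Poly_Mapping.single (u, v) 1))"
    by (simp add: tensor_action_scale tensor_action_single A_def B_def)
  moreover have "sc c * (uq_comult_gen g * Poly_Mapping.single (u, v) 1) =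
      uq_comult_gen g * Poly_Mapping.single (u, v) c"
    by (subst (2) single_eq_sc) (simp add: sc_left_commute)
  ultimately show ?case
    unfolding p by (simp add: single_eq_sc[of "(u, v)" c])
qed

lemma act_comult: "act x (a * b) \<approx> tensor_action a b (free_extension sc uq_comult_gen x)"
proof (induction x rule: poly_mapping_add_induct)
  case zero
  show ?case by (simp add: free_extension_def)
next
  case (add x y)
  show ?case
    using equiv_mod_add[OF add]
    by (simp add: act_add free_extension_eq sc_extension.extension_add tensor_action_add)
next
  case (single w c)
  have "foldr gen_action w (a * b) \<approx> tensor_action a b (prod_list (map uq_comult_gen w))"
  proof (induction w)
    case Nil
    have "tensor_action a b 1 = a * b"
      using tensor_action_single[of a b "[]" "[]" 1] single_one[where 'a="uq_gen list \<times> uq_gen list" and 'b=complex]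
      by (simp add: single_Nil zero_prod_def zero_list_def)
    then show ?case by simp
  next
    case (Cons g w)
    show ?case
      using equiv_mod_trans[OF linear_mod_cong[OF linear_mod_gen_action Cons]
          equiv_mod_sym[OF tensor_action_gen]]
      by simp
  qed
  from equiv_mod_left[OF this, of "sc c"] show ?case
    by (simp add: act_single free_extension_eq tensor_action_scale)
qed

end


definition class_rep :: "'g free set \<Rightarrow> 'g free set \<Rightarrow> 'g free" where
  "class_rep R A = (SOME x. rel_class R x = A)"

lemma class_rep [simp]: "rel_class R (class_rep R (rel_class R x)) = rel_class R x"
  unfolding class_rep_def by (rule someI) (rule refl)

lemma keys_project_tensor:
  "Poly_Mapping.keys (project_tensor R s) \<subseteq> range (rel_class R) \<times> range (rel_class R)"
proof (induction s rule: poly_mapping_add_induct)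
  case (add s s')
  then show ?case
    using Poly_Mapping.keys_add[of "project_tensor R s" "project_tensor R s'"]
    by (auto simp: project_tensor_eq project_extension.extension_add)
qed (simp_all add: project_tensor_eq)

text \<open>With the previous inclusion, every formal sum representing a coproduct is supported on
  pairs of classes, as \<open>comult_sum\<close> demands.\<close>

lemma keys_bilinear_relations:
  assumes "t \<in> bilinear_relations (presented_alg R) (presented_alg R)"
  shows "Poly_Mapping.keys t \<subseteq> range (rel_class R) \<times> range (rel_class R)"
proof -
  have "p \<in> range (rel_class R) \<times> range (rel_class R)" if "Poly_Mapping.lookup t p \<noteq> 0" for p
    using assms that
  proof (induction t arbitrary: p)
    case (add s t)
    then have "Poly_Mapping.lookup s p \<noteq> 0 \<or> Poly_Mapping.lookup t p \<noteq> 0"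
      by (auto simp: lookup_add)
    then show ?case using add by blast
  qed (auto simp: lookup_minus lookup_single carrier_presented when_def split: if_splits)
  then show ?thesis by (auto simp: in_keys_iff)
qed

lemma free_extension_gen: "free_extension sc g (gen h) = g h"
  unfolding free_extension_eq gen_def sc_extension.extension_single by simp

section \<open>Passage to the quotient algebras\<close>

context uq_action
begin

text \<open>Chosen representatives carry the action over to classes. The restriction to the carrier
  is due to \<open>linear_maps\<close>, whose members are extensional.\<close>

definition symmetry :: "uq_gen free set \<Rightarrow> disc_gen free set \<Rightarrow> disc_gen free set" where
  "symmetry S = (\<lambda>A\<in>carrier (disc q).
     disc_class q (act (class_rep (uq_rels q) S) (class_rep (disc_rels q) A)))"

lemma act_rep: "act (class_rep (uq_rels q) (uq_class q x)) a \<approx> act x a"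
  by (rule act_cong) simp

lemma symmetry_class: "symmetry (uq_class q x) (disc_class q a) = disc_class q (act x a)"
proof -
  have "class_rep (disc_rels q) (disc_class q a) \<approx> a"
    by (simp add: equiv_mod_iff_class)
  then have "act (class_rep (uq_rels q) (uq_class q x)) (class_rep (disc_rels q) (disc_class q a)) \<approx> act x a"
    using equiv_mod_trans[OF act_rep linear_mod_cong[OF linear_mod_act]] by blast
  then show ?thesis
    by (simp add: symmetry_def disc_def equiv_mod_iff_class)
qed

lemma symmetry_extensional: "A \<notin> carrier (disc q) \<Longrightarrow> symmetry S A = undefined"
  by (simp add: symmetry_def)

lemma symmetry_alg_hom: "symmetry \<in> alg_hom (presented_alg (uq_rels q)) (End_alg (disc q))"
proof -
  have class_add: "disc_class q (act x (a + b)) = disc_class q (act x a + act x b)"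
    and class_scale: "disc_class q (act x (sc c * a)) = disc_class q (sc c * act x a)"
    and class_mult: "disc_class q (act (x * x') a) = disc_class q (act x (act x' a))" for x x' a b c
    using linear_mod_add[OF linear_mod_act] linear_mod_scale[OF linear_mod_act] act_mult
    by (simp_all add: equiv_mod_iff_class)
  have mem: "symmetry S \<in> linear_maps (disc q)" if "S \<in> range (uq_class q)" for S
    using that
    by (auto simp: linear_maps_def disc_def carrier_presented symmetry_class class_add class_scale
        PiE_iff extensional_def symmetry_extensional[unfolded disc_def carrier_presented])
  have eqI: "symmetry S = F"
    if "F \<in> extensional (carrier (disc q))" "\<And>a. symmetry S (disc_class q a) = F (disc_class q a)"
    for F S
  proof (rule ext)
    fix A
    show "symmetry S A = F A"
    proof (cases "A \<in> carrier (disc q)")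
      case True
      then obtain a where A: "A = disc_class q a"
        by (auto simp: disc_def carrier_presented)
      show ?thesis unfolding A by (rule that(2))
    next
      case False
      show ?thesis
        unfolding symmetry_extensional[OF False] by (rule extensional_arb[OF that(1) False, symmetric])
    qed
  qed
  have cl: "disc_class q a \<in> carrier (disc q)" for a
    by (simp add: disc_def)
  have m: "symmetry (uq_class q x \<otimes>\<^bsub>presented_alg (uq_rels q)\<^esub> uq_class q x') =
      compose (carrier (disc q)) (symmetry (uq_class q x)) (symmetry (uq_class q x'))" for x x'
    by (rule eqI) (simp_all add: compose_extensional compose_eq cl symmetry_class class_mult)
  have a: "symmetry (uq_class q x \<oplus>\<^bsub>presented_alg (uq_rels q)\<^esub> uq_class q x') =
      (\<lambda>A\<in>carrier (disc q). symmetry (uq_class q x) A \<oplus>\<^bsub>disc q\<^esub> symmetry (uq_class q x') A)" for x x'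
    by (rule eqI) (simp_all add: cl symmetry_class act_add, simp add: disc_def)
  have s: "symmetry (c \<odot>\<^bsub>presented_alg (uq_rels q)\<^esub> uq_class q x) =
      (\<lambda>A\<in>carrier (disc q). c \<odot>\<^bsub>disc q\<^esub> symmetry (uq_class q x) A)" for x c
    by (rule eqI) (simp_all add: cl symmetry_class act_scale, simp add: disc_def)
  have o: "symmetry (uq_class q 1) = (\<lambda>A\<in>carrier (disc q). A)"
    by (rule eqI) (simp_all add: cl symmetry_class)
  show ?thesis
    unfolding alg_hom_def ring_hom_def End_alg_def carrier_presented presented_one
    by (auto simp: mem m a s o simp del: presented_simps presented_smult)
qed

lemma acts_through_symmetry: "acts_through symmetry (\<lambda>S. act (class_rep (uq_rels q) S))"
  unfolding acts_through_def symmetry_class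
  using act_rep equiv_mod_sym by (simp add: equiv_mod_iff_class)

definition rep_action :: "disc_gen free \<Rightarrow> disc_gen free \<Rightarrow>
    (uq_gen free set \<times> uq_gen free set \<Rightarrow>\<^sub>0 complex) \<Rightarrow> disc_gen free" where
  "rep_action a b t = linear_extension (\<lambda>p c. sc c *
    (act (class_rep (uq_rels q) (fst p)) a * act (class_rep (uq_rels q) (snd p)) b)) t"

lemma rep_action_add: "rep_action a b (t + t') = rep_action a b t + rep_action a b t'"
  and rep_action_diff: "rep_action a b (t - t') = rep_action a b t - rep_action a b t'"
  and rep_action_0: "rep_action a b 0 = 0"
  and rep_action_single: "rep_action a b (Poly_Mapping.single (S, T) c) =
    sc c * (act (class_rep (uq_rels q) S) a * act (class_rep (uq_rels q) T) b)"
  by (simp_all add: rep_action_def sc_extension.extension_add sc_extension.extension_diff)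

lemma rep_action_class:
  "rep_action a b (Poly_Mapping.single (uq_class q x, uq_class q x') c) \<approx> sc c * (act x a * act x' b)"
  unfolding rep_action_single by (intro equiv_mod_left equiv_mod_mult act_rep)

text \<open>Multiplication is bilinear and \<open>act\<close> is linear in its first argument. Hence
  the value does not depend on the formal sum that represents a coproduct.\<close>

lemma rep_action_bilinear:
  assumes "t \<in> bilinear_relations (presented_alg (uq_rels q)) (presented_alg (uq_rels q))"
  shows "rep_action a b t \<approx> 0"
proof -
  have s: "symbol (rep_action a b (Poly_Mapping.single (uq_class q x, uq_class q x') c)) =
      symbol (sc c * (act x a * act x' b))" for x x' c
    by (rule equiv_mod_symbol[OF rep_action_class])
  have "symbol (rep_action a b t) k u = 0" for k u
    using assms
  proof induction
    case (add s t)
    then show ?case by (simp add: rep_action_add)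
  qed (auto simp: carrier_presented rep_action_0 rep_action_add rep_action_diff s act_add act_scale algebra_simps
      sc_left_commute[of "act x a" for x])
  then show ?thesis by (simp add: equiv_mod_symbol_iff fun_eq_iff)
qed

lemma rep_action_project: "rep_action a b (project_tensor (uq_rels q) s) \<approx> tensor_action a b s"
proof (induction s rule: poly_mapping_add_induct)
  case zero
  show ?case by (simp add: project_tensor_eq rep_action_0)
next
  case (add s s')
  then show ?case
    by (simp add: project_tensor_eq project_extension.extension_add rep_action_add tensor_action_add
        equiv_mod_add)
next
  case (single p c)
  obtain u v where p: "p = (u, v)" by (cases p)
  show ?case
    unfolding p project_tensor_eq project_extension.extension_single fst_conv snd_conv
      tensor_action_single
    by (rule rep_action_class)
qed

text \<open>Independence of the representative is read off the action on 1: congruent elements act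
  alike there, and a scalar is recovered from its symbol in degree 0.\<close>

lemma counit_symmetry: "counit (uq q) (uq_class q x) = free_extension id uq_counit_gen x"
proof -
  have "free_extension id uq_counit_gen x' = free_extension id uq_counit_gen x"
    if "x' \<in> uq_class q x" for x'
  proof -
    have "uq_class q x' = uq_class q x"
      using that by (simp add: mem_rel_class_iff)
    then have "sc (free_extension id uq_counit_gen x') \<approx> sc (free_extension id uq_counit_gen x)"
      by (intro equiv_mod_trans[OF equiv_mod_sym[OF act_unit] equiv_mod_trans[OF act_cong act_unit]])
    from fun_cong[OF fun_cong[OF equiv_mod_symbol[OF this], of 0], of 0] show ?thesis by simp
  qed
  then have "free_extension id uq_counit_gen ` uq_class q x = {free_extension id uq_counit_gen x}"
    using mem_rel_class_iff[of x "uq_rels q" x] by blast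
  then show ?thesis by (simp add: uq_simps)
qed

lemma disc_symmetry_symmetry: "disc_symmetry q symmetry"
  unfolding disc_symmetry_def hopf_symmetry_def
proof (intro conjI ballI)
  show "symmetry \<in> alg_hom (module.truncate (uq q)) (End_alg (disc q))"
    unfolding uq_truncate by (rule symmetry_alg_hom)
next
  fix S t A B
  assume S: "S \<in> carrier (uq q)" and t: "t \<in> comult (uq q) S"
    and "A \<in> carrier (disc q)" "B \<in> carrier (disc q)"
  then obtain a b where ab: "A = disc_class q a" "B = disc_class q b"
    by (auto simp: disc_def carrier_presented)
  obtain x0 where x0: "S = uq_class q x0"
    using S by (auto simp: uq_simps carrier_presented)
  \<comment> \<open>A member of the coproduct of \<open>S\<close> comes from some representative of
    \<open>S\<close> and a bilinear relation.\<close>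
  obtain x m where x: "x \<in> S"
    and m: "m \<in> bilinear_relations (presented_alg (uq_rels q)) (presented_alg (uq_rels q))"
    and t_eq: "t = project_tensor (uq_rels q) (free_extension sc uq_comult_gen x) + m"
    using t by (auto simp: uq_simps tensor_class_def)
  have S: "S = uq_class q x"
    using x unfolding x0 mem_rel_class_iff by (rule sym)
  have keys: "Poly_Mapping.keys t \<subseteq> range (uq_class q) \<times> range (uq_class q)"
    unfolding t_eq
    by (rule order.trans[OF Poly_Mapping.keys_add
          Un_least[OF keys_project_tensor keys_bilinear_relations[OF m]]])
  have "rep_action a b t \<approx> tensor_action a b (free_extension sc uq_comult_gen x) + 0"
    unfolding t_eq rep_action_add
    by (intro equiv_mod_add rep_action_project rep_action_bilinear m)
  then have "act x (a * b) \<approx> rep_action a b t"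
    by (simp add: equiv_mod_trans[OF act_comult equiv_mod_sym])
  then have "symmetry S (disc_class q (a * b)) = disc_class q (rep_action a b t)"
    unfolding S symmetry_class equiv_mod_iff_class .
  with comult_sum[OF acts_through_symmetry keys, of a b]
  show "symmetry S (A \<otimes>\<^bsub>disc q\<^esub> B) = (\<Oplus>\<^bsub>disc q\<^esub>p\<in>Poly_Mapping.keys t.
      Poly_Mapping.lookup t p \<odot>\<^bsub>disc q\<^esub> (symmetry (fst p) A \<otimes>\<^bsub>disc q\<^esub> symmetry (snd p) B))"
    by (simp add: ab disc_def rep_action_def)
next
  fix S assume "S \<in> carrier (uq q)"
  then obtain x where S: "S = uq_class q x"
    by (auto simp: uq_simps carrier_presented)
  show "symmetry S \<one>\<^bsub>disc q\<^esub> = counit (uq q) S \<odot>\<^bsub>disc q\<^esub> \<one>\<^bsub>disc q\<^esub>"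
    using act_unit[of x]
    by (simp add: S disc_def presented_one symmetry_class[unfolded disc_def] symmetry_class
        counit_symmetry equiv_mod_iff_class)
qed

lemma symmetry_gen: "symmetry (uq_class q (gen g)) (disc_class q a) = disc_class q (gen_action g a)"
  using act_gen[of g a] by (simp add: symmetry_class equiv_mod_iff_class)

end


section \<open>Restricting a Hopf symmetry to the generators\<close>

context quantum_disc
begin

lemma disc_symmetry_action:
  assumes "disc_symmetry q \<pi>"
  obtains \<kappa> \<kappa>' e f where "uq_action q \<kappa> \<kappa>' e f"
    and "\<And>a. \<pi> (uq_class q (gen K_gen)) (disc_class q a) = disc_class q (\<kappa> a)"
    and "\<And>a. \<pi> (uq_class q (gen E_gen)) (disc_class q a) = disc_class q (e a)"
    and "\<And>a. \<pi> (uq_class q (gen F_gen)) (disc_class q a) = disc_class q (f a)"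
proof -
  let ?U = "presented_alg (uq_rels q)"
  have hom: "\<pi> \<in> alg_hom ?U (End_alg (disc q))"
    using assms by (simp add: disc_symmetry_def hopf_symmetry_def uq_truncate)
  have lin: "\<pi> (uq_class q x) \<in> linear_maps (disc q)" for x
    using hom by (auto simp: alg_hom_def ring_hom_def End_alg_def)
  have cl: "disc_class q a \<in> carrier (disc q)" for a
    by (simp add: disc_def)
  have mult: "\<pi> (uq_class q (x * x')) A = \<pi> (uq_class q x) (\<pi> (uq_class q x') A)"
    and add: "\<pi> (uq_class q (x + x')) A = \<pi> (uq_class q x) A \<oplus>\<^bsub>disc q\<^esub> \<pi> (uq_class q x') A"
    and scale: "\<pi> (uq_class q (sc c * x)) A = c \<odot>\<^bsub>disc q\<^esub> \<pi> (uq_class q x) A"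
    and one: "\<pi> (uq_class q 1) A = A"
    if A: "A \<in> carrier (disc q)" for x x' c A
  proof -
    have u: "uq_class q x \<in> carrier ?U" for x by simp
    have "\<pi> (uq_class q x \<otimes>\<^bsub>?U\<^esub> uq_class q x') =
        compose (carrier (disc q)) (\<pi> (uq_class q x)) (\<pi> (uq_class q x'))"
      using hom u by (simp add: alg_hom_def ring_hom_def End_alg_def del: presented_simps)
    then show "\<pi> (uq_class q (x * x')) A = \<pi> (uq_class q x) (\<pi> (uq_class q x') A)"
      using A by (simp add: compose_eq)
    have "\<pi> (uq_class q x \<oplus>\<^bsub>?U\<^esub> uq_class q x') =
        (\<lambda>A\<in>carrier (disc q). \<pi> (uq_class q x) A \<oplus>\<^bsub>disc q\<^esub> \<pi> (uq_class q x') A)"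
      using hom u by (simp add: alg_hom_def ring_hom_def End_alg_def del: presented_simps)
    then show "\<pi> (uq_class q (x + x')) A = \<pi> (uq_class q x) A \<oplus>\<^bsub>disc q\<^esub> \<pi> (uq_class q x') A"
      using A by simp
    have "\<pi> (c \<odot>\<^bsub>?U\<^esub> uq_class q x) = (\<lambda>A\<in>carrier (disc q). c \<odot>\<^bsub>disc q\<^esub> \<pi> (uq_class q x) A)"
      using hom u by (simp add: alg_hom_def End_alg_def del: presented_smult)
    then show "\<pi> (uq_class q (sc c * x)) A = c \<odot>\<^bsub>disc q\<^esub> \<pi> (uq_class q x) A"
      using A by simp
    have "\<pi> \<one>\<^bsub>?U\<^esub> = (\<lambda>A\<in>carrier (disc q). A)"
      using hom by (simp add: alg_hom_def ring_hom_def End_alg_def)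
    then show "\<pi> (uq_class q 1) A = A"
      using A by (simp add: presented_one)
  qed
  \<comment> \<open>\<open>P\<close> picks representatives of the images. It depends only on the
    class in the quantum group, so relations there become equalities of operators.\<close>
  define P where "P S a = (SOME b. disc_class q b = \<pi> S (disc_class q a))" for S a
  have P: "disc_class q (P (uq_class q x) a) = \<pi> (uq_class q x) (disc_class q a)" for x a
  proof -
    have "\<pi> (uq_class q x) \<in> carrier (disc q) \<rightarrow> carrier (disc q)"
      using lin[of x] by (simp add: linear_maps_def PiE_def)
    then have "\<pi> (uq_class q x) (disc_class q a) \<in> carrier (disc q)"
      using cl by (rule funcset_mem)
    then obtain b where b: "\<pi> (uq_class q x) (disc_class q a) = disc_class q b"
      unfolding disc_def carrier_presented by (rule rangeE)
    show ?thesis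
      unfolding P_def
      by (rule someI[of "\<lambda>c. disc_class q c = \<pi> (uq_class q x) (disc_class q a)", OF b[symmetric]])
  qed
  have through: "acts_through \<pi> P"
    by (simp add: acts_through_def P)
  define op where "op x a = P (uq_class q x) a" for x a
  have op: "\<pi> (uq_class q x) (disc_class q a) = disc_class q (op x a)" for x a
    by (simp add: op_def P)
  have linear_op: "linear_mod (op x)" for x
    unfolding linear_mod_def
  proof (intro conjI allI impI)
    fix a b c
    show "a \<approx> b \<Longrightarrow> op x a \<approx> op x b"
      by (simp add: equiv_mod_iff_class flip: op)
    show "op x (a + b) \<approx> op x a + op x b"
    proof -
      have "\<pi> (uq_class q x) (disc_class q a \<oplus>\<^bsub>disc q\<^esub> disc_class q b) =
          \<pi> (uq_class q x) (disc_class q a) \<oplus>\<^bsub>disc q\<^esub> \<pi> (uq_class q x) (disc_class q b)"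
        using lin[of x] cl unfolding linear_maps_def by blast
      then show ?thesis
        unfolding equiv_mod_iff_class op by (simp add: disc_def op[unfolded disc_def])
    qed
    show "op x (sc c * a) \<approx> sc c * op x a"
    proof -
      have "\<pi> (uq_class q x) (c \<odot>\<^bsub>disc q\<^esub> disc_class q a) = c \<odot>\<^bsub>disc q\<^esub> \<pi> (uq_class q x) (disc_class q a)"
        using lin[of x] cl unfolding linear_maps_def by blast
      then show ?thesis
        unfolding equiv_mod_iff_class op by (simp add: disc_def op[unfolded disc_def])
    qed
  qed
  have op_mult: "op (x * x') a \<approx> op x (op x' a)" for x x' a
    using mult[OF cl, of x x' a] unfolding op equiv_mod_iff_class .
  have op_add: "op (x + x') a \<approx> op x a + op x' a" for x x' a
    using add[OF cl, of x x' a] unfolding op equiv_mod_iff_class by (simp add: disc_def)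
  have op_scale: "op (sc c * x) a \<approx> sc c * op x a" for c x a
    using scale[OF cl, of c x a] unfolding op equiv_mod_iff_class by (simp add: disc_def)
  have op_one: "op 1 a \<approx> a" for a
    using one[OF cl, of a] unfolding op equiv_mod_iff_class .
  have op_rel: "op x a \<approx> op x' a" if "x - x' \<in> uq_rels q" for x x' a
  proof -
    have "uq_class q x = uq_class q x'"
      unfolding rel_class_eq_iff by (rule rel_ideal_memI[OF that])
    then show ?thesis by (simp add: op_def)
  qed
  \<comment> \<open>The coproduct axiom is used for the representative given by
    \<open>uq_comult_gen\<close>, with zero as the bilinear relation.\<close>
  have comult: "op (gen g) (a * b) \<approx> linear_extension (\<lambda>p c. sc c * (P (fst p) a * P (snd p) b))
      (project_tensor (uq_rels q) (uq_comult_gen g))" for g a b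
  proof -
    let ?t = "project_tensor (uq_rels q) (uq_comult_gen g)"
    have "?t \<in> comult (uq q) (uq_class q (gen g))"
      unfolding uq_simps tensor_class_def
    proof (rule UN_I)
      show "gen g \<in> uq_class q (gen g)" by (simp add: mem_rel_class_iff)
      show "?t \<in> {project_tensor (uq_rels q) (free_extension sc uq_comult_gen (gen g)) + m |m.
          m \<in> bilinear_relations ?U ?U}"
        using bilinear_relations.zero by (force simp: free_extension_gen)
    qed
    moreover have "uq_class q (gen g) \<in> carrier (uq q)"
      by (simp add: uq_simps)
    ultimately have "\<pi> (uq_class q (gen g)) (disc_class q a \<otimes>\<^bsub>disc q\<^esub> disc_class q b) =
        (\<Oplus>\<^bsub>disc q\<^esub>p\<in>Poly_Mapping.keys ?t. Poly_Mapping.lookup ?t p \<odot>\<^bsub>disc q\<^esub>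
          (\<pi> (fst p) (disc_class q a) \<otimes>\<^bsub>disc q\<^esub> \<pi> (snd p) (disc_class q b)))"
      using assms cl[of a] cl[of b] unfolding disc_symmetry_def hopf_symmetry_def by blast
    also note comult_sum[OF through keys_project_tensor]
    finally show ?thesis
      unfolding equiv_mod_iff_class by (simp add: disc_def op[unfolded disc_def])
  qed
  define \<kappa> \<kappa>' e f where "\<kappa> = op (gen K_gen)" and "\<kappa>' = op (gen Kinv_gen)"
    and "e = op (gen E_gen)" and "f = op (gen F_gen)"
  have word: "P (uq_class q (Poly_Mapping.single [g] 1)) a = op (gen g) a"
    "P (uq_class q (Poly_Mapping.single [] 1)) a = op 1 a" for g a
    by (simp_all add: op_def gen_def single_Nil)
  note tensor = project_tensor_eq word_tensor_def project_extension.extension_add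
    sc_extension.extension_add word
  have action: "uq_action q \<kappa> \<kappa>' e f"
  proof
    show "linear_mod \<kappa>" "linear_mod \<kappa>'" "linear_mod e" "linear_mod f"
      unfolding \<kappa>_def \<kappa>'_def e_def f_def by (rule linear_op)+
    fix a b
    have m: "op (x * x') a \<approx> c \<Longrightarrow> op x (op x' a) \<approx> c" for x x' c
      using equiv_mod_trans[OF equiv_mod_sym[OF op_mult]] .
    show "\<kappa> (\<kappa>' a) \<approx> a"
      unfolding \<kappa>_def \<kappa>'_def
      by (rule m, rule equiv_mod_trans[OF op_rel op_one]) (simp add: uq_rels_def)
    show "\<kappa>' (\<kappa> a) \<approx> a"
      unfolding \<kappa>_def \<kappa>'_def
      by (rule m, rule equiv_mod_trans[OF op_rel op_one]) (simp add: uq_rels_def)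
    have commute: "op x (op x' a) \<approx> sc c * op x' (op x a)"
      if "x * x' - sc c * x' * x \<in> uq_rels q" for x x' c
    proof (rule m)
      have "op (x * x') a \<approx> op (sc c * (x' * x)) a"
        using op_rel[OF that] by (simp add: mult.assoc)
      also have "\<dots> \<approx> sc c * op (x' * x) a" by (rule op_scale)
      also have "\<dots> \<approx> sc c * op x' (op x a)" by (rule equiv_mod_left[OF op_mult])
      finally show "op (x * x') a \<approx> sc c * op x' (op x a)" .
    qed
    show "\<kappa> (e a) \<approx> sc (q\<^sup>2) * e (\<kappa> a)" "\<kappa> (f a) \<approx> sc (inverse (q\<^sup>2)) * f (\<kappa> a)"
      unfolding \<kappa>_def e_def f_def by (rule commute; simp add: uq_rels_def)+
    have op_diff: "symbol (op (x - x') a) k t = symbol (op x a) k t - symbol (op x' a) k t" for x x' k t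
    proof -
      have "op (x - x') a \<approx> op x a + op (sc (- 1) * x') a"
        using op_add[of x "sc (- 1) * x'" a] by (simp add: sc_uminus)
      also have "\<dots> \<approx> op x a + sc (- 1) * op x' a"
        by (rule equiv_mod_add[OF equiv_mod_refl op_scale])
      finally show ?thesis by (simp add: equiv_mod_symbol_iff)
    qed
    have "op (gen E_gen * gen F_gen - gen F_gen * gen E_gen) a \<approx>
        op (sc (1 / (q - inverse q)) * (gen K_gen - gen Kinv_gen)) a"
      by (rule op_rel) (simp add: uq_rels_def)
    also have "\<dots> \<approx> sc (1 / (q - inverse q)) * op (gen K_gen - gen Kinv_gen) a"
      by (rule op_scale)
    finally show "e (f a) - f (e a) \<approx> sc (1 / (q - inverse q)) * (\<kappa> a - \<kappa>' a)"
      using equiv_mod_symbol[OF op_mult, of "gen E_gen" "gen F_gen" a]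
        equiv_mod_symbol[OF op_mult, of "gen F_gen" "gen E_gen" a]
      by (simp add: equiv_mod_symbol_iff fun_eq_iff op_diff e_def f_def \<kappa>_def \<kappa>'_def)
    show "\<kappa> (a * b) \<approx> \<kappa> a * \<kappa> b"
      using comult[of K_gen a b] by (simp add: tensor \<kappa>_def)
    \<comment> \<open>The empty word in the coproduct acts as \<open>op 1\<close>, which is the
      identity only modulo the relations.\<close>
    have "a * e b + e a * \<kappa> b \<approx> op 1 a * e b + e a * \<kappa> b"
      by (intro equiv_mod_add equiv_mod_right equiv_mod_sym[OF op_one] equiv_mod_refl)
    then show "e (a * b) \<approx> a * e b + e a * \<kappa> b"
      using equiv_mod_trans[OF comult[of E_gen a b] equiv_mod_sym]
      by (simp add: tensor \<kappa>_def e_def)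
    have "f a * b + \<kappa>' a * f b \<approx> f a * op 1 b + \<kappa>' a * f b"
      by (intro equiv_mod_add equiv_mod_left equiv_mod_sym[OF op_one] equiv_mod_refl)
    then show "f (a * b) \<approx> f a * b + \<kappa>' a * f b"
      using equiv_mod_trans[OF comult[of F_gen a b] equiv_mod_sym]
      by (simp add: tensor \<kappa>'_def f_def)
  qed
  show ?thesis
    by (rule that[OF action]) (simp_all add: \<kappa>_def e_def f_def op)
qed

text \<open>For \<open>n \<noteq> 0\<close> the branch of vanishing \<open>e\<close> and
  \<open>f\<close> is excluded; the other one is transported through the identification of
  components with homogeneous representatives.\<close>

lemma grading_jump_iff:
  assumes e: "\<And>a. \<pi> (uq_class q (gen E_gen)) (disc_class q a) = disc_class q (e a)"
    and f: "\<And>a. \<pi> (uq_class q (gen F_gen)) (disc_class q a) = disc_class q (f a)"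
    and "n \<noteq> 0"
  shows "grading_jump q \<pi> n \<longleftrightarrow> \<not> (\<forall>a. e a \<approx> 0 \<and> f a \<approx> 0) \<and>
    (\<forall>k a. homog k a \<longrightarrow> homog (k + n) (e a) \<and> homog (k - n) (f a))"
proof -
  have zero: "(\<forall>A\<in>carrier (disc q). \<pi> (uq_class q (gen E_gen)) A = \<zero>\<^bsub>disc q\<^esub> \<and>
      \<pi> (uq_class q (gen F_gen)) A = \<zero>\<^bsub>disc q\<^esub>) \<longleftrightarrow> (\<forall>a. e a \<approx> 0 \<and> f a \<approx> 0)"
    by (auto simp: disc_def carrier_presented presented_zero e f equiv_mod_iff_class)
  have component: "disc_component q k = disc_class q ` {a. homog k a}" for k
  proof -
    have "A \<in> range (disc_class q)" if "A \<in> disc_component q k" for A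
      using that unfolding disc_component_def by blast
    then show ?thesis
      using disc_component_iff by blast
  qed
  have image: "\<pi> (uq_class q x) ` disc_component q k \<subseteq> disc_component q l \<longleftrightarrow>
      (\<forall>a. homog k a \<longrightarrow> homog l (g a))"
    if "\<And>a. \<pi> (uq_class q x) (disc_class q a) = disc_class q (g a)" for x g k l
    unfolding component[of k] by (simp add: image_subset_iff that disc_component_iff)
  show ?thesis
    unfolding grading_jump_def Let_def zero
    using image[OF e] image[OF f] \<open>n \<noteq> 0\<close> by auto
qed

lemma no_large_jump:
  assumes "disc_symmetry q \<pi>" "grading_jump q \<pi> n"
  shows "n \<le> 1"
proof (rule ccontr)
  assume n: "\<not> n \<le> 1"
  obtain \<kappa> \<kappa>' e f where action: "uq_action q \<kappa> \<kappa>' e f"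
    and e: "\<And>a. \<pi> (uq_class q (gen E_gen)) (disc_class q a) = disc_class q (e a)"
    and f: "\<And>a. \<pi> (uq_class q (gen F_gen)) (disc_class q a) = disc_class q (f a)"
    using disc_symmetry_action[OF assms(1)] by metis
  have "grading_jump q \<pi> n \<longleftrightarrow> \<not> (\<forall>a. e a \<approx> 0 \<and> f a \<approx> 0) \<and>
      (\<forall>k a. homog k a \<longrightarrow> homog (k + n) (e a) \<and> homog (k - n) (f a))"
    by (rule grading_jump_iff) (use e f n in auto)
  with assms(2) n have "jump_symmetry q \<kappa> \<kappa>' e f n"
    by (intro jump_symmetry.intro action jump_symmetry_axioms.intro) auto
  then show False by (rule jump_symmetry.contradiction)
qed

end


section \<open>Inner skew derivations and the symmetries of jump 1\<close>

context quantum_disc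
begin

text \<open>For jump 1 the weight of \<open>z\<close> is q^2, so \<open>dilate (- 1)\<close> is the
  action of k and \<open>dilate 1\<close> that of its inverse. Multiplicativity holds exactly on the
  free algebra, not just modulo the relations.\<close>

definition dilate :: "int \<Rightarrow> disc_gen free \<Rightarrow> disc_gen free" where
  "dilate d a = linear_extension (\<lambda>w c. Poly_Mapping.single w (\<theta> (d * weight w) * c)) a"

sublocale dilation: termwise_additive "\<lambda>w c. Poly_Mapping.single w (\<theta> (d * weight w) * c)" for d
  by unfold_locales (simp add: distrib_left single_add)

lemma dilate_add: "dilate d (a + b) = dilate d a + dilate d b"
  and dilate_diff: "dilate d (a - b) = dilate d a - dilate d b"
  and dilate_0 [simp]: "dilate d 0 = 0"
  and dilate_single: "dilate d (Poly_Mapping.single w c) = Poly_Mapping.single w (\<theta> (d * weight w) * c)"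
  by (simp_all add: dilate_def dilation.extension_add dilation.extension_diff)

lemma weight_append: "weight (u @ v) = weight u + weight v"
  by (induction u rule: weight.induct) simp_all

lemma dilate_mult: "dilate d (a * b) = dilate d a * dilate d b"
proof (induction a rule: poly_mapping_add_induct)
  case (single u c)
  show ?case
    by (induction b rule: poly_mapping_add_induct)
      (simp_all add: distrib_left dilate_add dilate_single mult_single plus_list_def weight_append
        \<theta>_add mult_ac)
qed (simp_all add: distrib_right dilate_add)

lemma dilate_sc [simp]: "dilate d (sc c) = sc c"
  by (simp add: sc_def dilate_single zero_list_def)

lemma dilate_1 [simp]: "dilate d 1 = 1"
  using dilate_sc[of d 1] by simp

lemma dilate_z [simp]: "dilate d z = sc (\<theta> d) * z"
  and dilate_zs [simp]: "dilate d zs = sc (\<theta> (- d)) * zs"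
  by (simp_all add: gen_def dilate_single sc_mult_single)

lemma dilate_y: "dilate d y = y"
proof -
  have "sc (\<theta> d) * z * (sc (\<theta> (- d)) * zs) = sc (\<theta> d * \<theta> (- d)) * (z * zs)"
    by (simp add: sc_mult mult.assoc sc_left_commute[of z])
  also have "\<theta> d * \<theta> (- d) = 1" by (simp flip: \<theta>_add)
  finally show ?thesis by (simp add: dilate_diff dilate_mult)
qed

lemma dilate_dilate: "dilate d (dilate d' a) = dilate (d + d') a"
  by (induction a rule: poly_mapping_add_induct)
    (simp_all add: dilate_add dilate_single \<theta>_add distrib_right mult.assoc)

lemma dilate_0_left [simp]: "dilate 0 a = a"
  by (induction a rule: poly_mapping_add_induct) (simp_all add: dilate_add dilate_single)

lemma symbol_dilate: "symbol (dilate d a) k t = \<theta> (d * k) * symbol a k t"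
proof (induction a rule: poly_mapping_add_induct)
  case (single w c)
  show ?case
    by (cases "k = weight w") (simp_all add: dilate_single symbol_single symbol_word)
qed (simp_all add: dilate_add distrib_left)

lemma homog_dilate: "homog k a \<Longrightarrow> homog k (dilate d a)"
  by (simp add: homog_def symbol_dilate)

lemma linear_modI:
  assumes "\<And>a b. a \<approx> b \<Longrightarrow> g a \<approx> g b" "\<And>a b. g (a + b) = g a + g b"
    and "\<And>c a. g (sc c * a) = sc c * g a"
  shows "linear_mod g"
  using assms by (simp add: linear_mod_def)

lemma dilate_scale: "dilate d (sc c * a) = sc c * dilate d a"
  by (simp add: dilate_mult)

definition y_linear :: "complex \<Rightarrow> complex \<Rightarrow> disc_gen free" where
  "y_linear c d = sc c + sc d * y"

lemma symbol_y_linear [simp]: "symbol (y_linear c d) k t = (if k = 0 then c + d * t else 0)"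
  by (simp add: y_linear_def)

lemma symbol_y_linear_mult [simp]:
  "symbol (y_linear c d * a) k t = (c + d * \<theta> k * t) * symbol a k t"
  by (simp add: y_linear_def distrib_right mult.assoc)

lemma dilate_y_linear: "dilate d (y_linear c c') = y_linear c c'"
  by (simp only: y_linear_def dilate_add dilate_scale dilate_sc dilate_y)

lemma homog_y_linear: "homog 0 (y_linear c d)"
  by (simp add: homog_def)

end

text \<open>\<open>cross\<close> bounds the degree of the product of the two linear symbols by 1,
  and \<open>norm\<close> fits the constant term of the commutator. The choice \<open>x1 = 0\<close>
  yields the series with \<open>b\<^sub>0\<close>, \<open>b\<^sub>1\<close>, and
  \<open>v1 = 0\<close> that with \<open>a\<^sub>0\<close>, \<open>a\<^sub>1\<close>.\<close>

locale inner_action = quantum_disc +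
  fixes x0 x1 v0 v1 :: complex
  assumes cross: "x1 = 0 \<or> v1 = 0"
    and norm: "(\<theta> 1 - 1) * (x0 * v0) = 1 / (q - inverse q)"
begin

definition "X = z * y_linear x0 x1"
definition "Y = y_linear v0 v1 * zs"
definition "e a = X * dilate (- 1) a - a * X"
definition "f a = Y * a - dilate 1 a * Y"
definition "W = sc (\<theta> 1) * (X * Y) - Y * X"

lemma homog_X: "homog 1 X" and homog_Y: "homog (- 1) Y"
  using homog_mult[OF homog_z homog_y_linear[of x0 x1]] homog_mult[OF homog_y_linear[of v0 v1] homog_zs]
  by (simp_all add: X_def Y_def)

lemma homog_W: "homog 0 W"
  using homog_mult[OF homog_X homog_Y] homog_mult[OF homog_Y homog_X]
  unfolding W_def by (intro homog_diff homog_scale) simp_all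

lemma dilate_X: "dilate d X = sc (\<theta> d) * X" and dilate_Y: "dilate d Y = sc (\<theta> (- d)) * Y"
  by (simp_all add: X_def Y_def dilate_mult dilate_y_linear mult.assoc
      sc_left_commute[of "y_linear v0 v1"])

text \<open>By \<open>cross\<close> both products contain the same linear polynomial, once with
  rescaled variable, times 1 - t or 1 - \<open>\<theta> 1\<close> t. The terms linear in t
  cancel.\<close>

lemma symbol_W:
  "symbol W 0 t = 1 / (q - inverse q) + (\<theta> 1 - 1) * (x0 * v1 + x1 * v0) * t\<^sup>2"
proof -
  have "symbol W 0 t = \<theta> 1 * ((x0 + x1 * \<theta> (- 1) * t) * (v0 + v1 * \<theta> (- 1) * t) * (1 - t)) -
      (v0 + v1 * t) * (1 - \<theta> 1 * t) * (x0 + x1 * t)"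
    by (simp add: W_def X_def Y_def mult.assoc)
  also have "\<dots> = (\<theta> 1 - 1) * (x0 * v0) + (\<theta> 1 - 1) * (x0 * v1 + x1 * v0) * t\<^sup>2"
    using cross by (elim disjE) (simp_all add: \<theta>_1 \<theta>_minus_1 field_simps power2_eq_square)
  finally show ?thesis by (simp only: norm)
qed

text \<open>The terms with \<open>a\<close> between \<open>X\<close> and \<open>Y\<close> cancel,
  because \<open>dilate (- 1) Y\<close> and \<open>dilate 1 X\<close> carry the same factor
  \<open>\<theta> 1\<close>.\<close>

lemma e_f_commutator: "e (f a) - f (e a) = W * dilate (- 1) a - dilate 1 a * W"
  by (simp add: e_def f_def W_def dilate_mult dilate_diff dilate_X dilate_Y dilate_dilate
      algebra_simps sc_left_commute[of a] sc_left_commute[of X] sc_left_commute[of Y]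
      sc_left_commute[of "dilate 1 a"])

sublocale uq_action q "dilate (- 1)" "dilate 1" e f
proof
  have dilate: "linear_mod (dilate d)" for d
    by (rule linear_modI)
      (auto simp: dilate_add dilate_scale equiv_mod_symbol_iff fun_eq_iff symbol_dilate)
  show "linear_mod (dilate (- 1))" "linear_mod (dilate 1)" by (rule dilate)+
  show "linear_mod e"
  proof (rule linear_modI)
    show "e a \<approx> e b" if "a \<approx> b" for a b
      unfolding e_def
      by (intro equiv_mod_diff equiv_mod_left equiv_mod_right linear_mod_cong[OF dilate] that)
  qed (simp_all add: e_def dilate_add dilate_scale algebra_simps sc_left_commute[of X])
  show "linear_mod f"
  proof (rule linear_modI)
    show "f a \<approx> f b" if "a \<approx> b" for a b
      unfolding f_def
      by (intro equiv_mod_diff equiv_mod_left equiv_mod_right linear_mod_cong[OF dilate] that)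
  qed (simp_all add: f_def dilate_add dilate_scale algebra_simps sc_left_commute[of Y])
  fix a b
  show "dilate (- 1) (dilate 1 a) \<approx> a" "dilate 1 (dilate (- 1) a) \<approx> a"
    by (simp_all add: dilate_dilate)
  show "dilate (- 1) (a * b) \<approx> dilate (- 1) a * dilate (- 1) b"
    by (simp add: dilate_mult)
  show "dilate (- 1) (e a) \<approx> sc (q\<^sup>2) * e (dilate (- 1) a)"
    by (simp add: e_def dilate_mult dilate_diff dilate_X \<theta>_minus_1 algebra_simps
        sc_left_commute[of "dilate (- 1) a"])
  show "dilate (- 1) (f a) \<approx> sc (inverse (q\<^sup>2)) * f (dilate (- 1) a)"
    by (simp add: f_def dilate_mult dilate_diff dilate_Y dilate_dilate \<theta>_1 algebra_simps
        sc_left_commute[of a])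
  show "e (a * b) \<approx> a * e b + e a * dilate (- 1) b"
    by (simp add: e_def dilate_mult algebra_simps)
  show "f (a * b) \<approx> f a * b + dilate 1 a * f b"
    by (simp add: f_def dilate_mult algebra_simps)
  have "symbol (W * dilate (- 1) a - dilate 1 a * W) k t =
      1 / (q - inverse q) * (\<theta> (- k) * symbol a k t - \<theta> k * symbol a k t)" for k t
  proof -
    define c w where "c = 1 / (q - inverse q)" and "w = (\<theta> 1 - 1) * (x0 * v1 + x1 * v0)"
    have "symbol (W * dilate (- 1) a - dilate 1 a * W) k t =
        (c + w * (\<theta> k * t)\<^sup>2) * (\<theta> (- k) * symbol a k t) - \<theta> k * symbol a k t * (c + w * t\<^sup>2)"
      by (simp add: symbol_mult_homog_left[OF homog_W] symbol_mult_homog_right[OF homog_W]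
          symbol_dilate symbol_W c_def w_def)
    also have "\<dots> = c * (\<theta> (- k) * symbol a k t - \<theta> k * symbol a k t) +
        (\<theta> (- k) * (\<theta> k * t)\<^sup>2 - \<theta> k * t\<^sup>2) * (w * symbol a k t)"
      by (simp add: algebra_simps)
    \<comment> \<open>So the quadratic part of \<open>W\<close> drops out: passing y^2 across degree
      k costs \<open>\<theta> (2 * k)\<close>, exactly the ratio of \<open>dilate 1\<close> to
      \<open>dilate (- 1)\<close>.\<close>
    also have "\<theta> (- k) * (\<theta> k * t)\<^sup>2 = \<theta> k * t\<^sup>2"
      by (simp add: \<theta>_minus power2_eq_square)
    finally show ?thesis by (simp add: c_def)
  qed
  then show "e (f a) - f (e a) \<approx> sc (1 / (q - inverse q)) * (dilate (- 1) a - dilate 1 a)"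
    unfolding e_f_commutator by (simp add: equiv_mod_symbol_iff fun_eq_iff symbol_dilate)
qed

section \<open>The symmetry of jump 1 and its values on the generators\<close>

lemma inner_symmetry:
  "symmetry (uq_class q (gen K_gen)) (disc_class q a) = disc_class q (dilate (- 1) a)"
  "symmetry (uq_class q (gen E_gen)) (disc_class q a) = disc_class q (e a)"
  "symmetry (uq_class q (gen F_gen)) (disc_class q a) = disc_class q (f a)"
  by (simp_all add: symmetry_gen)

lemma grading_jump_inner: "grading_jump q symmetry 1"
proof -
  have "grading_jump q symmetry 1 \<longleftrightarrow> \<not> (\<forall>a. e a \<approx> 0 \<and> f a \<approx> 0) \<and>
      (\<forall>k a. homog k a \<longrightarrow> homog (k + 1) (e a) \<and> homog (k - 1) (f a))"
    by (rule grading_jump_iff) (simp_all add: inner_symmetry)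
  \<comment> \<open>Otherwise k and its inverse would act alike, which the weight of
    \<open>z\<close> forbids.\<close>
  moreover have "\<not> (\<forall>a. e a \<approx> 0 \<and> f a \<approx> 0)"
  proof
    assume *: "\<forall>a. e a \<approx> 0 \<and> f a \<approx> 0"
    then have "dilate (- 1) z \<approx> dilate 1 z"
      by (intro \<kappa>_eq_\<kappa>') blast
    then have "\<theta> (- 1) = \<theta> 1"
      using equiv_mod_symbol[THEN fun_cong[of _ _ 1], THEN fun_cong[of _ _ 0]] by fastforce
    then have "\<theta> (1 - (- 1)) = 1"
      unfolding \<theta>_diff by simp
    then show False by (simp add: \<theta>_eq_1_iff)
  qed
  moreover have "homog (k + 1) (e a) \<and> homog (k - 1) (f a)" if "homog k a" for k a
    using homog_mult[OF homog_X homog_dilate[OF that]] homog_mult[OF that homog_X]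
      homog_mult[OF homog_Y that] homog_mult[OF homog_dilate[OF that] homog_Y]
    unfolding e_def f_def by (auto intro!: homog_diff simp: add.commute)
  ultimately show ?thesis by blast
qed

text \<open>The contribution of \<open>x1\<close> cancels: moving \<open>y\<close> past
  \<open>z\<close> costs \<open>\<theta> 1\<close>, the inverse of the weight of
  \<open>z\<close>.\<close>

lemma e_z: "disc_class q (e z) = disc_class q (sc (x0 * (q\<^sup>2 - 1)) * z\<^sup>2)"
  unfolding disc_class_eq_iff
  by (intro ext) (auto simp: e_def X_def mult.assoc power2_eq_square \<theta>_1 \<theta>_minus_1 field_simps)

lemma e_zs: "disc_class q (e zs) =
    disc_class q (sc ((\<theta> 1 - 1) * x0) + sc ((\<theta> 1 - 1) * x1) * y\<^sup>2)"
  unfolding disc_class_eq_iff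
  by (intro ext) (auto simp: e_def X_def mult.assoc power2_eq_square \<theta>_1 \<theta>_minus_1 field_simps)

lemma e_y: "disc_class q (e y) =
    disc_class q (z * (sc ((1 - \<theta> 1) * x0) * y + sc ((1 - \<theta> 1) * x1) * y\<^sup>2))"
  unfolding disc_class_eq_iff
  by (intro ext) (auto simp: e_def X_def dilate_y mult.assoc power2_eq_square \<theta>_1 \<theta>_minus_1 field_simps)

lemma f_z: "disc_class q (f z) =
    disc_class q (sc ((1 - \<theta> 1) * v0) + sc ((1 - \<theta> 1) * v1) * y\<^sup>2)"
  unfolding disc_class_eq_iff
  by (intro ext) (auto simp: f_def Y_def mult.assoc power2_eq_square \<theta>_1 \<theta>_minus_1 field_simps)

text \<open>The contribution of \<open>v1\<close> cancels, since moving \<open>y\<close> past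
  \<open>zs\<close> costs the same factor as \<open>dilate 1\<close> on \<open>zs\<close>.\<close>

lemma f_zs: "disc_class q (f zs) = disc_class q (sc (v0 * (1 - q\<^sup>2)) * zs\<^sup>2)"
  unfolding disc_class_eq_iff
proof (intro ext)
  fix k t
  have "\<theta> (- 2) = q\<^sup>2 * q\<^sup>2"
    using \<theta>_add[of "- 1" "- 1"] by (simp add: \<theta>_minus_1)
  then show "symbol (f zs) k t = symbol (sc (v0 * (1 - q\<^sup>2)) * zs\<^sup>2) k t"
    by (cases "k = - 2")
      (auto simp: f_def Y_def mult.assoc power2_eq_square \<theta>_minus_1 algebra_simps)
qed

lemma f_y: "disc_class q (f y) =
    disc_class q ((sc ((\<theta> 1 - 1) * v0) * y + sc ((\<theta> 1 - 1) * v1) * y\<^sup>2) * zs)"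
  unfolding disc_class_eq_iff
  by (intro ext) (auto simp: f_def Y_def dilate_y mult.assoc power2_eq_square \<theta>_1 \<theta>_minus_1 field_simps)

end

theorem theorem4p1:
  fixes q :: complex
  assumes "q \<noteq> 0" and "\<And>m::nat. m > 0 \<Longrightarrow> q ^ m \<noteq> 1"
  shows
    "let k = uq_class q (gen K_gen); e = uq_class q (gen E_gen); f = uq_class q (gen F_gen);
         cl = disc_class q; z = gen Z_gen; zs = gen Zstar_gen; y = 1 - z * zs in
     \<not> (\<exists>\<pi> n. disc_symmetry q \<pi> \<and> grading_jump q \<pi> n \<and> n > 1) \<and>
     (\<forall>b\<^sub>0 b\<^sub>1. b\<^sub>0 \<noteq> 0 \<longrightarrow>
       (\<exists>\<pi>. disc_symmetry q \<pi> \<and> grading_jump q \<pi> 1 \<and>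
          \<pi> k (cl z) = cl (sc (q\<^sup>2) * z) \<and>
          \<pi> k (cl zs) = cl (sc (inverse (q\<^sup>2)) * zs) \<and>
          \<pi> e (cl y) = cl (sc (inverse q * inverse b\<^sub>0) * z * y) \<and>
          \<pi> f (cl y) = cl ((sc b\<^sub>0 * y + sc b\<^sub>1 * y\<^sup>2) * zs) \<and>
          \<pi> e (cl z) = cl (sc (q * inverse b\<^sub>0) * z\<^sup>2) \<and>
          \<pi> f (cl z) = cl (- sc b\<^sub>0 - sc b\<^sub>1 * y\<^sup>2) \<and>
          \<pi> e (cl zs) = cl (- sc (inverse q * inverse b\<^sub>0)) \<and>
          \<pi> f (cl zs) = cl (sc (q\<^sup>2 * b\<^sub>0) * zs\<^sup>2))) \<and>
     (\<forall>a\<^sub>0 a\<^sub>1. a\<^sub>0 \<noteq> 0 \<longrightarrow>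
       (\<exists>\<pi>. disc_symmetry q \<pi> \<and> grading_jump q \<pi> 1 \<and>
          \<pi> k (cl z) = cl (sc (q\<^sup>2) * z) \<and>
          \<pi> k (cl zs) = cl (sc (inverse (q\<^sup>2)) * zs) \<and>
          \<pi> e (cl y) = cl (z * (sc a\<^sub>0 * y + sc a\<^sub>1 * y\<^sup>2)) \<and>
          \<pi> f (cl y) = cl (sc (inverse q * inverse a\<^sub>0) * y * zs) \<and>
          \<pi> e (cl z) = cl (sc (q\<^sup>2 * a\<^sub>0) * z\<^sup>2) \<and>
          \<pi> f (cl z) = cl (- sc (inverse q * inverse a\<^sub>0)) \<and>
          \<pi> e (cl zs) = cl (- sc a\<^sub>0 - sc a\<^sub>1 * y\<^sup>2) \<and>
          \<pi> f (cl zs) = cl (sc (q * inverse a\<^sub>0) * zs\<^sup>2)))"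
proof -
  interpret quantum_disc q
    using assms by unfold_locales
  have q: "q - inverse q \<noteq> 0" "\<theta> 1 - 1 \<noteq> 0" "1 - \<theta> 1 \<noteq> 0"
    using assms(2)[of 2] assms(1) \<theta>_eq_1_iff[of 1] by (auto simp: field_simps power2_eq_square)
  \<comment> \<open>Factoring out \<open>q - inverse q\<close> lets it cancel against the
    denominators of the parameters chosen below.\<close>
  have \<theta>_q: "1 - \<theta> 1 = inverse q * (q - inverse q)" "\<theta> 1 - 1 = - (inverse q * (q - inverse q))"
    "q\<^sup>2 - 1 = q * (q - inverse q)" "1 - q\<^sup>2 = - (q * (q - inverse q))"
    by (simp_all add: \<theta>_1 field_simps power2_eq_square)
  have no: "\<not> (\<exists>\<pi> n. disc_symmetry q \<pi> \<and> grading_jump q \<pi> n \<and> n > 1)"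
    using no_large_jump by force
  have dilations: "disc_class q (dilate (- 1) z) = disc_class q (sc (q\<^sup>2) * z)"
    "disc_class q (dilate (- 1) zs) = disc_class q (sc (inverse (q\<^sup>2)) * zs)"
    by (simp_all add: \<theta>_1 \<theta>_minus_1)
  have a: "\<exists>\<pi>. disc_symmetry q \<pi> \<and> grading_jump q \<pi> 1 \<and>
      \<pi> (uq_class q (gen K_gen)) (disc_class q z) = disc_class q (sc (q\<^sup>2) * z) \<and>
      \<pi> (uq_class q (gen K_gen)) (disc_class q zs) = disc_class q (sc (inverse (q\<^sup>2)) * zs) \<and>
      \<pi> (uq_class q (gen E_gen)) (disc_class q y) = disc_class q (sc (inverse q * inverse b0) * z * y) \<and>
      \<pi> (uq_class q (gen F_gen)) (disc_class q y) = disc_class q ((sc b0 * y + sc b1 * y\<^sup>2) * zs) \<and>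
      \<pi> (uq_class q (gen E_gen)) (disc_class q z) = disc_class q (sc (q * inverse b0) * z\<^sup>2) \<and>
      \<pi> (uq_class q (gen F_gen)) (disc_class q z) = disc_class q (- sc b0 - sc b1 * y\<^sup>2) \<and>
      \<pi> (uq_class q (gen E_gen)) (disc_class q zs) = disc_class q (- sc (inverse q * inverse b0)) \<and>
      \<pi> (uq_class q (gen F_gen)) (disc_class q zs) = disc_class q (sc (q\<^sup>2 * b0) * zs\<^sup>2)"
    if b0: "b0 \<noteq> 0" for b0 b1
  proof -
    \<comment> \<open>\<open>v0\<close> and \<open>v1\<close> are read off the value required for
      \<open>f z\<close>; \<open>x0\<close> is then fixed by \<open>norm\<close>.\<close>
    define x0 v0 v1 where "x0 = 1 / (b0 * (q - inverse q))"
      and "v0 = b0 / (\<theta> 1 - 1)" and "v1 = b1 / (\<theta> 1 - 1)"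
    interpret inner_action q x0 0 v0 v1
      by unfold_locales (use b0 q in \<open>simp_all add: x0_def v0_def\<close>)
    have coeffs: "(1 - \<theta> 1) * x0 = inverse q * inverse b0" "(\<theta> 1 - 1) * x0 = - (inverse q * inverse b0)"
      "x0 * (q\<^sup>2 - 1) = q * inverse b0"
      using b0 q(1) unfolding x0_def \<theta>_q by (simp_all add: field_simps)
    have coeffs': "(\<theta> 1 - 1) * v0 = b0" "(\<theta> 1 - 1) * v1 = b1"
      "(1 - \<theta> 1) * v0 = - b0" "(1 - \<theta> 1) * v1 = - b1"
      using q(2) unfolding v0_def v1_def by (simp_all add: field_simps)
    have coeffs'': "v0 * (1 - q\<^sup>2) = q\<^sup>2 * b0"
      using q(1) assms(1) unfolding v0_def \<theta>_q by (simp add: field_simps power2_eq_square)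
    show ?thesis
      by (intro exI[of _ symmetry] conjI disc_symmetry_symmetry grading_jump_inner;
          unfold inner_symmetry dilations e_z e_zs e_y f_z f_zs f_y coeffs coeffs' coeffs'')
        (simp_all add: sc_uminus mult.assoc sc_left_commute[of z])
  qed
  have b: "\<exists>\<pi>. disc_symmetry q \<pi> \<and> grading_jump q \<pi> 1 \<and>
      \<pi> (uq_class q (gen K_gen)) (disc_class q z) = disc_class q (sc (q\<^sup>2) * z) \<and>
      \<pi> (uq_class q (gen K_gen)) (disc_class q zs) = disc_class q (sc (inverse (q\<^sup>2)) * zs) \<and>
      \<pi> (uq_class q (gen E_gen)) (disc_class q y) = disc_class q (z * (sc a0 * y + sc a1 * y\<^sup>2)) \<and>
      \<pi> (uq_class q (gen F_gen)) (disc_class q y) = disc_class q (sc (inverse q * inverse a0) * y * zs) \<and>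
      \<pi> (uq_class q (gen E_gen)) (disc_class q z) = disc_class q (sc (q\<^sup>2 * a0) * z\<^sup>2) \<and>
      \<pi> (uq_class q (gen F_gen)) (disc_class q z) = disc_class q (- sc (inverse q * inverse a0)) \<and>
      \<pi> (uq_class q (gen E_gen)) (disc_class q zs) = disc_class q (- sc a0 - sc a1 * y\<^sup>2) \<and>
      \<pi> (uq_class q (gen F_gen)) (disc_class q zs) = disc_class q (sc (q * inverse a0) * zs\<^sup>2)"
    if a0: "a0 \<noteq> 0" for a0 a1
  proof -
    \<comment> \<open>Here \<open>x0\<close> and \<open>x1\<close> come from the value required for
      \<open>e zs\<close>, and \<open>v0\<close> from \<open>norm\<close>.\<close>
    define x0 x1 v0 where "x0 = a0 / (1 - \<theta> 1)" and "x1 = a1 / (1 - \<theta> 1)"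
      and "v0 = - 1 / (a0 * (q - inverse q))"
    have norm: "(\<theta> 1 - 1) * (x0 * v0) = 1 / (q - inverse q)"
    proof -
      have "(\<theta> 1 - 1) * x0 = - a0" using q(3) unfolding x0_def by (simp add: field_simps)
      then show ?thesis using a0 q(1) unfolding v0_def mult.assoc[symmetric] by simp
    qed
    interpret inner_action q x0 x1 v0 0
      by unfold_locales (simp_all add: norm)
    have coeffs: "(1 - \<theta> 1) * v0 = - (inverse q * inverse a0)" "(\<theta> 1 - 1) * v0 = inverse q * inverse a0"
      "v0 * (1 - q\<^sup>2) = q * inverse a0"
      using a0 q(1) unfolding v0_def \<theta>_q by (simp_all add: field_simps)
    have coeffs': "(\<theta> 1 - 1) * x0 = - a0" "(\<theta> 1 - 1) * x1 = - a1"
      "(1 - \<theta> 1) * x0 = a0" "(1 - \<theta> 1) * x1 = a1"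
      using q(3) unfolding x0_def x1_def by (simp_all add: field_simps)
    have coeffs'': "x0 * (q\<^sup>2 - 1) = q\<^sup>2 * a0"
      using q(1) assms(1) unfolding x0_def \<theta>_q by (simp add: field_simps power2_eq_square)
    show ?thesis
      by (intro exI[of _ symmetry] conjI disc_symmetry_symmetry grading_jump_inner;
          unfold inner_symmetry dilations e_z e_zs e_y f_z f_zs f_y coeffs coeffs' coeffs'')
        (simp_all add: sc_uminus mult.assoc sc_left_commute[of z])
  qed
  show ?thesis
    unfolding Let_def using no a b by blast
qed

end
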